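(* Let $T>0$ and $\alpha\in(0,1)$. Let $X$ be a separable, reflexive Banach space that is compactly and densely embedded in the separable Hilbert space $H$, with $H$ identified with its dual so that $(X,H,X')$ is a Gelfand triple. Let $u_0\in H$, let $\mathcal{E}\in C^1(X;\mathbb{R})$, and assume there are $p>1$ and positive constants $C_0,C_1,C_2<\infty$ such that $$\|\nabla_H\mathcal{E}(u)\|_{X'}\le C_0\|u\|_X^{p-1}+C_0,\qquad \delta\mathcal{E}(u,u)\ge C_1\|u\|_X^p-C_2\|u\|_H^2\qquad\text{for all }u\in X,$$ and that the realization of $\nabla_H\mathcal{E}$ as an operator from $L^p(0,T;X)$ to $L^{p'}(0,T;X')$, $\frac1p+\frac1{p'}=1$, is weak-to-weak continuous. Let $u$ be a solution to the variational form of the time-fractional gradient flow $\partial_t^\alpha u=-\nabla_H\mathcal{E}(u)$, $u(0)=u_0$. Then the augmented energy $$\mathcal{E}^{\mathrm{aug}}(u)=\mathcal{E}(u)+\mathcal{H}(\mathcal{G}\{u\})$$ is monotonically decreasing (i.e. non-increasing) in time.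
   Context: $\delta\mathcal{E}(u,v)=\lim_{h\to0}\frac{\mathcal{E}(u+hv)-\mathcal{E}(u)}{h}$ is the Gâteaux derivative of $\mathcal{E}$, and $\nabla_H\mathcal{E}:X\to X'$ is defined by $\langle\nabla_H\mathcal{E}(u),v\rangle_{X'\times X}=\delta\mathcal{E}(u,v)$ for all $v\in X$; the pairing $\langle\cdot,\cdot\rangle_{X'\times X}$ extends the inner product of $H$. For $\alpha>0$, $g_\alpha(t)=t^{\alpha-1}/\Gamma(\alpha)$, and $*$ is convolution in time on the positive half-line. The Caputo derivative of order $\alpha\in(0,1)$ is $\partial_t^\alpha u=g_{1-\alpha}*\partial_tu$ for absolutely continuous $u$; for less regular $u$ with initial datum $u_0$ it is understood as $\partial_t\big(g_{1-\alpha}*(u-u_0)\big)$ in the distributional sense. $W^{\alpha,q}(0,T;Z)$ is the space of $u\in L^q(0,T;Z)$ with $\partial_t^\alpha u\in L^q(0,T;Z)$. Variational form: $u\in L^p(0,T;X)\cap L^\infty(0,T;H)\cap W^{\alpha,p'}(0,T;X')$ with $g_{1-\alpha}*(u-u_0)\in C([0,T];H)$ satisfies $\langle\partial_t^\alpha u+\nabla_H\mathcal{E}(u),v\rangle_{X'\times X}=0$ for all $v\in X$ (a.e. in $(0,T)$), with $(g_{1-\alpha}*(u-u_0))(t)\to0$ in $H$ as $t\to0$. With $c_0(\theta)=\frac1{1-\theta}$, $c_1(\theta)=\frac\theta{1-\theta}$ and $w_\alpha(\theta)=g_{1-\alpha}(\theta)g_\alpha(1-\theta)$ for $\theta\in(0,1)$,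 $$\mathcal{G}\{u\}(t,\theta)=-c_0(\theta)\int_0^te^{-c_1(\theta)(t-s)}\nabla_H\mathcal{E}(u(s))\,\mathrm{d}s,\qquad \mathcal{H}(\tilde v)=\frac12\int_0^1\theta\,w_\alpha(\theta)\|\tilde v(\theta)\|_H^2\,\mathrm{d}\theta.$$ The augmented energy at time $t$ is $\mathcal{E}(u(t))+\mathcal{H}(\mathcal{G}\{u\}(t,\cdot))$. *)

theory Defs
  imports "HOL-Analysis.Analysis"
begin

text \<open>
  \<open>X\<close> and \<open>H\<close> are types, the inclusion of \<open>X\<close> in \<open>H\<close> is a bounded linear map \<open>\<iota>\<close>, the dual \<open>X'\<close>
  is \<open>'x \<Rightarrow>\<^sub>L real\<close> with its operator norm, and the duality pairing is \<open>blinfun_apply\<close>.  Separability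
  of \<open>X\<close> and \<open>H\<close> is expressed by the class \<open>second_countable_topology\<close>, which is equivalent to it
  on metric spaces.
\<close>

definition reflexive :: "'x::real_normed_vector itself \<Rightarrow> bool" where
  "reflexive _ \<longleftrightarrow>
     (\<forall>\<Phi> :: ('x \<Rightarrow>\<^sub>L real) \<Rightarrow>\<^sub>L real. \<exists>x::'x. \<forall>\<xi>. blinfun_apply \<Phi> \<xi> = blinfun_apply \<xi> x)"

definition compact_dense_embedding ::
    "('x::real_normed_vector \<Rightarrow>\<^sub>L 'h::real_normed_vector) \<Rightarrow> bool" where
  "compact_dense_embedding \<iota> \<longleftrightarrow>
     inj (blinfun_apply \<iota>) \<and>
     compact (closure (blinfun_apply \<iota> ` ball 0 1)) \<and>
     closure (range (blinfun_apply \<iota>)) = UNIV"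

text \<open>The embedding of \<open>H\<close> in \<open>X'\<close>: \<open>h\<close> acts on \<open>v \<in> X\<close> as the inner product of \<open>h\<close> and \<open>\<iota> v\<close>.\<close>

definition dual_emb ::
    "('x::real_normed_vector \<Rightarrow>\<^sub>L 'h::real_inner) \<Rightarrow> 'h \<Rightarrow> ('x \<Rightarrow>\<^sub>L real)" where
  "dual_emb \<iota> h = blinfun_inner_right h o\<^sub>L \<iota>"

text \<open>The norm of \<open>H\<close> on \<open>X'\<close>, with value \<open>\<infinity>\<close> at functionals that do not belong to \<open>H\<close>.\<close>

definition ext_norm_H ::
    "('x::real_normed_vector \<Rightarrow>\<^sub>L 'h::real_inner) \<Rightarrow> ('x \<Rightarrow>\<^sub>L real) \<Rightarrow> ennreal" where
  "ext_norm_H \<iota> \<xi> =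
     (if \<xi> \<in> range (dual_emb \<iota>) then ennreal (norm (THE h. dual_emb \<iota> h = \<xi>)) else \<infinity>)"

definition C1_functional :: "('x::real_normed_vector \<Rightarrow> real) \<Rightarrow> bool" where
  "C1_functional E \<longleftrightarrow>
     (\<exists>E' :: 'x \<Rightarrow> ('x \<Rightarrow>\<^sub>L real).
        (\<forall>u. (E has_derivative blinfun_apply (E' u)) (at u)) \<and> continuous_on UNIV E')"

definition gateaux :: "('x::real_normed_vector \<Rightarrow> real) \<Rightarrow> 'x \<Rightarrow> 'x \<Rightarrow> real" where
  "gateaux E u v = Lim (at 0) (\<lambda>h::real. (E (u + h *\<^sub>R v) - E u) / h)"

definition grad_H :: "('x::real_normed_vector \<Rightarrow> real) \<Rightarrow> 'x \<Rightarrow> ('x \<Rightarrow>\<^sub>L real)" where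
  "grad_H E u = (THE \<xi>. \<forall>v. blinfun_apply \<xi> v = gateaux E u v)"

text \<open>
  Elements are functions rather than equivalence classes.  All target spaces that occur (\<open>X\<close>, \<open>H\<close>,
  and \<open>X'\<close> for separable reflexive \<open>X\<close>) are separable, so that Borel measurability with respect
  to the Lebesgue sigma-algebra is strong measurability.  Time integrals with values in
  a Banach space are written with \<open>integral\<close>, which does not require a class of separable
  spaces (there is no such instance for \<open>'x \<Rightarrow>\<^sub>L real\<close>) and agrees with the Bochner integral on
  Bochner integrable functions.
\<close>

abbreviation time_measure :: "real \<Rightarrow> real measure" where
  "time_measure T \<equiv> lebesgue_on {0<..<T}"

definition Lp_space :: "real \<Rightarrow> real \<Rightarrow> (real \<Rightarrow> 'z::real_normed_vector) set" where
  "Lp_space p T = {f. f \<in> borel_measurable (time_measure T) \<and>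
                      integrable (time_measure T) (\<lambda>t. norm (f t) powr p)}"

definition Lp_norm :: "real \<Rightarrow> real \<Rightarrow> (real \<Rightarrow> 'z::real_normed_vector) \<Rightarrow> real" where
  "Lp_norm p T f = (LINT t|time_measure T. norm (f t) powr p) powr (1 / p)"

definition Linf_space :: "real \<Rightarrow> (real \<Rightarrow> 'z::real_normed_vector) set" where
  "Linf_space T = {f. f \<in> borel_measurable (time_measure T) \<and>
                      (\<exists>C. AE t in time_measure T. norm (f t) \<le> C)}"

text \<open>The bound forces \<open>\<Phi>\<close> to respect equality a.e., so these are the elements of the dual of \<open>L\<^sup>p(0,T;Z)\<close>.\<close>

definition Lp_functional ::
    "real \<Rightarrow> real \<Rightarrow> ((real \<Rightarrow> 'z::real_normed_vector) \<Rightarrow> real) \<Rightarrow> bool" where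
  "Lp_functional p T \<Phi> \<longleftrightarrow>
     (\<forall>f \<in> Lp_space p T. \<forall>g \<in> Lp_space p T. \<Phi> (\<lambda>t. f t + g t) = \<Phi> f + \<Phi> g) \<and>
     (\<forall>c. \<forall>f \<in> Lp_space p T. \<Phi> (\<lambda>t. c *\<^sub>R f t) = c * \<Phi> f) \<and>
     (\<exists>C. \<forall>f \<in> Lp_space p T. \<bar>\<Phi> f\<bar> \<le> C * Lp_norm p T f)"

definition Lp_weakly_converges ::
    "real \<Rightarrow> real \<Rightarrow> (nat \<Rightarrow> real \<Rightarrow> 'z::real_normed_vector) \<Rightarrow> (real \<Rightarrow> 'z) \<Rightarrow> bool" where
  "Lp_weakly_converges p T fs f \<longleftrightarrow>
     (\<forall>\<Phi>. Lp_functional p T \<Phi> \<longrightarrow> (\<lambda>n. \<Phi> (fs n)) \<longlonglongrightarrow> \<Phi> f)"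

text \<open>
  Continuity is sequential; it is implied by continuity with respect to the weak topologies.
\<close>

definition weak_to_weak_continuous ::
    "real \<Rightarrow> real \<Rightarrow> real \<Rightarrow> ('y::real_normed_vector \<Rightarrow> 'z::real_normed_vector) \<Rightarrow> bool" where
  "weak_to_weak_continuous p q T A \<longleftrightarrow>
     (\<forall>u \<in> Lp_space p T. (\<lambda>t. A (u t)) \<in> Lp_space q T) \<and>
     (\<forall>us. \<forall>u \<in> Lp_space p T. (\<forall>n. us n \<in> Lp_space p T) \<longrightarrow> Lp_weakly_converges p T us u \<longrightarrow>
        Lp_weakly_converges q T (\<lambda>n t. A (us n t)) (\<lambda>t. A (u t)))"

definition g_ker :: "real \<Rightarrow> real \<Rightarrow> real" where
  "g_ker \<alpha> t = t powr (\<alpha> - 1) / Gamma \<alpha>"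

definition conv :: "(real \<Rightarrow> real) \<Rightarrow> (real \<Rightarrow> 'z::real_normed_vector) \<Rightarrow> real \<Rightarrow> 'z" where
  "conv k f t = integral {0..t} (\<lambda>s. k (t - s) *\<^sub>R f s)"

definition test_function :: "real \<Rightarrow> (real \<Rightarrow> real) \<Rightarrow> bool" where
  "test_function T \<phi> \<longleftrightarrow>
     (\<forall>n x. (deriv ^^ n) \<phi> field_differentiable at x) \<and>
     (\<exists>K. compact K \<and> K \<subseteq> {0<..<T} \<and> (\<forall>t. t \<notin> K \<longrightarrow> \<phi> t = 0))"

text \<open>
  \<open>z \<in> L\<^sup>1(0,T;Z)\<close> is the distributional time derivative of \<open>g\<^bsub>1-\<alpha>\<^esub> * (u - u\<^sub>0)\<close>.
\<close>

definition has_caputo_derivative ::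
    "real \<Rightarrow> real \<Rightarrow> 'z::real_normed_vector \<Rightarrow> (real \<Rightarrow> 'z) \<Rightarrow> (real \<Rightarrow> 'z) \<Rightarrow> bool" where
  "has_caputo_derivative \<alpha> T u0 u z \<longleftrightarrow>
     z \<in> Lp_space 1 T \<and>
     (\<forall>\<phi>. test_function T \<phi> \<longrightarrow>
        integral {0..T} (\<lambda>t. \<phi> t *\<^sub>R z t) =
        - integral {0..T} (\<lambda>t. deriv \<phi> t *\<^sub>R conv (g_ker (1 - \<alpha>)) (\<lambda>s. u s - u0) t))"

definition frac_sobolev ::
    "real \<Rightarrow> real \<Rightarrow> real \<Rightarrow> 'z::real_normed_vector \<Rightarrow> (real \<Rightarrow> 'z) set" where
  "frac_sobolev \<alpha> q T u0 =
     {u \<in> Lp_space q T. \<exists>z \<in> Lp_space q T. has_caputo_derivative \<alpha> T u0 u z}"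

definition variational_solution ::
    "('x::real_normed_vector \<Rightarrow>\<^sub>L 'h::real_inner) \<Rightarrow> ('x \<Rightarrow> real) \<Rightarrow> real \<Rightarrow> real \<Rightarrow> real \<Rightarrow> 'h \<Rightarrow>
     (real \<Rightarrow> 'x) \<Rightarrow> bool" where
  "variational_solution \<iota> E \<alpha> p T u0 u \<longleftrightarrow>
     u \<in> Lp_space p T \<and>
     (\<lambda>t. blinfun_apply \<iota> (u t)) \<in> Linf_space T \<and>
     (\<lambda>t. dual_emb \<iota> (blinfun_apply \<iota> (u t))) \<in> frac_sobolev \<alpha> (p / (p - 1)) T (dual_emb \<iota> u0) \<and>
     (\<exists>z. has_caputo_derivative \<alpha> T (dual_emb \<iota> u0) (\<lambda>t. dual_emb \<iota> (blinfun_apply \<iota> (u t))) z \<and>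
          (\<forall>v. AE t in time_measure T. blinfun_apply (z t + grad_H E (u t)) v = 0)) \<and>
     continuous_on {0..T} (conv (g_ker (1 - \<alpha>)) (\<lambda>s. blinfun_apply \<iota> (u s) - u0)) \<and>
     (conv (g_ker (1 - \<alpha>)) (\<lambda>s. blinfun_apply \<iota> (u s) - u0) \<longlongrightarrow> 0) (at_right 0)"

definition c0 :: "real \<Rightarrow> real" where
  "c0 \<theta> = 1 / (1 - \<theta>)"

definition c1 :: "real \<Rightarrow> real" where
  "c1 \<theta> = \<theta> / (1 - \<theta>)"

definition w_weight :: "real \<Rightarrow> real \<Rightarrow> real" where
  "w_weight \<alpha> \<theta> = g_ker (1 - \<alpha>) \<theta> * g_ker \<alpha> (1 - \<theta>)"

definition G_aug ::
    "('x::real_normed_vector \<Rightarrow> real) \<Rightarrow> (real \<Rightarrow> 'x) \<Rightarrow> real \<Rightarrow> real \<Rightarrow> ('x \<Rightarrow>\<^sub>L real)" where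
  "G_aug E u t \<theta> =
     - c0 \<theta> *\<^sub>R integral {0..t} (\<lambda>s. exp (- c1 \<theta> * (t - s)) *\<^sub>R grad_H E (u s))"

definition H_aug ::
    "('x::real_normed_vector \<Rightarrow>\<^sub>L 'h::real_inner) \<Rightarrow> real \<Rightarrow> (real \<Rightarrow> ('x \<Rightarrow>\<^sub>L real)) \<Rightarrow> ennreal" where
  "H_aug \<iota> \<alpha> v =
     ennreal (1 / 2) *
     (\<integral>\<^sup>+ \<theta>. ennreal (\<theta> * w_weight \<alpha> \<theta>) * (ext_norm_H \<iota> (v \<theta>))\<^sup>2 * indicator {0<..<1} \<theta> \<partial>lebesgue)"

definition augmented_energy ::
    "('x::real_normed_vector \<Rightarrow>\<^sub>L 'h::real_inner) \<Rightarrow> ('x \<Rightarrow> real) \<Rightarrow> real \<Rightarrow> (real \<Rightarrow> 'x) \<Rightarrow> real \<Rightarrow> ereal" where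
  "augmented_energy \<iota> E \<alpha> u t = ereal (E (u t)) + enn2ereal (H_aug \<iota> \<alpha> (G_aug E u t))"

end

theory Submission
  imports Defs
begin

text \<open>
  Weak continuity of the Nemytskii operator of \<open>\<nabla>\<^sub>H\<E>\<close> is so strong that it forces \<open>\<nabla>\<^sub>H\<E>\<close> to be affine:
  rapid oscillation in time between \<open>m + d\<close> and \<open>m - d\<close> converges weakly to \<open>m\<close>.  With the coercivity,
  \<open>\<nabla>\<^sub>H\<E>\<close> is a symmetric linear operator \<open>A\<close> that satisfies a Garding inequality.  As the embedding is compact,
  \<open>A\<close> is diagonal in an orthonormal basis of \<open>H\<close>, and the augmented energy of \<open>u\<close> is the sum of those of
  its coefficients \<open>y\<close>, which solve the scalar equations \<open>y = y\<^sub>0 - \<nu> g\<^bsub>\<alpha>\<^esub> * y\<close>.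

  In the scalar case, \<open>g\<^bsub>\<alpha>\<^esub>(t)\<close> is a superposition of the exponentials \<open>e\<^bsup>-\<sigma>t\<^esup>\<close> with a positive
  measure \<open>\<mu>\<close>.  The modes \<open>Z = e\<^bsup>-\<sigma>t\<^esup> * y\<close> satisfy \<open>Z' = y - \<sigma> Z\<close>, and \<open>y' = - \<nu> \<integral>Z' d\<mu>\<close>, so
  \<open>\<nu> y\<^sup>2 / 2 + \<nu>\<^sup>2 / 2 \<integral>\<sigma> Z\<^sup>2 d\<mu>\<close> has the derivative \<open>- \<nu>\<^sup>2 \<integral>Z'\<^sup>2 d\<mu> \<le> 0\<close>.
\<close>

section \<open>Integration\<close>

text \<open>The coercivity also excludes, near the origin, a constant term of the affine gradient,
  and by scaling every exponent \<open>p \<noteq> 2\<close> unless \<open>X\<close> is trivial; this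
  is how a Garding inequality with squares comes out. It bounds the eigenvalues only from below, so
  the scalar argument has to work for either sign of \<nu>. The measure is dictated by the weights:
  for \<open>\<sigma> = c1 \<theta>\<close> and the density
  \<open>w_weight \<alpha> \<theta> * c0 \<theta>\<close> one has
  \<open>c1 \<theta> * c0 \<theta> = \<theta> * (c0 \<theta>)\<^sup>2\<close>, so the history energy
  of a coefficient is exactly its \<sigma>-weighted term. The obstacle is regularity. A coefficient
  solves its equation only almost everywhere, its continuous representative has no derivative at
  hand, and \<mu> has infinite mass. The identity is therefore proved for averages over short time
  windows, for which differentiation and Fubini are legitimate, and passed to the limit. As the
  total history energy may be infinite, the modes are summed only after each scalar inequality, in
  the extended reals.\<close>

lemma fundamental_theorem_real:
  fixes f :: "real \<Rightarrow> real"
  assumes "a \<le> b" "\<And>x. x \<in> {a..b} \<Longrightarrow> (f has_real_derivative f' x) (at x)"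
  shows "(f' has_integral f b - f a) {a..b}"
  by (rule fundamental_theorem_of_calculus[OF assms(1)])
     (metis assms(2) has_real_derivative_iff_has_vector_derivative has_vector_derivative_at_within)

lemma continuous_bounded_on_Icc:
  fixes f :: "real \<Rightarrow> real"
  assumes "continuous_on UNIV f"
  obtains K where "\<And>s. s \<in> {a..b} \<Longrightarrow> \<bar>f s\<bar> \<le> K"
proof -
  have "compact (f ` {a..b})"
    using assms by (intro compact_continuous_image) (auto intro: continuous_on_subset)
  then show thesis
    by (metis that compact_imp_bounded bounded_real imageI)
qed

lemma exp_decay_has_integral:
  fixes c :: real
  assumes "c \<noteq> 0" "0 \<le> t"
  shows "((\<lambda>r. exp (- c * r)) has_integral (1 - exp (- c * t)) / c) {0..t}"
    and "((\<lambda>s. exp (- c * (t - s))) has_integral (1 - exp (- c * t)) / c) {0..t}"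
proof -
  have "((\<lambda>r. exp (- c * r)) has_integral - exp (- c * t) / c - - exp (- c * 0) / c) {0..t}"
    using assms by (intro fundamental_theorem_real) (auto intro!: derivative_eq_intros)
  then show "((\<lambda>r. exp (- c * r)) has_integral (1 - exp (- c * t)) / c) {0..t}"
    by (simp add: diff_divide_distrib)
  have "((\<lambda>s. exp (- c * (t - s))) has_integral exp (- c * (t - t)) / c - exp (- c * (t - 0)) / c) {0..t}"
    using assms by (intro fundamental_theorem_real) (auto intro!: derivative_eq_intros)
  then show "((\<lambda>s. exp (- c * (t - s))) has_integral (1 - exp (- c * t)) / c) {0..t}"
    by (simp add: diff_divide_distrib)
qed

text \<open>On a bounded time interval this puts \<open>L^p\<close> functions into
  \<open>L^1\<close>, with \<open>1 + norm (f t) powr p\<close> as majorant.\<close>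

lemma le_1_plus_powr:
  fixes x :: real
  assumes "x \<ge> 0" "p \<ge> 1"
  shows "x \<le> 1 + x powr p"
proof (cases "x \<le> 1")
  case False
  then have "x powr 1 \<le> x powr p" using assms by (intro powr_mono) auto
  then show ?thesis using False by simp
qed (simp add: add_increasing2)

lemma set_integrable_bounded_borel:
  fixes f :: "real \<Rightarrow> real"
  assumes [measurable]: "f \<in> borel_measurable borel" and bound: "\<And>t. t \<in> {a..b} \<Longrightarrow> \<bar>f t\<bar> \<le> K"
  shows "set_integrable lborel {a..b} f"
  unfolding set_integrable_def
proof (rule Bochner_Integration.integrable_bound)
  show "integrable lborel (\<lambda>s. indicator {a..b} s * K :: real)"
    by (intro integrable_mult_left integrable_real_indicator) (auto simp: emeasure_lborel_Icc_eq)
  show "AE s in lborel. norm (indicator {a..b} s *\<^sub>R f s) \<le> norm (indicator {a..b} s * K)"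
    using bound by (intro AE_I2) (auto simp: indicator_def intro: order_trans[OF _ abs_ge_self])
qed measurable

lemma bounded_borel_integrable_on:
  fixes f :: "real \<Rightarrow> real"
  assumes "f \<in> borel_measurable borel" and "\<And>t. \<bar>f t\<bar> \<le> K"
  shows "f integrable_on {a..b}"
  by (intro set_borel_integral_eq_integral(1) set_integrable_bounded_borel) (use assms in auto)

text \<open>Riemann sums of \<open>f\<close> and \<open>g\<close> over the same tagged division
  differ by at most the Riemann sum of \<open>h\<close>, which lies near its small integral; so the
  Cauchy criterion passes from \<open>g\<close> to \<open>f\<close>. The target is an arbitrary
  Banach space.\<close>

lemma integrable_on_cbox_approx:
  fixes f :: "'a::euclidean_space \<Rightarrow> 'b::banach"
  assumes approx: "\<And>\<epsilon>. \<epsilon> > 0 \<Longrightarrow> \<exists>g h. g integrable_on cbox a b \<and> h integrable_on cbox a b \<and>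
      (\<forall>x\<in>cbox a b. norm (f x - g x) \<le> h x) \<and> integral (cbox a b) h \<le> \<epsilon>"
  shows "f integrable_on cbox a b"
  unfolding integrable_Cauchy
proof safe
  fix e :: real assume e: "e > 0"
  \<comment> \<open>Sums of \<open>h\<close> stay below \<open>e / 8 + e / 8\<close>, so each
    replacement of \<open>f\<close> by \<open>g\<close> costs less than \<open>e / 4\<close>; with
    \<open>e / 4\<close> for \<open>g\<close> itself the total is below
    \<open>3 * e / 4\<close>.\<close>
  obtain g h where g: "g integrable_on cbox a b" and h: "h integrable_on cbox a b"
    and fg: "\<And>x. x \<in> cbox a b \<Longrightarrow> norm (f x - g x) \<le> h x" and hi: "integral (cbox a b) h \<le> e / 8"
    using approx[of "e / 8"] e by auto
  obtain \<gamma>1 where \<gamma>1: "gauge \<gamma>1" and g_fine: "\<And>D1 D2. D1 tagged_division_of cbox a b \<Longrightarrow> \<gamma>1 fine D1 \<Longrightarrow>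
      D2 tagged_division_of cbox a b \<Longrightarrow> \<gamma>1 fine D2 \<Longrightarrow>
      norm ((\<Sum>(x,K)\<in>D1. measure lborel K *\<^sub>R g x) - (\<Sum>(x,K)\<in>D2. measure lborel K *\<^sub>R g x)) < e / 4"
    using g[unfolded integrable_Cauchy, rule_format, of "e / 4"] e by auto
  obtain \<gamma>2 where \<gamma>2: "gauge \<gamma>2" and h_fine: "\<And>D. D tagged_division_of cbox a b \<Longrightarrow> \<gamma>2 fine D \<Longrightarrow>
      norm ((\<Sum>(x,K)\<in>D. measure lborel K *\<^sub>R h x) - integral (cbox a b) h) < e / 8"
    using integrable_integral[OF h] e unfolding has_integral by (meson divide_pos_pos zero_less_numeral)
  have approx_sum: "norm ((\<Sum>(x,K)\<in>D. measure lborel K *\<^sub>R f x) - (\<Sum>(x,K)\<in>D. measure lborel K *\<^sub>R g x)) < e / 4"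
    if D: "D tagged_division_of cbox a b" "\<gamma>2 fine D" for D
  proof -
    have "norm ((\<Sum>(x,K)\<in>D. measure lborel K *\<^sub>R f x) - (\<Sum>(x,K)\<in>D. measure lborel K *\<^sub>R g x))
        = norm (\<Sum>(x,K)\<in>D. measure lborel K *\<^sub>R (f x - g x))"
      by (simp add: sum_subtractf[symmetric] split_def scaleR_diff_right)
    also have "\<dots> \<le> (\<Sum>(x,K)\<in>D. measure lborel K *\<^sub>R h x)"
    proof (intro sum_norm_le, safe)
      fix x K assume "(x, K) \<in> D"
      then have "x \<in> cbox a b" using D(1) by (meson tag_in_interval)
      then show "norm (measure lborel K *\<^sub>R (f x - g x)) \<le> measure lborel K *\<^sub>R h x"
        using fg by (simp add: mult_left_mono)
    qed
    also have "\<dots> < e / 4" using h_fine[OF D] hi unfolding real_norm_def by linarith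
    finally show ?thesis .
  qed
  show "\<exists>\<gamma>. gauge \<gamma> \<and> (\<forall>D1 D2. D1 tagged_division_of cbox a b \<and> \<gamma> fine D1 \<and>
      D2 tagged_division_of cbox a b \<and> \<gamma> fine D2 \<longrightarrow>
      norm ((\<Sum>(x,K)\<in>D1. measure lborel K *\<^sub>R f x) - (\<Sum>(x,K)\<in>D2. measure lborel K *\<^sub>R f x)) < e)"
  proof (intro exI conjI allI impI)
    show "gauge (\<lambda>x. \<gamma>1 x \<inter> \<gamma>2 x)" using \<gamma>1 \<gamma>2 by (rule gauge_Int)
    fix D1 D2
    assume "D1 tagged_division_of cbox a b \<and> (\<lambda>x. \<gamma>1 x \<inter> \<gamma>2 x) fine D1 \<and>
      D2 tagged_division_of cbox a b \<and> (\<lambda>x. \<gamma>1 x \<inter> \<gamma>2 x) fine D2"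
    then have D: "D1 tagged_division_of cbox a b" "\<gamma>1 fine D1" "\<gamma>2 fine D1"
      "D2 tagged_division_of cbox a b" "\<gamma>1 fine D2" "\<gamma>2 fine D2"
      by (auto simp: fine_Int)
    show "norm ((\<Sum>(x,K)\<in>D1. measure lborel K *\<^sub>R f x) - (\<Sum>(x,K)\<in>D2. measure lborel K *\<^sub>R f x)) < e"
    proof -
      have *: "norm (x - y) < e" if "norm (x - v) < e / 4" "norm (v - w) < e / 4" "norm (y - w) < e / 4"
        for x y v w :: 'b
      proof -
        have "norm (x - y) = norm ((x - v) + (v - w) - (y - w))" by simp
        also have "\<dots> \<le> norm (x - v) + norm (v - w) + norm (y - w)"
          by (meson norm_triangle_ineq4 norm_triangle_ineq add_right_mono order_trans)
        finally show ?thesis using that e by linarith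
      qed
      show ?thesis by (rule * [OF approx_sum[OF D(1,3)] g_fine[OF D(1,2,4,5)] approx_sum[OF D(4,6)]])
    qed
  qed
qed

text \<open>Bridges the two integrals in play: time integrals are written as gauge integrals, while
  integrability is established in Bochner's sense. In the limit step of the induction the preceding
  criterion applies with a simple function as \<open>g\<close> and the pointwise error as
  \<open>h\<close>.\<close>

lemma integrable_lebesgue_imp_integrable_on_cbox:
  fixes f :: "'a::euclidean_space \<Rightarrow> 'b::{banach, second_countable_topology}"
  assumes "integrable lebesgue f"
  shows "f integrable_on cbox a b"
  using assms
proof (induction rule: integrable_induct)
  case (base A c)
  then have "integrable lebesgue (indicator A :: 'a \<Rightarrow> real)" by simp
  then have "(indicator A :: 'a \<Rightarrow> real) integrable_on cbox a b"
    by (metis integrable_on_lebesgue integrable_on_subcbox subset_UNIV)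
  from integrable_linear[OF this bounded_linear_scaleR_left[of c]]
  show ?case by (simp add: o_def)
next
  case (add f g)
  then show ?case by (intro integrable_add)
next
  case (lim f s)
  define h where "h i x = norm (f x - s i x)" for i x
  have h: "integrable lebesgue (h i)" for i
    unfolding h_def using lim by (intro integrable_norm Bochner_Integration.integrable_diff)
  have "(\<lambda>i. integral\<^sup>L lebesgue (h i)) \<longlonglongrightarrow> integral\<^sup>L lebesgue (\<lambda>x :: 'a. 0 :: real)"
  proof (rule integral_dominated_convergence)
    \<comment> \<open>The approximating simple functions satisfy
      \<open>norm (s i x) \<le> 2 * norm (f x)\<close>, hence the factor 3.\<close>
    show "integrable lebesgue (\<lambda>x. 3 * norm (f x))" using lim by simp
    show "AE x in lebesgue. (\<lambda>i. h i x) \<longlonglongrightarrow> 0"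
    proof (rule AE_I2)
      fix x
      have "(\<lambda>i. norm (f x - s i x)) \<longlonglongrightarrow> norm (f x - f x)"
        using lim by (intro tendsto_intros) simp
      then show "(\<lambda>i. h i x) \<longlonglongrightarrow> 0" by (simp add: h_def)
    qed
    show "AE x in lebesgue. norm (h i x) \<le> 3 * norm (f x)" for i
    proof (rule AE_I2)
      fix x
      show "norm (h i x) \<le> 3 * norm (f x)"
        using norm_triangle_ineq4[of "f x" "s i x"] lim(3)[of x i] by (simp add: h_def)
    qed
  qed (use h in \<open>auto simp: borel_measurable_integrable\<close>)
  then have lim0: "(\<lambda>i. integral\<^sup>L lebesgue (h i)) \<longlonglongrightarrow> 0" by simp
  show ?case
  proof (rule integrable_on_cbox_approx)
    fix \<epsilon> :: real assume "\<epsilon> > 0"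
    then obtain i where i: "integral\<^sup>L lebesgue (h i) < \<epsilon>"
      using order_tendstoD(2)[OF lim0] by (metis eventually_sequentially order_refl)
    have hU: "h i integrable_on UNIV" using h by (rule integrable_on_lebesgue)
    then have hc: "h i integrable_on cbox a b" by (rule integrable_on_subcbox) simp
    have "integral (cbox a b) (h i) \<le> integral UNIV (h i)"
      using hc hU by (intro integral_subset_le) (auto simp: h_def)
    also have "\<dots> = integral\<^sup>L lebesgue (h i)" using has_integral_integral_lebesgue[OF h] by (rule integral_unique)
    finally show "\<exists>g h. g integrable_on cbox a b \<and> h integrable_on cbox a b \<and>
      (\<forall>x\<in>cbox a b. norm (f x - g x) \<le> h x) \<and> integral (cbox a b) h \<le> \<epsilon>"
      using lim i hc by (intro exI[of _ "s i"] exI[of _ "h i"]) (auto simp: h_def)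
  qed
qed

lemma integrable_lebesgue_on_imp_integrable_on:
  fixes f :: "real \<Rightarrow> 'b::{banach, second_countable_topology}"
  assumes "integrable (lebesgue_on {a<..<b}) f" "{c..d} \<subseteq> {a..b}"
  shows "f integrable_on {c..d}"
proof -
  have "integrable lebesgue (\<lambda>x. indicator {a<..<b} x *\<^sub>R f x)"
    using assms(1) by (subst (asm) integrable_restrict_space) auto
  then have "(\<lambda>x. indicator {a<..<b} x *\<^sub>R f x) integrable_on {c..d}"
    by (metis integrable_lebesgue_imp_integrable_on_cbox box_real(2))
  then show ?thesis
    by (rule integrable_spike[where S = "{a, b}"])
       (use assms(2) in \<open>auto simp: indicator_def\<close>)
qed

section \<open>Spectral decomposition of a coercive form\<close>

lemma compact_embedding_subseq:
  assumes "compact_dense_embedding \<iota>" and bdd: "\<And>n. norm (v n) \<le> R"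
  obtains r l where "strict_mono r" "(\<lambda>n. blinfun_apply \<iota> (v (r n :: nat))) \<longlonglongrightarrow> l"
proof -
  let ?K = "closure (blinfun_apply \<iota> ` ball 0 1)"
  define c where "c = 1 / (\<bar>R\<bar> + 1)"
  have c: "c > 0" by (auto simp: c_def)
  have "norm (c *\<^sub>R v n) < 1" for n
  proof -
    have "norm (v n) < \<bar>R\<bar> + 1" using bdd[of n] by linarith
    then show ?thesis by (simp add: c_def)
  qed
  then have "\<forall>n. blinfun_apply \<iota> (c *\<^sub>R v n) \<in> ?K"
    by (auto intro!: closure_subset[THEN subsetD])
  moreover have "compact ?K" using assms by (simp add: compact_dense_embedding_def)
  ultimately obtain l r where r: "strict_mono (r :: nat \<Rightarrow> nat)"
    and l: "((\<lambda>n. blinfun_apply \<iota> (c *\<^sub>R v n)) \<circ> r) \<longlonglongrightarrow> l"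
    unfolding compact_def by (elim allE[of _ "\<lambda>n. blinfun_apply \<iota> (c *\<^sub>R v n)"]) blast
  have "(\<lambda>n. (1 / c) *\<^sub>R blinfun_apply \<iota> (c *\<^sub>R v (r n))) \<longlonglongrightarrow> (1 / c) *\<^sub>R l"
    using l by (intro tendsto_intros) (simp add: o_def)
  then have "(\<lambda>n. blinfun_apply \<iota> (v (r n))) \<longlonglongrightarrow> (1 / c) *\<^sub>R l"
    using c by (simp add: blinfun.scaleR_right)
  with r that show thesis by blast
qed

lemma dual_emb_apply [simp]:
  "blinfun_apply (dual_emb \<iota> h) v = h \<bullet> blinfun_apply \<iota> v"
  by (simp add: dual_emb_def)

text \<open>By density: \<open>h - k\<close> is orthogonal to the image of \<open>X\<close>, hence
  to its closure, which contains \<open>h - k\<close> itself.\<close>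

lemma dual_emb_inj:
  assumes "compact_dense_embedding \<iota>"
  shows "inj (dual_emb \<iota>)"
proof (rule injI)
  fix h k assume eq: "dual_emb \<iota> h = dual_emb \<iota> k"
  have "closed {x. (h - k) \<bullet> x = 0}"
    by (intro closed_Collect_eq continuous_intros)
  moreover have "range (blinfun_apply \<iota>) \<subseteq> {x. (h - k) \<bullet> x = 0}"
  proof clarsimp
    fix v
    have "blinfun_apply (dual_emb \<iota> h) v = blinfun_apply (dual_emb \<iota> k) v" using eq by simp
    then show "(h - k) \<bullet> blinfun_apply \<iota> v = 0" by (simp add: inner_diff_left)
  qed
  ultimately have "closure (range (blinfun_apply \<iota>)) \<subseteq> {x. (h - k) \<bullet> x = 0}"
    by (rule closure_minimal[rotated])
  then have "(h - k) \<bullet> (h - k) = 0"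
    using assms unfolding compact_dense_embedding_def by blast
  then show "h = k" by simp
qed

lemma ext_norm_H_dual_emb:
  assumes "compact_dense_embedding \<iota>"
  shows "ext_norm_H \<iota> (dual_emb \<iota> h) = ennreal (norm h)"
proof -
  have "(THE k. dual_emb \<iota> k = dual_emb \<iota> h) = h"
    using dual_emb_inj[OF assms] by (auto dest: injD)
  then show ?thesis by (simp add: ext_norm_H_def)
qed

locale garding_form =
  fixes \<iota> :: "'x::banach \<Rightarrow>\<^sub>L 'h::{real_inner, banach}"
    and A :: "'x \<Rightarrow>\<^sub>L ('x \<Rightarrow>\<^sub>L real)"
    and C1 C2 :: real
  assumes emb: "compact_dense_embedding \<iota>"
    and sym: "A v w = A w v"
    and C1_pos: "C1 > 0"
    and garding: "C1 * (norm v)\<^sup>2 \<le> A v v + C2 * (norm (\<iota> v))\<^sup>2"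
begin

text \<open>The shift by \<open>C2\<close> makes the form coercive: \<open>a\<close> is an inner
  product equivalent to the norm of \<open>X\<close>, and its eigenvectors relative to the inner
  product of \<open>H\<close> are those of \<open>A\<close>.\<close>

definition a :: "'x \<Rightarrow> 'x \<Rightarrow> real" where
  "a v w = A v w + C2 * (\<iota> v \<bullet> \<iota> w)"

lemma a_bilinear: "bounded_bilinear a"
proof
  show "\<exists>K. \<forall>v w. norm (a v w) \<le> norm v * norm w * K"
  proof (intro exI allI)
    fix v w
    have "\<bar>A v w\<bar> \<le> norm (A v) * norm w"
      using norm_blinfun[of "A v" w] by simp
    also have "\<dots> \<le> (norm A * norm v) * norm w"
      by (intro mult_right_mono norm_blinfun) auto
    finally have 1: "\<bar>A v w\<bar> \<le> norm A * norm v * norm w" .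
    have "\<bar>\<iota> v \<bullet> \<iota> w\<bar> \<le> norm (\<iota> v) * norm (\<iota> w)" by (rule Cauchy_Schwarz_ineq2)
    also have "\<dots> \<le> (norm \<iota> * norm v) * (norm \<iota> * norm w)"
      by (intro mult_mono norm_blinfun) auto
    finally have "\<bar>C2\<bar> * \<bar>\<iota> v \<bullet> \<iota> w\<bar> \<le> \<bar>C2\<bar> * ((norm \<iota> * norm v) * (norm \<iota> * norm w))"
      by (intro mult_left_mono) auto
    with 1 show "norm (a v w) \<le> norm v * norm w * (norm A + \<bar>C2\<bar> * (norm \<iota>)\<^sup>2)"
      by (simp add: a_def algebra_simps power2_eq_square abs_mult[symmetric])
  qed
qed (auto simp: a_def blinfun.add_left blinfun.add_right blinfun.scaleR_left blinfun.scaleR_right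
      algebra_simps inner_add_left inner_add_right)

interpretation a: bounded_bilinear a by (rule a_bilinear)

lemma a_commute: "a v w = a w v"
  by (simp add: a_def sym inner_commute)

lemma a_ge: "C1 * (norm v)\<^sup>2 \<le> a v v"
  using garding[of v] by (simp add: a_def power2_norm_eq_inner)

lemma a_nonneg: "0 \<le> a v v"
  using a_ge[of v] C1_pos by (smt (verit) mult_nonneg_nonneg zero_le_power2)

lemma a_pos: "v \<noteq> 0 \<Longrightarrow> 0 < a v v"
  using a_ge[of v] C1_pos by (smt (verit) mult_pos_pos norm_eq_zero zero_less_power2)

lemma emb_inj: "\<iota> v = 0 \<Longrightarrow> v = 0"
  using emb unfolding compact_dense_embedding_def by (metis blinfun.zero_right injD)

lemma a_bounded_imp:
  assumes "a v v \<le> R" shows "norm v \<le> sqrt (R / C1)"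
proof -
  have "(norm v)\<^sup>2 \<le> R / C1"
    using a_ge[of v] assms C1_pos by (simp add: field_simps)
  then show ?thesis by (simp add: real_le_rsqrt)
qed

text \<open>A maximizing sequence converges in \<open>X\<close>: its image has a convergent subsequence in \<open>H\<close>,
  and then the parallelogram law for \<open>a\<close> makes the subsequence Cauchy for \<open>a\<close>.\<close>

lemma ex_maximizer:
  assumes V: "closed V" "subspace V"
  shows "\<exists>e\<in>V. a e e \<le> 1 \<and> (\<forall>v\<in>V. (norm (\<iota> v))\<^sup>2 \<le> (norm (\<iota> e))\<^sup>2 * a v v)"
proof -
  define S where "S = (\<lambda>v. (norm (\<iota> v))\<^sup>2) ` {v\<in>V. a v v \<le> 1}"
  define \<mu> where "\<mu> = Sup S"
  have bdd: "bdd_above S"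
  proof (rule bdd_aboveI)
    fix s assume "s \<in> S"
    then obtain v where v: "a v v \<le> 1" "s = (norm (\<iota> v))\<^sup>2" by (auto simp: S_def)
    have "norm (\<iota> v) \<le> norm \<iota> * norm v" by (rule norm_blinfun)
    also have "\<dots> \<le> norm \<iota> * sqrt (1 / C1)" by (intro mult_left_mono a_bounded_imp v) auto
    finally show "s \<le> (norm \<iota> * sqrt (1 / C1))\<^sup>2"
      unfolding v by (intro power_mono) auto
  qed
  have "0 \<in> S" using V by (auto simp: S_def subspace_0 a.zero_left intro!: image_eqI[of _ _ 0])
  then have \<mu>0: "0 \<le> \<mu>" unfolding \<mu>_def using bdd by (rule cSup_upper)
  have \<mu>_bound: "(norm (\<iota> v))\<^sup>2 \<le> \<mu> * a v v" if "v \<in> V" for v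
  proof (cases "v = 0")
    case False
    define c where "c = 1 / sqrt (a v v)"
    have av: "a v v > 0" using False by (rule a_pos)
    have "(norm (\<iota> (c *\<^sub>R v)))\<^sup>2 \<in> S"
      unfolding S_def using that V av
      by (intro imageI) (auto simp: subspace_scale a.scaleR_left a.scaleR_right c_def)
    then have "(norm (\<iota> (c *\<^sub>R v)))\<^sup>2 \<le> \<mu>" unfolding \<mu>_def using bdd by (rule cSup_upper)
    then show ?thesis using av
      by (simp add: blinfun.scaleR_right power_mult_distrib c_def power_divide field_simps)
  qed (auto simp: a.zero_left)
  show ?thesis
  proof (cases "\<mu> = 0")
    case True
    \<comment> \<open>If \<open>\<mu> = 0\<close>, the embedding vanishes on \<open>V\<close>, and
      the zero vector serves.\<close>
    show ?thesis using \<mu>_bound V True by (intro bexI[of _ 0]) (auto simp: a.zero_left subspace_0)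
  next
    case False
    then have \<mu>: "\<mu> > 0" using \<mu>0 by simp
    have "\<exists>v\<in>V. a v v \<le> 1 \<and> \<mu> - inverse (real (Suc n)) < (norm (\<iota> v))\<^sup>2" for n
    proof -
      have "\<mu> - inverse (real (Suc n)) < Sup S"
        unfolding \<mu>_def[symmetric] by (simp del: of_nat_Suc)
      then obtain s where "s \<in> S" "\<mu> - inverse (real (Suc n)) < s"
        using less_cSup_iff[of S] bdd \<open>0 \<in> S\<close> by blast
      then show ?thesis by (auto simp: S_def)
    qed
    then obtain v where v: "\<And>n. v n \<in> V" "\<And>n. a (v n) (v n) \<le> 1"
      "\<And>n. \<mu> - inverse (real (Suc n)) < (norm (\<iota> (v n)))\<^sup>2" by metis
    obtain r l where r: "strict_mono r" and l: "(\<lambda>n. \<iota> (v (r n))) \<longlonglongrightarrow> l"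
      using compact_embedding_subseq[OF emb, of v "sqrt (1 / C1)"] a_bounded_imp[OF v(2)] by blast
    define x where "x n = v (r n)" for n
    have x: "x n \<in> V" "a (x n) (x n) \<le> 1" for n using v by (auto simp: x_def)
    have lim\<mu>: "(\<lambda>n. (norm (\<iota> (x n)))\<^sup>2) \<longlonglongrightarrow> (norm l)\<^sup>2"
      using l unfolding x_def by (intro tendsto_intros)
    have "(\<lambda>n. \<mu> - inverse (real (Suc n))) \<longlonglongrightarrow> \<mu> - 0"
      by (intro tendsto_intros LIMSEQ_inverse_real_of_nat)
    then have "(\<lambda>n. \<mu> - inverse (real (Suc (r n)))) \<longlonglongrightarrow> \<mu>"
      using LIMSEQ_subseq_LIMSEQ[OF _ r] by (auto simp: o_def)
    then have l_ge: "\<mu> \<le> (norm l)\<^sup>2"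
      using lim\<mu> by (rule LIMSEQ_le) (use v(3) in \<open>auto simp: x_def intro: less_imp_le\<close>)
    \<comment> \<open>The bound at the sum \<open>x m + x n\<close>, with the parallelogram laws of
      \<open>a\<close> and of \<open>H\<close>, controls the difference. The right side tends to
      \<open>4 * \<mu> - 2 * \<mu> - 2 * \<mu> + 0\<close>.\<close>
    have key: "\<mu> * C1 * (norm (x m - x n))\<^sup>2
        \<le> 4 * \<mu> - 2 * (norm (\<iota> (x m)))\<^sup>2 - 2 * (norm (\<iota> (x n)))\<^sup>2 + (norm (\<iota> (x m) - \<iota> (x n)))\<^sup>2" for m n
    proof -
      have "(norm (\<iota> (x m + x n)))\<^sup>2 \<le> \<mu> * a (x m + x n) (x m + x n)"
        using \<mu>_bound V x by (auto simp: subspace_add)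
      also have "a (x m + x n) (x m + x n) = 2 * a (x m) (x m) + 2 * a (x n) (x n) - a (x m - x n) (x m - x n)"
        by (simp add: a.add_left a.add_right a.diff_left a.diff_right)
      also have "\<mu> * \<dots> \<le> \<mu> * (4 - C1 * (norm (x m - x n))\<^sup>2)"
        using x(2)[of m] x(2)[of n] a_ge[of "x m - x n"] \<mu> by (intro mult_left_mono) auto
      finally have "(norm (\<iota> (x m + x n)))\<^sup>2 \<le> 4 * \<mu> - \<mu> * C1 * (norm (x m - x n))\<^sup>2"
        by (simp add: algebra_simps)
      moreover have "(norm (\<iota> (x m + x n)))\<^sup>2
          = 2 * (norm (\<iota> (x m)))\<^sup>2 + 2 * (norm (\<iota> (x n)))\<^sup>2 - (norm (\<iota> (x m) - \<iota> (x n)))\<^sup>2"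
        by (simp add: blinfun.add_right power2_norm_eq_inner inner_add_left inner_add_right
            inner_diff_left inner_diff_right)
      ultimately show ?thesis by simp
    qed
    have "Cauchy x"
    proof (rule metric_CauchyI)
      fix \<epsilon> :: real assume \<epsilon>: "\<epsilon> > 0"
      \<comment> \<open>In \<open>key\<close> the two squared norms leave at most
        \<open>2 * \<delta>\<close> each and the last term less than \<open>\<delta>\<close>; hence
        the 5.\<close>
      define \<delta> where "\<delta> = \<mu> * C1 * \<epsilon>\<^sup>2 / 5"
      have \<delta>: "\<delta> > 0" using \<mu> C1_pos \<epsilon> by (simp add: \<delta>_def)
      have "\<forall>\<^sub>F n in sequentially. \<mu> - \<delta> < (norm (\<iota> (x n)))\<^sup>2"
        using order_tendstoD(1)[OF lim\<mu>, of "\<mu> - \<delta>"] l_ge \<delta> by auto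
      then obtain N1 where N1: "\<And>n. n \<ge> N1 \<Longrightarrow> \<mu> - \<delta> < (norm (\<iota> (x n)))\<^sup>2"
        unfolding eventually_sequentially by blast
      have "Cauchy (\<lambda>n. \<iota> (x n))" using l unfolding x_def by (rule LIMSEQ_imp_Cauchy)
      then obtain N2 where N2: "\<And>m n. m \<ge> N2 \<Longrightarrow> n \<ge> N2 \<Longrightarrow> dist (\<iota> (x m)) (\<iota> (x n)) < sqrt \<delta>"
        using \<delta> unfolding Cauchy_def by (metis real_sqrt_gt_0_iff)
      show "\<exists>M. \<forall>m\<ge>M. \<forall>n\<ge>M. dist (x m) (x n) < \<epsilon>"
      proof (intro exI[of _ "max N1 N2"] allI impI)
        fix m n assume "max N1 N2 \<le> m" "max N1 N2 \<le> n"
        then have b: "\<mu> - \<delta> < (norm (\<iota> (x m)))\<^sup>2" "\<mu> - \<delta> < (norm (\<iota> (x n)))\<^sup>2"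
          "norm (\<iota> (x m) - \<iota> (x n)) < sqrt \<delta>"
          using N1 N2 by (auto simp: dist_norm)
        have "(norm (\<iota> (x m) - \<iota> (x n)))\<^sup>2 < (sqrt \<delta>)\<^sup>2"
          using b(3) by (intro power_strict_mono) auto
        then have "\<mu> * C1 * (norm (x m - x n))\<^sup>2 < 5 * \<delta>"
          using key[of m n] b \<delta> by simp
        then have "(norm (x m - x n))\<^sup>2 < \<epsilon>\<^sup>2"
          using \<mu> C1_pos by (simp add: \<delta>_def)
        then show "dist (x m) (x n) < \<epsilon>"
          using \<epsilon> by (simp add: dist_norm power_less_imp_less_base)
      qed
    qed
    then obtain e where e: "x \<longlonglongrightarrow> e" using Cauchy_convergent convergent_def by blast
    have "e \<in> V" using V(1) x(1) e by (rule closed_sequentially)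
    moreover have "(\<lambda>n. a (x n) (x n)) \<longlonglongrightarrow> a e e" by (intro a.tendsto e)
    then have "a e e \<le> 1" by (rule LIMSEQ_le_const2) (use x in auto)
    moreover have "(\<lambda>n. \<iota> (x n)) \<longlonglongrightarrow> \<iota> e" by (intro tendsto_intros e)
    then have "\<iota> e = l" using l unfolding x_def by (rule LIMSEQ_unique)
    then have "\<forall>v\<in>V. (norm (\<iota> v))\<^sup>2 \<le> (norm (\<iota> e))\<^sup>2 * a v v"
      using \<mu>_bound l_ge a_nonneg by (meson mult_right_mono order_trans)
    ultimately show ?thesis by blast
  qed
qed

text \<open>Successive maximization of a Rayleigh quotient on the \<open>a\<close>-orthogonal
  complement of the previous vectors. The predicate \<open>P f k\<close> depends on \<open>f\<close>
  only below \<open>k\<close>, as well-founded dependent choice demands. On a trivial complement the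
  choice is \<open>0\<close>, so finite dimension needs no separate treatment.\<close>

lemma ex_eigensequence:
  obtains e :: "nat \<Rightarrow> 'x" where
    "\<And>k j. j < k \<Longrightarrow> a (e k) (e j) = 0"
    "\<And>k. a (e k) (e k) \<le> 1"
    "\<And>k v. (\<And>j. j < k \<Longrightarrow> a v (e j) = 0) \<Longrightarrow> (norm (\<iota> v))\<^sup>2 \<le> (norm (\<iota> (e k)))\<^sup>2 * a v v"
proof -
  define V where "V f k = {v. \<forall>j<k. a v (f j) = 0}" for f :: "nat \<Rightarrow> 'x" and k :: nat
  define P where "P f k e \<longleftrightarrow> e \<in> V f k \<and> a e e \<le> 1 \<and>
      (\<forall>v\<in>V f k. (norm (\<iota> v))\<^sup>2 \<le> (norm (\<iota> e))\<^sup>2 * a v v)" for f :: "nat \<Rightarrow> 'x" and k :: nat and e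
  have "\<exists>f. \<forall>k. P f k (f k)"
  proof (rule dependent_wf_choice[OF wf_less_than])
    fix f g :: "nat \<Rightarrow> 'x" and k e
    assume "\<And>z. (z, k) \<in> less_than \<Longrightarrow> f z = g z"
    then have "V f k = V g k" by (auto simp: V_def)
    then show "P f k e = P g k e" by (simp add: P_def)
  next
    fix k and f :: "nat \<Rightarrow> 'x"
    have "V f k = (\<Inter>j\<in>{..<k}. {v. a v (f j) = 0})" by (auto simp: V_def)
    also have "closed \<dots>"
      by (intro closed_INT ballI closed_Collect_eq a.continuous_on continuous_intros)
    finally have "closed (V f k)" .
    moreover have "subspace (V f k)"
      by (auto simp: V_def subspace_def a.add_left a.scaleR_left a.zero_left)
    ultimately show "\<exists>e. P f k e" using ex_maximizer[of "V f k"] by (auto simp: P_def)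
  qed
  then obtain e where "\<And>k. P e k (e k)" by blast
  then show thesis by (intro that[of e]) (auto simp: P_def V_def)
qed

text \<open>A quadratic polynomial with minimum value 0 at \<open>s = 0\<close> has derivative 0
  there: the first-order condition at a maximizer.\<close>

lemma quad_nonneg_imp_zero:
  fixes c d :: real
  assumes "\<And>s. 0 \<le> 2 * s * c + s\<^sup>2 * d"
  shows "c = 0"
proof (rule ccontr)
  assume c: "c \<noteq> 0"
  define s where "s = - c / (\<bar>d\<bar> + 1)"
  have "2 * s * c + s\<^sup>2 * d \<le> 2 * s * c + s * (s * (\<bar>d\<bar> + 1))"
    using mult_left_mono[of d "\<bar>d\<bar> + 1" "s\<^sup>2"] by (simp add: power2_eq_square mult.assoc)
  also have "s * (\<bar>d\<bar> + 1) = - c" by (simp add: s_def)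
  also have "2 * s * c + s * - c = - (c\<^sup>2 / (\<bar>d\<bar> + 1))"
    by (simp add: s_def power2_eq_square)
  also have "\<dots> < 0" using c by (simp add: divide_pos_pos add_nonneg_pos)
  finally show False using assms[of s] by simp
qed

text \<open>The first-order condition at a maximizer is the eigenvalue equation
  \<open>\<iota> (e k) \<bullet> \<iota> v = \<mu> k * a (e k) v\<close>; undoing the shift in
  \<open>a\<close> gives the eigenvalue \<open>1 / \<mu> k - C2\<close> of \<open>A\<close>. The
  expansion converges in \<open>X\<close> and not merely in \<open>H\<close>, so that functionals in
  \<open>X'\<close> can be evaluated on it term by term.\<close>

lemma ex_eigenbasis_X:
  obtains x :: "nat \<Rightarrow> 'x" and \<nu> :: "nat \<Rightarrow> real" where
    "\<And>k v. A (x k) v = \<nu> k * (\<iota> (x k) \<bullet> \<iota> v)"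
    "\<And>j k. j \<noteq> k \<Longrightarrow> \<iota> (x j) \<bullet> \<iota> (x k) = 0"
    "\<And>k. x k = 0 \<or> norm (\<iota> (x k)) = 1"
    "\<And>v. (\<lambda>n. v - (\<Sum>j<n. (\<iota> (x j) \<bullet> \<iota> v) *\<^sub>R x j)) \<longlonglongrightarrow> 0"
proof -
  obtain e :: "nat \<Rightarrow> 'x" where orth': "\<And>k j. j < k \<Longrightarrow> a (e k) (e j) = 0"
    and e_le: "\<And>k. a (e k) (e k) \<le> 1"
    and max: "\<And>k v. (\<And>j. j < k \<Longrightarrow> a v (e j) = 0) \<Longrightarrow> (norm (\<iota> v))\<^sup>2 \<le> (norm (\<iota> (e k)))\<^sup>2 * a v v"
    by (rule ex_eigensequence) blast
  define \<mu> where "\<mu> k = (norm (\<iota> (e k)))\<^sup>2" for k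
  have orth: "a (e k) (e j) = 0" if "j \<noteq> k" for j k
    using orth'[of j k] orth'[of k j] that a_commute by (cases j k rule: linorder_cases) auto
  \<comment> \<open>Inserting \<open>e k\<close> into its own maximality forces
    \<open>a (e k) (e k) = 1\<close> unless \<open>e k\<close> vanishes.\<close>
  have e_unit: "e k = 0 \<or> a (e k) (e k) = 1" for k
  proof (cases "\<mu> k = 0")
    case True
    then show ?thesis using emb_inj[of "e k"] by (simp add: \<mu>_def)
  next
    case False
    then have "\<mu> k > 0" by (simp add: \<mu>_def)
    moreover have "\<mu> k \<le> \<mu> k * a (e k) (e k)"
      unfolding \<mu>_def by (rule max) (rule orth')
    ultimately show ?thesis using e_le[of k] by simp
  qed
  define P where "P k v = (\<Sum>j<k. a v (e j) *\<^sub>R e j)" for k v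
  have aPe: "a (v - P k v) (e j) = 0" if "j < k" for v k j
  proof -
    have "a (P k v) (e j) = (\<Sum>i<k. if i = j then a v (e j) else 0)"
      unfolding P_def a.sum_left a.scaleR_left
    proof (intro sum.cong refl)
      fix i
      have "e j = 0 \<or> a (e j) (e j) = 1" by (rule e_unit)
      then show "a v (e i) *\<^sub>R a (e i) (e j) = (if i = j then a v (e j) else 0)"
        using orth[of j i] by (auto simp: a.zero_right)
    qed
    also have "\<dots> = a v (e j)" using that by simp
    finally show ?thesis by (simp add: a.diff_left)
  qed
  have eig_V: "\<iota> (e k) \<bullet> \<iota> v = \<mu> k * a (e k) v" if v: "\<And>j. j < k \<Longrightarrow> a v (e j) = 0" for k v
  proof -
    have "0 \<le> 2 * s * (\<mu> k * a (e k) v - \<iota> (e k) \<bullet> \<iota> v) + s\<^sup>2 * (\<mu> k * a v v - \<iota> v \<bullet> \<iota> v)" for s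
    proof -
      have "(norm (\<iota> (e k + s *\<^sub>R v)))\<^sup>2 \<le> \<mu> k * a (e k + s *\<^sub>R v) (e k + s *\<^sub>R v)"
        unfolding \<mu>_def using v by (intro max) (simp add: a.add_left a.scaleR_left orth')
      moreover have "\<mu> k * a (e k) (e k) = \<mu> k"
        using e_unit[of k] by (auto simp: \<mu>_def)
      moreover have "(norm (\<iota> (e k + s *\<^sub>R v)))\<^sup>2 = \<mu> k + 2 * s * (\<iota> (e k) \<bullet> \<iota> v) + s\<^sup>2 * (\<iota> v \<bullet> \<iota> v)"
        unfolding \<mu>_def power2_norm_eq_inner
        by (simp add: blinfun.add_right blinfun.scaleR_right inner_add_left
            inner_add_right inner_commute[of "\<iota> v" "\<iota> (e k)"] power2_eq_square algebra_simps)
      ultimately show ?thesis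
        by (simp add: a.add_left a.add_right a.scaleR_left a.scaleR_right a_commute[of v "e k"]
            power2_eq_square algebra_simps)
    qed
    from quad_nonneg_imp_zero[OF this] show ?thesis by simp
  qed
  \<comment> \<open>So far the condition holds only on the complement of the earlier vectors. By
    induction those are eigenvectors, hence orthogonal to \<open>e k\<close> in \<open>H\<close> as
    well as for \<open>a\<close>, and the projection \<open>P k v\<close> drops out.\<close>
  have eig: "\<iota> (e k) \<bullet> \<iota> v = \<mu> k * a (e k) v" for k v
  proof (induction k arbitrary: v rule: less_induct)
    case (less k)
    have "\<iota> (e k) \<bullet> \<iota> (e j) = 0" if "j < k" for j
      using less.IH[OF that, of "e k"] orth[of j k] orth[of k j] that by (simp add: inner_commute)
    then have "\<iota> (e k) \<bullet> \<iota> (P k v) = 0"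
      by (simp add: P_def blinfun.sum_right blinfun.scaleR_right inner_sum_right)
    moreover have "a (e k) (P k v) = 0"
      by (auto simp: P_def a.sum_right a.scaleR_right orth intro!: sum.neutral)
    moreover have "\<iota> (e k) \<bullet> \<iota> (v - P k v) = \<mu> k * a (e k) (v - P k v)"
      by (rule eig_V) (rule aPe)
    ultimately show ?case by (simp add: blinfun.diff_right inner_diff_right a.diff_right)
  qed
  \<comment> \<open>Normalized in \<open>H\<close>. If \<open>\<mu> k = 0\<close>, then
    \<open>e k = 0\<close>, and division by zero yields the eigenvalue \<open>- C2\<close> for a
    vector that is zero.\<close>
  define x where "x k = (1 / sqrt (\<mu> k)) *\<^sub>R e k" for k
  have \<mu>0: "\<mu> k \<ge> 0" for k by (simp add: \<mu>_def)
  have e0: "e k = 0" if "\<mu> k = 0" for k using that emb_inj[of "e k"] by (simp add: \<mu>_def)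
  \<comment> \<open>The \<open>H\<close>-coefficients with respect to \<open>x\<close> and the
    \<open>a\<close>-coefficients with respect to \<open>e\<close> describe the same projection, so
    convergence may be studied in the norm of \<open>a\<close>.\<close>
  have xe: "(\<iota> (x k) \<bullet> \<iota> v) *\<^sub>R x k = a v (e k) *\<^sub>R e k" for k v
    using \<mu>0[of k] e0[of k]
    by (cases "\<mu> k = 0")
       (auto simp: x_def blinfun.scaleR_right eig a_commute[of "e k" v] field_simps)
  have 1: "A (x k) v = (1 / \<mu> k - C2) * (\<iota> (x k) \<bullet> \<iota> v)" for k v
  proof (cases "\<mu> k = 0")
    case False
    have "A (e k) v = (1 / \<mu> k - C2) * (\<iota> (e k) \<bullet> \<iota> v)"
      using eig[of k v] False by (simp add: a_def field_simps)
    then show ?thesis by (simp add: x_def blinfun.scaleR_right blinfun.scaleR_left)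
  qed (use e0 in \<open>simp add: x_def blinfun.zero_left\<close>)
  have 2: "\<iota> (x j) \<bullet> \<iota> (x k) = 0" if "j \<noteq> k" for j k
    using that by (simp add: x_def blinfun.scaleR_right eig orth)
  have 3: "x k = 0 \<or> norm (\<iota> (x k)) = 1" for k
    using e0[of k] by (cases "\<mu> k = 0") (auto simp: x_def blinfun.scaleR_right \<mu>_def)
  have 4: "(\<lambda>n. v - (\<Sum>j<n. (\<iota> (x j) \<bullet> \<iota> v) *\<^sub>R x j)) \<longlonglongrightarrow> 0" for v
  proof -
    define r where "r n = v - P n v" for n
    have r_eq: "(\<lambda>n. v - (\<Sum>j<n. (\<iota> (x j) \<bullet> \<iota> v) *\<^sub>R x j)) = r"
      by (simp add: fun_eq_iff r_def P_def xe)
    have are: "a (r k) (e j) = 0" "a (e j) (r k) = 0" if "j < k" for j k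
      using aPe[OF that, of v] a_commute by (auto simp: r_def)
    have arr: "a (r k) (r m) = a v (r m)" if "k \<le> m" for k m
    proof -
      have "a (P k v) (r m) = 0"
        unfolding P_def a.sum_left a.scaleR_left using that by (intro sum.neutral) (auto simp: are)
      then show ?thesis by (simp add: r_def[of k] a.diff_left)
    qed
    \<comment> \<open>The remainders are orthogonal projections for \<open>a\<close>, so an
      increment is measured by the drop of \<open>a (r n) (r n)\<close>. This quantity decreases and
      is bounded below, which makes \<open>r\<close> Cauchy.\<close>
    have diff: "a (r k - r m) (r k - r m) = a (r k) (r k) - a (r m) (r m)" if "k \<le> m" for k m
      using arr[OF that] arr[of m m] a_commute[of "r m" "r k"]
      by (simp add: a.diff_left a.diff_right)
    have "decseq (\<lambda>n. a (r n) (r n))"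
      using diff a_nonneg by (auto simp: decseq_def) (metis diff_ge_0_iff_ge)
    then obtain L where "(\<lambda>n. a (r n) (r n)) \<longlonglongrightarrow> L"
      by (rule decseq_convergent[where B = 0]) (auto intro: a_nonneg)
    then have "Cauchy (\<lambda>n. a (r n) (r n))" by (rule LIMSEQ_imp_Cauchy)
    have "Cauchy r"
    proof (rule metric_CauchyI)
      fix \<epsilon> :: real assume \<epsilon>: "\<epsilon> > 0"
      then have "C1 * \<epsilon>\<^sup>2 > 0" using C1_pos by simp
      then obtain N where N: "\<And>m n. m \<ge> N \<Longrightarrow> n \<ge> N \<Longrightarrow> dist (a (r m) (r m)) (a (r n) (r n)) < C1 * \<epsilon>\<^sup>2"
        using \<open>Cauchy (\<lambda>n. a (r n) (r n))\<close> unfolding Cauchy_def by metis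
      have *: "dist (r m) (r n) < \<epsilon>" if "m \<ge> N" "n \<ge> N" "m \<le> n" for m n
      proof -
        have "C1 * (norm (r m - r n))\<^sup>2 < C1 * \<epsilon>\<^sup>2"
          using a_ge[of "r m - r n"] diff[OF that(3)] N[OF that(1,2)] by (simp add: dist_real_def)
        then have "(norm (r m - r n))\<^sup>2 < \<epsilon>\<^sup>2" using C1_pos by simp
        then show ?thesis using \<epsilon> by (simp add: dist_norm power_less_imp_less_base)
      qed
      then show "\<exists>M. \<forall>m\<ge>M. \<forall>n\<ge>M. dist (r m) (r n) < \<epsilon>"
        by (metis dist_commute linear)
    qed
    then obtain l where l: "r \<longlonglongrightarrow> l" using Cauchy_convergent convergent_def by blast
    have al: "a l (e j) = 0" for j
    proof -
      have "(\<lambda>n. a (r n) (e j)) \<longlonglongrightarrow> a l (e j)" by (intro a.tendsto l tendsto_intros)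
      moreover have "\<forall>\<^sub>F n in sequentially. a (r n) (e j) = 0"
        using eventually_gt_at_top[of j] by eventually_elim (rule are)
      ultimately show ?thesis by (metis tendsto_eventually LIMSEQ_unique)
    qed
    \<comment> \<open>A nonzero limit would compete in every maximization, so every
      \<open>\<mu> k\<close> would be at least \<open>\<delta>\<close>. Then the
      \<open>\<iota> (e k)\<close> are orthogonal with squared norms at least
      \<open>\<delta>\<close> and have no convergent subsequence, against compactness.\<close>
    have "l = 0"
    proof (rule ccontr)
      assume "l \<noteq> 0"
      define \<delta> where "\<delta> = (norm (\<iota> l))\<^sup>2 / a l l"
      have \<delta>: "\<delta> > 0" using \<open>l \<noteq> 0\<close> a_pos[of l] emb_inj[of l]
        by (auto simp: \<delta>_def intro!: divide_pos_pos)
      have \<mu>\<delta>: "\<mu> k \<ge> \<delta>" for k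
        using max[of k l] al a_pos[OF \<open>l \<noteq> 0\<close>] by (simp add: \<mu>_def \<delta>_def field_simps)
      obtain q m where q: "strict_mono q" and "(\<lambda>n. \<iota> (e (q n))) \<longlonglongrightarrow> m"
        using compact_embedding_subseq[OF emb, of e "sqrt (1 / C1)"] a_bounded_imp[OF e_le] by blast
      then have "Cauchy (\<lambda>n. \<iota> (e (q n)))" by (intro LIMSEQ_imp_Cauchy)
      then obtain N where N: "\<And>m n. m \<ge> N \<Longrightarrow> n \<ge> N \<Longrightarrow> dist (\<iota> (e (q m))) (\<iota> (e (q n))) < sqrt \<delta>"
        using \<delta> unfolding Cauchy_def by (metis real_sqrt_gt_0_iff)
      have "q N \<noteq> q (Suc N)" using q by (metis n_not_Suc_n strict_mono_eq)
      then have "(norm (\<iota> (e (q N)) - \<iota> (e (q (Suc N)))))\<^sup>2 = \<mu> (q N) + \<mu> (q (Suc N))"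
        using eig[of "q N" "e (q (Suc N))"] eig[of "q (Suc N)" "e (q N)"]
          orth[of "q N" "q (Suc N)"] orth[of "q (Suc N)" "q N"]
        by (simp add: power2_norm_eq_inner \<mu>_def inner_diff_left inner_diff_right)
      moreover have "(norm (\<iota> (e (q N)) - \<iota> (e (q (Suc N)))))\<^sup>2 < (sqrt \<delta>)\<^sup>2"
        using N[of N "Suc N"] by (intro power_strict_mono) (auto simp: dist_norm)
      ultimately show False using \<mu>\<delta>[of "q N"] \<mu>\<delta>[of "q (Suc N)"] \<delta> by simp
    qed
    then show ?thesis using l r_eq by simp
  qed
  show thesis by (rule that[of x "\<lambda>k. 1 / \<mu> k - C2"]) (use 1 2 3 4 in auto)
qed

end

section \<open>Orthonormal expansions in \<open>H\<close>\<close>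

lemma bessel_identity:
  fixes f :: "nat \<Rightarrow> 'h::real_inner"
  assumes "\<And>j k. j \<noteq> k \<Longrightarrow> f j \<bullet> f k = 0" and unit: "\<And>k. f k = 0 \<or> norm (f k) = 1"
  shows "(norm (h - (\<Sum>j<n. (f j \<bullet> h) *\<^sub>R f j)))\<^sup>2 = (norm h)\<^sup>2 - (\<Sum>j<n. (f j \<bullet> h)\<^sup>2)"
proof (induction n)
  case (Suc n)
  define r where "r = h - (\<Sum>j<n. (f j \<bullet> h) *\<^sub>R f j)"
  have "f n \<bullet> (\<Sum>j<n. (f j \<bullet> h) *\<^sub>R f j) = 0"
    unfolding inner_sum_right using assms(1) by (intro sum.neutral) auto
  then have fr: "f n \<bullet> r = f n \<bullet> h" by (simp add: r_def inner_diff_right)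
  have "f n \<bullet> f n = 1 \<or> f n = 0" using unit[of n] by (auto simp: norm_eq_1)
  then have "(norm (r - (f n \<bullet> h) *\<^sub>R f n))\<^sup>2 = (norm r)\<^sup>2 - (f n \<bullet> h)\<^sup>2"
    unfolding power2_norm_eq_inner using fr
    by (auto simp: inner_diff_left inner_diff_right inner_commute power2_eq_square)
  then show ?case using Suc by (simp add: r_def diff_diff_eq)
qed simp

text \<open>By Bessel the remainder maps \<open>R n\<close> are contractions, so their convergence
  to zero passes from \<open>D\<close> to its closure.\<close>

lemma parseval_from_dense:
  fixes f :: "nat \<Rightarrow> 'h::real_inner"
  assumes orth: "\<And>j k. j \<noteq> k \<Longrightarrow> f j \<bullet> f k = 0" and unit: "\<And>k. f k = 0 \<or> norm (f k) = 1"
    and conv: "\<And>d. d \<in> D \<Longrightarrow> (\<lambda>n. d - (\<Sum>j<n. (f j \<bullet> d) *\<^sub>R f j)) \<longlonglongrightarrow> 0"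
    and "closure D = UNIV"
  shows "(\<lambda>k. (f k \<bullet> h)\<^sup>2) sums (norm h)\<^sup>2"
proof -
  define R where "R n h = h - (\<Sum>j<n. (f j \<bullet> h) *\<^sub>R f j)" for n h
  have R_norm: "(norm (R n h))\<^sup>2 = (norm h)\<^sup>2 - (\<Sum>j<n. (f j \<bullet> h)\<^sup>2)" for n h
    unfolding R_def by (rule bessel_identity) (use orth unit in auto)
  have R_le: "norm (R n h) \<le> norm h" for n h
  proof -
    have "(norm (R n h))\<^sup>2 \<le> (norm h)\<^sup>2"
      unfolding R_norm by (simp add: sum_nonneg)
    then show ?thesis by (rule power2_le_imp_le) auto
  qed
  have R_diff: "R n (h - d) = R n h - R n d" for n h d
    by (simp add: R_def inner_diff_right scaleR_diff_left sum_subtractf)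
  have "(\<lambda>n. R n h) \<longlonglongrightarrow> 0"
  proof (rule LIMSEQ_I)
    fix \<epsilon> :: real assume \<epsilon>: "\<epsilon> > 0"
    have "h \<in> closure D" using assms by simp
    then obtain d where d: "d \<in> D" "dist d h < \<epsilon> / 2"
      using \<epsilon> by (meson closure_approachable half_gt_zero)
    then obtain N where N: "\<And>n. n \<ge> N \<Longrightarrow> norm (R n d) < \<epsilon> / 2"
      using LIMSEQ_D[OF conv[OF d(1)], of "\<epsilon> / 2"] \<epsilon> by (auto simp: R_def)
    show "\<exists>N. \<forall>n\<ge>N. norm (R n h - 0) < \<epsilon>"
    proof (intro exI allI impI)
      fix n assume "n \<ge> N"
      have "R n h = R n (h - d) + R n d" by (simp add: R_diff)
      then have "norm (R n h) \<le> norm (h - d) + norm (R n d)"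
        using norm_triangle_ineq[of "R n (h - d)" "R n d"] R_le[of n "h - d"] by simp
      then show "norm (R n h - 0) < \<epsilon>"
        using N[OF \<open>n \<ge> N\<close>] d(2) by (simp add: dist_norm norm_minus_commute)
    qed
  qed
  then have "(\<lambda>n. (norm h)\<^sup>2 - (norm (R n h))\<^sup>2) \<longlonglongrightarrow> (norm h)\<^sup>2 - (norm (0 :: 'h))\<^sup>2"
    by (intro tendsto_intros)
  then show ?thesis
    unfolding sums_def R_norm by simp
qed

context garding_form
begin

text \<open>A functional \<open>A v\<close> lies in \<open>H\<close> exactly when its coefficients
  are square summable: if they are, their series in \<open>H\<close> represents it; if it lies in
  \<open>H\<close>, Parseval sums them. Otherwise both sides are infinite, which is why the last
  clause lives in \<open>ennreal\<close>.\<close>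

theorem eigenbasis:
  obtains x :: "nat \<Rightarrow> 'x" and \<nu> :: "nat \<Rightarrow> real" where
    "\<And>k v. A v (x k) = \<nu> k * (\<iota> v \<bullet> \<iota> (x k))"
    "\<And>v. (\<lambda>k. \<nu> k * (\<iota> v \<bullet> \<iota> (x k))\<^sup>2) sums A v v"
    "\<And>v. (ext_norm_H \<iota> (A v))\<^sup>2 = (\<Sum>k. ennreal ((\<nu> k * (\<iota> v \<bullet> \<iota> (x k)))\<^sup>2))"
proof -
  obtain x :: "nat \<Rightarrow> 'x" and \<nu> :: "nat \<Rightarrow> real" where
    eig: "\<And>k v. A (x k) v = \<nu> k * (\<iota> (x k) \<bullet> \<iota> v)" and
    orth: "\<And>j k. j \<noteq> k \<Longrightarrow> \<iota> (x j) \<bullet> \<iota> (x k) = 0" and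
    unit': "\<And>k. x k = 0 \<or> norm (\<iota> (x k)) = 1" and
    conv: "\<And>v. (\<lambda>n. v - (\<Sum>j<n. (\<iota> (x j) \<bullet> \<iota> v) *\<^sub>R x j)) \<longlonglongrightarrow> 0"
    by (rule ex_eigenbasis_X) blast
  have eig': "A v (x k) = \<nu> k * (\<iota> v \<bullet> \<iota> (x k))" for k v
    using eig[of k v] sym by (simp add: inner_commute)
  have unit: "\<iota> (x k) = 0 \<or> norm (\<iota> (x k)) = 1" for k using unit'[of k] by auto
  have parseval: "(\<lambda>k. (\<iota> (x k) \<bullet> h)\<^sup>2) sums (norm h)\<^sup>2" for h
  proof (rule parseval_from_dense[where D = "range \<iota>"])
    fix d assume "d \<in> range \<iota>"
    then obtain v where v: "d = \<iota> v" by blast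
    have "(\<lambda>n. \<iota> (v - (\<Sum>j<n. (\<iota> (x j) \<bullet> \<iota> v) *\<^sub>R x j))) \<longlonglongrightarrow> \<iota> 0"
      by (intro tendsto_intros conv)
    then show "(\<lambda>n. d - (\<Sum>j<n. (\<iota> (x j) \<bullet> d) *\<^sub>R \<iota> (x j))) \<longlonglongrightarrow> 0"
      by (simp add: v blinfun.diff_right blinfun.sum_right blinfun.scaleR_right)
  qed (use orth unit emb in \<open>auto simp: compact_dense_embedding_def\<close>)
  have expand: "(\<lambda>k. (\<iota> (x k) \<bullet> \<iota> w) * A v (x k)) sums A v w" for v w
  proof -
    have "(\<lambda>n. A v w - A v (w - (\<Sum>j<n. (\<iota> (x j) \<bullet> \<iota> w) *\<^sub>R x j))) \<longlonglongrightarrow> A v w - A v 0"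
      by (intro tendsto_intros conv)
    then show ?thesis
      by (simp add: sums_def blinfun.diff_right blinfun.sum_right blinfun.scaleR_right)
  qed
  have quad: "(\<lambda>k. \<nu> k * (\<iota> v \<bullet> \<iota> (x k))\<^sup>2) sums A v v" for v
    using expand[of v v] by (simp add: eig' power2_eq_square mult_ac inner_commute)
  have "(ext_norm_H \<iota> (A v))\<^sup>2 = (\<Sum>k. ennreal ((\<nu> k * (\<iota> v \<bullet> \<iota> (x k)))\<^sup>2))" for v
  proof -
    define c where "c k = \<nu> k * (\<iota> v \<bullet> \<iota> (x k))" for k
    show ?thesis
    proof (cases "summable (\<lambda>k. (c k)\<^sup>2)")
      case True
      \<comment> \<open>An inequality, because some of the \<open>x k\<close> may be zero.\<close>
      have cx: "norm (\<Sum>k\<in>I. c k *\<^sub>R \<iota> (x k)) ^ 2 \<le> (\<Sum>k\<in>I. (c k)\<^sup>2)" if "finite I" for I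
        using that
      proof (induction I)
        case (insert i I)
        have "\<iota> (x i) \<bullet> (\<Sum>k\<in>I. c k *\<^sub>R \<iota> (x k)) = 0"
          unfolding inner_sum_right using insert.hyps orth[of i]
          by (intro sum.neutral ballI) (metis inner_scaleR_right mult_zero_right)
        then have "norm (\<Sum>k\<in>insert i I. c k *\<^sub>R \<iota> (x k)) ^ 2
            = (c i)\<^sup>2 * (norm (\<iota> (x i)))\<^sup>2 + norm (\<Sum>k\<in>I. c k *\<^sub>R \<iota> (x k)) ^ 2"
          unfolding power2_norm_eq_inner using insert.hyps
          by (simp add: inner_add_left inner_add_right inner_commute power2_eq_square)
        also have "\<dots> \<le> (c i)\<^sup>2 * 1 + (\<Sum>k\<in>I. (c k)\<^sup>2)"
          using insert unit[of i] by (intro add_mono mult_left_mono) auto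
        finally show ?case using insert by simp
      qed simp
      have "summable (\<lambda>k. c k *\<^sub>R \<iota> (x k))"
        unfolding summable_Cauchy
      proof safe
        fix \<epsilon> :: real assume \<epsilon>: "\<epsilon> > 0"
        then obtain N where N: "\<And>m n. m \<ge> N \<Longrightarrow> norm (\<Sum>k=m..<n. (c k)\<^sup>2) < \<epsilon>\<^sup>2"
          using True unfolding summable_Cauchy by (meson zero_less_power)
        show "\<exists>N. \<forall>m\<ge>N. \<forall>n. norm (\<Sum>k=m..<n. c k *\<^sub>R \<iota> (x k)) < \<epsilon>"
        proof (intro exI allI impI)
          fix m n assume "m \<ge> N"
          have "norm (\<Sum>k=m..<n. c k *\<^sub>R \<iota> (x k)) ^ 2 \<le> (\<Sum>k=m..<n. (c k)\<^sup>2)"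
            by (rule cx) simp
          also have "\<dots> < \<epsilon>\<^sup>2" using N[OF \<open>m \<ge> N\<close>, of n] by (simp add: sum_nonneg)
          finally show "norm (\<Sum>k=m..<n. c k *\<^sub>R \<iota> (x k)) < \<epsilon>"
            using \<epsilon> by (simp add: power_less_imp_less_base)
        qed
      qed
      then obtain h where h: "(\<lambda>k. c k *\<^sub>R \<iota> (x k)) sums h" by (auto simp: summable_def)
      have "A v w = dual_emb \<iota> h w" for w
      proof -
        have "(\<lambda>k. (c k *\<^sub>R \<iota> (x k)) \<bullet> \<iota> w) sums (h \<bullet> \<iota> w)"
          by (rule bounded_linear.sums[OF bounded_linear_inner_left h])
        then have "(\<lambda>k. (\<iota> (x k) \<bullet> \<iota> w) * A v (x k)) sums (h \<bullet> \<iota> w)"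
          by (simp add: eig' c_def mult_ac)
        then show ?thesis using sums_unique2[OF expand] by simp
      qed
      then have Av: "A v = dual_emb \<iota> h" by (intro blinfun_eqI)
      have "\<iota> (x k) \<bullet> h = c k" for k
        using eig'[of v k] unfolding Av by (simp add: c_def inner_commute)
      then have "(\<lambda>k. (c k)\<^sup>2) sums (norm h)\<^sup>2" using parseval[of h] by simp
      then have "(\<Sum>k. ennreal ((c k)\<^sup>2)) = ennreal ((norm h)\<^sup>2)"
        by (simp add: suminf_ennreal2 sums_iff)
      then show ?thesis unfolding Av ext_norm_H_dual_emb[OF emb] c_def[symmetric]
        by (simp add: ennreal_power)
    next
      case False
      have "A v \<notin> range (dual_emb \<iota>)"
      proof
        assume "A v \<in> range (dual_emb \<iota>)"
        then obtain h where Av: "A v = dual_emb \<iota> h" by blast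
        have "\<iota> (x k) \<bullet> h = c k" for k
          using eig'[of v k] unfolding Av by (simp add: c_def inner_commute)
        then show False using parseval[of h] False by (simp add: sums_iff)
      qed
      moreover have "(\<Sum>k. ennreal ((c k)\<^sup>2)) = top"
        using False by (metis summable_suminf_not_top zero_le_power2)
      ultimately show ?thesis by (simp add: ext_norm_H_def c_def power2_eq_square ennreal_top_mult)
    qed
  qed
  with eig' quad show thesis by (rule that)
qed

end

section \<open>Linearity of the gradient\<close>

lemma has_derivative_imp_gateaux:
  assumes "(E has_derivative blinfun_apply E') (at u)"
  shows "gateaux E u v = blinfun_apply E' v"
proof -
  have "((\<lambda>h::real. u + h *\<^sub>R v) has_derivative (\<lambda>h. h *\<^sub>R v)) (at 0)"
    by (auto intro!: derivative_eq_intros)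
  then have "((\<lambda>h. E (u + h *\<^sub>R v)) has_derivative (\<lambda>h. blinfun_apply E' (h *\<^sub>R v))) (at 0)"
    using has_derivative_compose[of "\<lambda>h. u + h *\<^sub>R v" "\<lambda>h. h *\<^sub>R v" 0 UNIV E "blinfun_apply E'"] assms by simp
  then have "((\<lambda>h. E (u + h *\<^sub>R v)) has_real_derivative blinfun_apply E' v) (at 0)"
    by (simp add: has_field_derivative_def blinfun.scaleR_right mult.commute[of _ "blinfun_apply E' v"])
  then have "((\<lambda>h. (E (u + h *\<^sub>R v) - E u) / h) \<longlongrightarrow> blinfun_apply E' v) (at 0)"
    by (simp add: DERIV_def)
  then show ?thesis unfolding gateaux_def by (intro tendsto_Lim) auto
qed

lemma has_derivative_imp_grad_H:
  assumes "(E has_derivative blinfun_apply E') (at u)"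
  shows "grad_H E u = E'"
  unfolding grad_H_def has_derivative_imp_gateaux[OF assms]
  by (rule the_equality) (auto intro: blinfun_eqI)

text \<open>Cauchy's functional equation: additivity gives homogeneity over the rationals, and
  continuity extends it to their closure.\<close>

lemma additive_continuous_imp_scaleR:
  fixes f :: "'a::real_normed_vector \<Rightarrow> 'b::real_normed_vector"
  assumes add: "\<And>x y. f (x + y) = f x + f y" and cont: "continuous_on UNIV f"
  shows "f (r *\<^sub>R x) = r *\<^sub>R f x"
proof -
  have f0: "f 0 = 0" using add[of 0 0] by simp
  have nat: "f (real n *\<^sub>R z) = real n *\<^sub>R f z" for n z
    by (induction n) (simp_all add: f0 add scaleR_left_distrib)
  have minus: "f (- z) = - f z" for z
    using add[of z "- z"] by (simp add: f0 eq_neg_iff_add_eq_0 add.commute)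
  have quot: "f ((real m / real n) *\<^sub>R x) = (real m / real n) *\<^sub>R f x" if "n \<noteq> 0" for m n
  proof -
    have "real n *\<^sub>R f ((real m / real n) *\<^sub>R x) = f (real n *\<^sub>R ((real m / real n) *\<^sub>R x))"
      by (simp only: nat)
    also have "\<dots> = real m *\<^sub>R f x" using that by (simp add: nat)
    finally have "(1 / real n) *\<^sub>R (real n *\<^sub>R f ((real m / real n) *\<^sub>R x)) = (1 / real n) *\<^sub>R (real m *\<^sub>R f x)"
      by (simp only:)
    then show ?thesis using that by simp
  qed
  have "f (q *\<^sub>R x) = q *\<^sub>R f x" if "q \<in> \<rat>" for q
  proof -
    obtain m n :: nat where n: "n \<noteq> 0" and q: "\<bar>q\<bar> = real m / real n"
      using Rats_abs_nat_div_natE[OF \<open>q \<in> \<rat>\<close>] by metis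
    then have "q = real m / real n \<or> q = - (real m / real n)" by linarith
    then show ?thesis using quot[OF n, of m] minus[of "(real m / real n) *\<^sub>R x"]
      by (metis scaleR_minus_left)
  qed
  then have "\<rat> \<subseteq> {r. f (r *\<^sub>R x) = r *\<^sub>R f x}" by blast
  moreover have "closed {r. f (r *\<^sub>R x) = r *\<^sub>R f x}"
    by (intro closed_Collect_eq continuous_intros continuous_on_compose2[OF cont]) auto
  ultimately have "closure \<rat> \<subseteq> {r. f (r *\<^sub>R x) = r *\<^sub>R f x}" by (rule closure_minimal)
  then show ?thesis using Rats_closure_real by blast
qed

section \<open>Rademacher functions and oscillation in time\<close>

definition square_wave :: "real \<Rightarrow> real" where
  "square_wave x = (if even \<lfloor>x\<rfloor> then 1 else - 1)"

lemma square_wave_shift: "square_wave (x + of_int k) = (if even k then square_wave x else - square_wave x)"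
  by (auto simp: square_wave_def)

lemma abs_square_wave: "\<bar>square_wave x\<bar> = 1"
  by (simp add: square_wave_def)

lemma square_wave_measurable [measurable]: "square_wave \<in> borel_measurable borel"
  unfolding square_wave_def[abs_def] by measurable

text \<open>Between \<open>0\<close> and \<open>T\<close> there are \<open>2 ^ n\<close> full
  periods; the exponent \<open>Suc n\<close> ensures that the function with \<open>n = 0\<close> has
  mean zero as well.\<close>

definition rademacher :: "real \<Rightarrow> nat \<Rightarrow> real \<Rightarrow> real" where
  "rademacher T n t = square_wave (2 ^ Suc n * t / T)"

lemma rademacher_measurable [measurable]: "rademacher T n \<in> borel_measurable borel"
  unfolding rademacher_def[abs_def] by measurable

lemma abs_rademacher: "\<bar>rademacher T n t\<bar> = 1"
  by (simp add: rademacher_def abs_square_wave)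

lemma rademacher_cases: "rademacher T n t = 1 \<or> rademacher T n t = - 1"
  by (simp add: rademacher_def square_wave_def)

text \<open>The shift is half a period of the function with index \<open>m\<close> and a whole
  number of periods of every finer one.\<close>

lemma rademacher_shift:
  assumes "T \<noteq> 0"
  shows "m \<le> n \<Longrightarrow> rademacher T n (t + T / 2 ^ Suc m) = (if m = n then - rademacher T n t else rademacher T n t)"
proof -
  assume mn: "m \<le> n"
  have "(2::real) ^ Suc n / 2 ^ Suc m = 2 ^ (n - m)"
    using mn by (simp add: power_diff)
  then have eq: "2 ^ Suc n * (t + T / 2 ^ Suc m) / T = 2 ^ Suc n * t / T + of_int (2 ^ (n - m))"
    using assms by (simp add: field_simps)
  then show ?thesis
    unfolding rademacher_def eq square_wave_shift using mn by auto
qed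

text \<open>Neighbouring intervals of length \<open>h\<close> cancel. Orthogonality of the
  Rademacher functions follows, since a product whose coarser index is \<open>m\<close> changes sign
  under the shift by \<open>T / 2 ^ Suc m\<close>.\<close>

lemma integral_antiperiodic:
  fixes P :: "real \<Rightarrow> real"
  assumes int: "\<And>a b. P integrable_on {a..b}" and P: "\<And>t. P (t + h) = - P t" and h: "h > 0"
  shows "integral {0..2 * real k * h} P = 0"
proof (induction k)
  case (Suc k)
  define a where "a = 2 * real k * h"
  have "integral {a + h..a + h + h} P = integral {a..a + h} (\<lambda>t. P (t + h))"
    using integral_shift_Icc_real[of a "a + h" P h] by (simp add: o_def add.commute)
  then have "integral {a..a + h} P + integral {a + h..a + h + h} P = 0"
    by (simp add: P)
  moreover have "integral {a..a + h} P + integral {a + h..a + h + h} P = integral {a..a + h + h} P"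
    using h int by (intro Henstock_Kurzweil_Integration.integral_combine) auto
  moreover have "integral {0..a} P + integral {a..a + h + h} P = integral {0..a + h + h} P"
    using h int by (intro Henstock_Kurzweil_Integration.integral_combine) (auto simp: a_def)
  moreover have "a + h + h = 2 * real (Suc k) * h" by (simp add: a_def algebra_simps)
  ultimately show ?case using Suc by (simp add: a_def)
qed simp


lemma borel_imp_time_measurable: "f \<in> borel_measurable borel \<Longrightarrow> f \<in> borel_measurable (time_measure T)"
  by (intro measurable_restrict_space1 measurable_completion) simp

lemma finite_measure_time: "finite_measure (time_measure T)"
  by (rule finite_measure_lebesgue_on) simp

lemma time_integrable_bounded:
  fixes f :: "real \<Rightarrow> 'b::{banach, second_countable_topology}"
  assumes "f \<in> borel_measurable (time_measure T)" "\<And>t. norm (f t) \<le> K"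
  shows "integrable (time_measure T) f"
  by (rule finite_measure.integrable_const_bound[OF finite_measure_time, of _ K]) (use assms in auto)

lemma time_integral_eq:
  fixes f :: "real \<Rightarrow> real"
  assumes "integrable (time_measure T) f"
  shows "(LINT t|time_measure T. f t) = integral {0..T} f"
proof -
  have "(LINT t|time_measure T. f t) = integral {0<..<T} f"
    by (rule lebesgue_integral_eq_integral[OF assms]) simp
  also have "\<dots> = integral {0..T} f" using integral_open_interval_real[of 0 T f] by simp
  finally show ?thesis .
qed

lemma integral_rademacher:
  assumes "T > 0"
  shows "integral {0..T} (rademacher T n) = 0"
proof -
  have "integral {0..2 * real (2 ^ n) * (T / 2 ^ Suc n)} (rademacher T n) = 0"
    using assms rademacher_shift[of T n n] abs_rademacher
    by (intro integral_antiperiodic bounded_borel_integrable_on[where K = 1]) auto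
  then show ?thesis by simp
qed

lemma integral_rademacher_mult:
  assumes "T > 0"
  shows "integral {0..T} (\<lambda>t. rademacher T m t * rademacher T n t) = (if m = n then T else 0)"
proof -
  have *: "integral {0..T} (\<lambda>t. rademacher T m t * rademacher T n t) = 0" if "m < n" for m n
  proof -
    have "integral {0..2 * real (2 ^ m) * (T / 2 ^ Suc m)} (\<lambda>t. rademacher T m t * rademacher T n t) = 0"
      using assms that rademacher_shift[of T m m] rademacher_shift[of T m n] abs_rademacher
      by (intro integral_antiperiodic bounded_borel_integrable_on[where K = 1]) (auto simp: abs_mult)
    then show ?thesis by simp
  qed
  show ?thesis
  proof (cases "m = n")
    case True
    have "rademacher T n t * rademacher T n t = 1" for t
      using rademacher_cases[of T n t] by auto
    then show ?thesis using True assms by simp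
  next
    case False
    then show ?thesis using *[of m n] *[of n m] by (cases "m < n") (auto simp: mult.commute)
  qed
qed

lemma integral_rademacher_sum_squared:
  assumes T: "T > 0" and S: "finite S" and \<epsilon>: "\<And>n. \<epsilon> n = 1 \<or> \<epsilon> n = - 1"
  shows "integral {0..T} (\<lambda>t. (\<Sum>n\<in>S. \<epsilon> n * rademacher T n t)\<^sup>2) = real (card S) * T"
proof -
  have int: "(\<lambda>t. rademacher T m t * rademacher T n t) integrable_on {0..T}" for m n
    by (rule bounded_borel_integrable_on[where K = 1]) (auto simp: abs_mult abs_rademacher)
  have "(\<lambda>t. (\<Sum>n\<in>S. \<epsilon> n * rademacher T n t)\<^sup>2)
      = (\<lambda>t. \<Sum>m\<in>S. \<Sum>n\<in>S. (\<epsilon> m * \<epsilon> n) * (rademacher T m t * rademacher T n t))"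
    by (simp add: power2_eq_square sum_product mult_ac)
  then have "integral {0..T} (\<lambda>t. (\<Sum>n\<in>S. \<epsilon> n * rademacher T n t)\<^sup>2)
      = (\<Sum>m\<in>S. \<Sum>n\<in>S. (\<epsilon> m * \<epsilon> n) * integral {0..T} (\<lambda>t. rademacher T m t * rademacher T n t))"
    using S int by (simp add: Henstock_Kurzweil_Integration.integral_sum integrable_sum integrable_on_mult_right)
  also have "\<dots> = (\<Sum>m\<in>S. \<Sum>n\<in>S. if m = n then T else 0)"
  proof (intro sum.cong refl)
    fix m n
    show "(\<epsilon> m * \<epsilon> n) * integral {0..T} (\<lambda>t. rademacher T m t * rademacher T n t) = (if m = n then T else 0)"
      using \<epsilon>[of n] by (auto simp: integral_rademacher_mult[OF T])
  qed
  also have "\<dots> = real (card S) * T" using S by simp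
  finally show ?thesis .
qed

lemma Lp_space_bounded:
  assumes f: "f \<in> borel_measurable (time_measure T)" and bound: "\<And>t. norm (f t) \<le> K" and p: "p > 0"
  shows "f \<in> Lp_space p T"
  unfolding Lp_space_def
proof (intro CollectI conjI f time_integrable_bounded)
  have "(norm :: 'a \<Rightarrow> real) \<in> borel_measurable borel"
    by (intro borel_measurable_continuous_onI continuous_intros)
  from measurable_compose[OF f this] have "(\<lambda>t. norm (f t)) \<in> borel_measurable (time_measure T)" .
  then show "(\<lambda>t. norm (f t) powr p) \<in> borel_measurable (time_measure T)" by measurable
  show "norm (norm (f t) powr p) \<le> K powr p" for t
    using bound[of t] p by (simp add: powr_mono2)
qed

lemma scaleR_const_measurable:
  fixes d :: "'z::real_normed_vector"
  assumes "f \<in> borel_measurable borel"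
  shows "(\<lambda>t. m + f t *\<^sub>R d) \<in> borel_measurable (time_measure T)"
proof -
  have "(\<lambda>x::real. m + x *\<^sub>R d) \<in> borel_measurable borel"
    by (intro borel_measurable_continuous_onI continuous_intros)
  from measurable_compose[OF assms this] show ?thesis by (rule borel_imp_time_measurable)
qed

text \<open>By orthogonality a sum of \<open>N\<close> signs has mean square \<open>N\<close>,
  although it may reach \<open>N\<close> pointwise. Interpolating the two gives an
  \<open>L^p\<close> norm of smaller order than \<open>N\<close> for every finite
  \<open>p \<ge> 1\<close>: a crude form of Khinchin's inequality.\<close>

lemma Lp_norm_rademacher_sum:
  fixes d :: "'z::real_normed_vector"
  assumes T: "T > 0" and p: "p \<ge> 1" and S: "finite S" "S \<noteq> {}" and \<epsilon>: "\<And>n. \<epsilon> n = 1 \<or> \<epsilon> n = - 1"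
  shows "Lp_norm p T (\<lambda>t. \<Sum>n\<in>S. \<epsilon> n *\<^sub>R (rademacher T n t *\<^sub>R d))
    \<le> real (card S) * norm d * (T / sqrt (real (card S))) powr (1 / p)"
proof -
  define N where "N = real (card S)"
  have N: "N > 0" using S by (simp add: N_def card_gt_0_iff)
  define f where "f t = (\<Sum>n\<in>S. \<epsilon> n * rademacher T n t)" for t
  have f_meas [measurable]: "f \<in> borel_measurable borel" unfolding f_def[abs_def] by measurable
  have f_le: "\<bar>f t\<bar> \<le> N" for t
  proof -
    have "\<bar>f t\<bar> \<le> (\<Sum>n\<in>S. \<bar>\<epsilon> n * rademacher T n t\<bar>)" unfolding f_def by (rule sum_abs)
    also have "\<dots> = (\<Sum>n\<in>S. 1)"
    proof (intro sum.cong refl)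
      fix n show "\<bar>\<epsilon> n * rademacher T n t\<bar> = 1" using \<epsilon>[of n] by (auto simp: abs_mult abs_rademacher)
    qed
    finally show ?thesis by (simp add: N_def)
  qed
  have F: "(\<Sum>n\<in>S. \<epsilon> n *\<^sub>R (rademacher T n t *\<^sub>R d)) = f t *\<^sub>R d" for t
    by (simp add: f_def scaleR_sum_left)
  \<comment> \<open>Balances the estimate \<open>z \<le> (\<eta> + z\<^sup>2 / \<eta>) / 2\<close>:
    the mean of \<open>z\<^sup>2\<close> is \<open>1 / N\<close>, so both terms have mean
    \<open>1 / sqrt N\<close>.\<close>
  define \<eta> where "\<eta> = 1 / sqrt N"
  have \<eta>: "\<eta> > 0" using N by (simp add: \<eta>_def)
  have pointwise: "norm (f t *\<^sub>R d) powr p \<le> (N * norm d) powr p * ((\<eta> + (f t)\<^sup>2 / (N\<^sup>2 * \<eta>)) / 2)" for t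
  proof -
    define z where "z = \<bar>f t\<bar> / N"
    have z: "0 \<le> z" "z \<le> 1" using f_le[of t] N by (auto simp: z_def)
    have "norm (f t *\<^sub>R d) = (N * norm d) * z" using N by (simp add: z_def)
    then have "norm (f t *\<^sub>R d) powr p = (N * norm d) powr p * z powr p"
      using N z by (simp only: powr_mult norm_ge_zero mult_nonneg_nonneg less_imp_le)
    also have "\<dots> \<le> (N * norm d) powr p * z"
    proof (rule mult_left_mono)
      show "z powr p \<le> z"
        using powr_mono'[of 1 p z] z p by (cases "z = 0") auto
    qed simp
    also have "\<dots> \<le> (N * norm d) powr p * ((\<eta> + z\<^sup>2 / \<eta>) / 2)"
    proof (rule mult_left_mono)
      have "0 \<le> (z - \<eta>)\<^sup>2" by simp
      then have "2 * z * \<eta> \<le> \<eta>\<^sup>2 + z\<^sup>2" by (simp add: power2_diff algebra_simps)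
      then show "z \<le> (\<eta> + z\<^sup>2 / \<eta>) / 2" using \<eta> by (simp add: field_simps power2_eq_square)
    qed simp
    finally show ?thesis by (simp add: z_def power_divide)
  qed
  have fsq_int: "(\<lambda>t. (f t)\<^sup>2) integrable_on {0..T}"
    using f_le by (intro bounded_borel_integrable_on[where K = "N\<^sup>2"]) (auto simp: abs_le_square_iff[symmetric] N_def)
  have norm_meas: "(\<lambda>t. norm (f t *\<^sub>R d) powr p) \<in> borel_measurable borel"
    unfolding norm_scaleR by measurable
  have norm_bound: "\<bar>norm (f t *\<^sub>R d) powr p\<bar> \<le> (N * norm d) powr p" for t
    using f_le[of t] p by (auto intro!: powr_mono2 mult_right_mono)
  have "(LINT t|time_measure T. norm (f t *\<^sub>R d) powr p) = integral {0..T} (\<lambda>t. norm (f t *\<^sub>R d) powr p)"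
  proof (rule time_integral_eq, rule time_integrable_bounded)
    show "norm (norm (f t *\<^sub>R d) powr p) \<le> (N * norm d) powr p" for t
      using norm_bound[of t] by simp
  qed (rule borel_imp_time_measurable[OF norm_meas])
  also have "\<dots> \<le> integral {0..T} (\<lambda>t. (N * norm d) powr p * ((\<eta> + (f t)\<^sup>2 / (N\<^sup>2 * \<eta>)) / 2))"
  proof (intro Henstock_Kurzweil_Integration.integral_le pointwise)
    show "(\<lambda>t. norm (f t *\<^sub>R d) powr p) integrable_on {0..T}"
      by (rule bounded_borel_integrable_on[OF norm_meas norm_bound])
    show "(\<lambda>t. (N * norm d) powr p * ((\<eta> + (f t)\<^sup>2 / (N\<^sup>2 * \<eta>)) / 2)) integrable_on {0..T}"
      using fsq_int by (intro integrable_on_mult_right integrable_on_divide integrable_add) auto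
  qed
  also have "\<dots> = (N * norm d) powr p * ((\<eta> * T + (N * T) / (N\<^sup>2 * \<eta>)) / 2)"
  proof (intro integral_unique has_integral_mult_right has_integral_divide has_integral_add)
    have "integral {0..T} (\<lambda>t. (f t)\<^sup>2) = N * T"
      unfolding f_def N_def by (rule integral_rademacher_sum_squared[OF T S(1)]) (rule \<epsilon>)
    then show "((\<lambda>t. (f t)\<^sup>2) has_integral N * T) {0..T}"
      using fsq_int by (simp add: has_integral_iff)
    show "((\<lambda>t. \<eta>) has_integral \<eta> * T) {0..T}"
      using has_integral_const_real[of \<eta> 0 T] T by (simp add: mult.commute)
  qed
  also have "(\<eta> * T + (N * T) / (N\<^sup>2 * \<eta>)) / 2 = T / sqrt N"
  proof -
    have "N = sqrt N * sqrt N" using N by simp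
    then have "(N * T) / (N\<^sup>2 * \<eta>) = T / sqrt N"
      using N by (simp add: \<eta>_def power2_eq_square field_simps)
    then show ?thesis by (simp add: \<eta>_def)
  qed
  finally have "(LINT t|time_measure T. norm (f t *\<^sub>R d) powr p) \<le> (N * norm d) powr p * (T / sqrt N)" .
  then have "Lp_norm p T (\<lambda>t. f t *\<^sub>R d) \<le> ((N * norm d) powr p * (T / sqrt N)) powr (1 / p)"
    unfolding Lp_norm_def using p by (intro powr_mono2) auto
  also have "\<dots> = (N * norm d) * (T / sqrt N) powr (1 / p)"
  proof -
    have "((N * norm d) powr p) powr (1 / p) = N * norm d"
      using p N by (simp only: powr_powr) simp
    then show ?thesis by (simp only: powr_mult)
  qed
  finally show ?thesis unfolding F N_def by simp
qed


text \<open>If infinitely many values stayed away from zero, then \<open>N\<close> of these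
  functions, summed with the signs of their values, would give \<open>\<Phi>\<close> a value of
  order \<open>N\<close> on a function whose norm is of smaller order. Only linearity and
  boundedness of \<open>\<Phi>\<close> enter, no representation of the dual of
  \<open>L^p\<close>.\<close>

lemma Lp_functional_rademacher_tendsto_0:
  fixes d :: "'z::real_normed_vector"
  assumes T: "T > 0" and p: "p \<ge> 1" and \<Phi>: "Lp_functional p T \<Phi>"
  shows "(\<lambda>n. \<Phi> (\<lambda>t. rademacher T n t *\<^sub>R d)) \<longlonglongrightarrow> 0"
proof (rule ccontr)
  define r where "r n = (\<lambda>t. rademacher T n t *\<^sub>R d)" for n
  define x where "x n = \<Phi> (r n)" for n
  assume "\<not> ?thesis"
  then have "\<not> x \<longlonglongrightarrow> 0" by (simp add: x_def[abs_def] r_def)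
  then obtain \<delta> where \<delta>: "\<delta> > 0" "\<And>N. \<exists>n\<ge>N. \<delta> \<le> \<bar>x n\<bar>"
    unfolding lim_sequentially by (auto simp: not_less)
  then have inf: "infinite {n. \<delta> \<le> \<bar>x n\<bar>}" by (auto simp: infinite_nat_iff_unbounded_le)
  define \<epsilon> where "\<epsilon> n = (if x n \<ge> 0 then 1 else - 1 :: real)" for n
  have \<epsilon>: "\<epsilon> n = 1 \<or> \<epsilon> n = - 1" for n by (simp add: \<epsilon>_def)
  have add: "\<Phi> (\<lambda>t. f t + g t) = \<Phi> f + \<Phi> g" if "f \<in> Lp_space p T" "g \<in> Lp_space p T" for f g
    using \<Phi> that by (simp add: Lp_functional_def)
  have scale: "\<Phi> (\<lambda>t. c *\<^sub>R f t) = c * \<Phi> f" if "f \<in> Lp_space p T" for c f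
    using \<Phi> that by (simp add: Lp_functional_def)
  obtain C where C: "\<And>f. f \<in> Lp_space p T \<Longrightarrow> \<bar>\<Phi> f\<bar> \<le> C * Lp_norm p T f"
    using \<Phi> unfolding Lp_functional_def by blast
  have mem: "(\<lambda>t. \<Sum>n\<in>S. \<epsilon> n *\<^sub>R r n t) \<in> Lp_space p T" for S
  proof (rule Lp_space_bounded)
    have eq: "(\<Sum>n\<in>S. \<epsilon> n *\<^sub>R r n t) = 0 + (\<Sum>n\<in>S. \<epsilon> n * rademacher T n t) *\<^sub>R d" for t
      by (simp add: r_def scaleR_sum_left)
    show "(\<lambda>t. \<Sum>n\<in>S. \<epsilon> n *\<^sub>R r n t) \<in> borel_measurable (time_measure T)"
      unfolding eq by (rule scaleR_const_measurable) measurable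
    show "norm (\<Sum>n\<in>S. \<epsilon> n *\<^sub>R r n t) \<le> (\<Sum>n\<in>S. norm d)" for t
      by (rule sum_norm_le) (use \<epsilon> in \<open>auto simp: r_def abs_mult abs_rademacher \<epsilon>_def\<close>)
  qed (use p in simp)
  have mem_r: "r n \<in> Lp_space p T" for n
    using mem[of "{n}"] \<epsilon>[of n]
  proof (intro Lp_space_bounded)
    show "r n \<in> borel_measurable (time_measure T)"
      using scaleR_const_measurable[of "rademacher T n" 0 d T] by (simp add: r_def)
    show "norm (r n t) \<le> norm d" for t by (simp add: r_def abs_rademacher)
  qed (use p in simp)
  have \<Phi>_sum: "\<Phi> (\<lambda>t. \<Sum>n\<in>S. \<epsilon> n *\<^sub>R r n t) = (\<Sum>n\<in>S. \<bar>x n\<bar>)" if "finite S" for S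
    using that
  proof (induction S)
    case empty
    show ?case using scale[OF mem_r, of 0] by simp
  next
    case (insert k S)
    have "(\<lambda>t. \<epsilon> k *\<^sub>R r k t) \<in> Lp_space p T" using mem[of "{k}"] by simp
    then have "\<Phi> (\<lambda>t. \<Sum>n\<in>insert k S. \<epsilon> n *\<^sub>R r n t) = \<epsilon> k * x k + \<Phi> (\<lambda>t. \<Sum>n\<in>S. \<epsilon> n *\<^sub>R r n t)"
      using insert.hyps add[OF _ mem[of S], of "\<lambda>t. \<epsilon> k *\<^sub>R r k t"] scale[OF mem_r] by (simp add: x_def)
    then show ?case using insert by (simp add: \<epsilon>_def)
  qed
  define C' where "C' = (\<bar>C\<bar> * norm d) * T powr (1 / p)"
  have key: "\<delta> \<le> C' * (1 / sqrt (real N)) powr (1 / p)" if N: "N > 0" for N :: nat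
  proof -
    obtain S where S: "finite S" "card S = N" "S \<subseteq> {n. \<delta> \<le> \<bar>x n\<bar>}"
      using infinite_arbitrarily_large[OF inf] by blast
    have "S \<noteq> {}" using S N by auto
    have "real N * \<delta> = (\<Sum>n\<in>S. \<delta>)" using S by simp
    also have "\<dots> \<le> (\<Sum>n\<in>S. \<bar>x n\<bar>)" using S(3) by (intro sum_mono) auto
    also have "\<dots> = \<Phi> (\<lambda>t. \<Sum>n\<in>S. \<epsilon> n *\<^sub>R r n t)" using \<Phi>_sum[OF S(1)] by simp
    also have "\<dots> \<le> C * Lp_norm p T (\<lambda>t. \<Sum>n\<in>S. \<epsilon> n *\<^sub>R r n t)"
      using C[OF mem[of S]] by linarith
    also have "\<dots> \<le> \<bar>C\<bar> * Lp_norm p T (\<lambda>t. \<Sum>n\<in>S. \<epsilon> n *\<^sub>R r n t)"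
      by (intro mult_right_mono) (auto simp: Lp_norm_def)
    also have "\<dots> \<le> \<bar>C\<bar> * (real N * norm d * (T / sqrt (real N)) powr (1 / p))"
      using Lp_norm_rademacher_sum[OF T p S(1) \<open>S \<noteq> {}\<close>, of \<epsilon> d] \<epsilon> S(2)
      unfolding r_def by (intro mult_left_mono) auto
    also have "(T / sqrt (real N)) powr (1 / p) = T powr (1 / p) * (1 / sqrt (real N)) powr (1 / p)"
      using T powr_mult[of T "1 / sqrt (real N)" "1 / p"] by simp
    finally have "real N * \<delta> \<le> real N * (C' * (1 / sqrt (real N)) powr (1 / p))"
      by (simp add: C'_def mult_ac)
    then show ?thesis using N by simp
  qed
  have "(\<lambda>N. inverse (sqrt (real N))) \<longlonglongrightarrow> 0"
    by (intro tendsto_inverse_0_at_top filterlim_compose[OF sqrt_at_top filterlim_real_sequentially])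
  then have "(\<lambda>N. 1 / sqrt (real N)) \<longlonglongrightarrow> 0" by (simp add: inverse_eq_divide)
  then have "(\<lambda>N. (1 / sqrt (real N)) powr (1 / p)) \<longlonglongrightarrow> 0 powr (1 / p)"
    using p by (intro tendsto_powr') auto
  then have "(\<lambda>N. C' * (1 / sqrt (real N)) powr (1 / p)) \<longlonglongrightarrow> C' * 0"
    by (intro tendsto_mult tendsto_const) simp
  then have "(\<lambda>N. C' * (1 / sqrt (real N)) powr (1 / p)) \<longlonglongrightarrow> 0" by simp
  moreover have "\<forall>\<^sub>F N in sequentially. \<delta> \<le> C' * (1 / sqrt (real N)) powr (1 / p)"
    using eventually_gt_at_top[of 0] by eventually_elim (rule key)
  ultimately have "\<delta> \<le> 0" by (intro tendsto_lowerbound[where F = sequentially]) auto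
  then show False using \<delta>(1) by simp
qed

text \<open>Pairing with a fixed \<open>v\<close> is the functional by which weak limits are
  identified. Its bound comes from \<open>x \<le> 1 + x powr q\<close>, applied to
  \<open>norm (g t)\<close> divided by the \<open>L^q\<close> norm of \<open>g\<close>; in place of
  Hoelder's inequality this gives the constant \<open>T + 1\<close>.\<close>

lemma Lp_functional_eval:
  fixes v :: "'x::real_normed_vector"
  assumes q: "q > 1" and T: "T > 0"
  shows "Lp_functional q T (\<lambda>g. LINT t|time_measure T. blinfun_apply (g t :: 'x \<Rightarrow>\<^sub>L real) v)"
proof -
  have le: "x \<le> 1 + x powr q" if "x \<ge> 0" for x :: real
    using le_1_plus_powr[OF that] q by simp
  have meas: "(\<lambda>t. blinfun_apply (g t) v) \<in> borel_measurable (time_measure T)"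
    and norm_meas: "(\<lambda>t. norm (g t)) \<in> borel_measurable (time_measure T)"
    if "g \<in> Lp_space q T" for g :: "real \<Rightarrow> 'x \<Rightarrow>\<^sub>L real"
  proof -
    have g: "g \<in> borel_measurable (time_measure T)" using that by (simp add: Lp_space_def)
    have "(\<lambda>\<xi>. blinfun_apply \<xi> v) \<in> borel_measurable borel" "(norm :: ('x \<Rightarrow>\<^sub>L real) \<Rightarrow> real) \<in> borel_measurable borel"
      by (intro borel_measurable_continuous_onI continuous_intros)+
    from measurable_compose[OF g this(1)] measurable_compose[OF g this(2)]
    show "(\<lambda>t. blinfun_apply (g t) v) \<in> borel_measurable (time_measure T)"
      "(\<lambda>t. norm (g t)) \<in> borel_measurable (time_measure T)" .
  qed
  have one: "integrable (time_measure T) (\<lambda>_. 1 :: real)"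
    using finite_measure.integrable_const[OF finite_measure_time] .
  have one_val: "(LINT t|time_measure T. 1) = T"
    using time_integral_eq[OF one] T by simp
  have norm_int: "integrable (time_measure T) (\<lambda>t. norm (g t))"
    if "g \<in> Lp_space q T" for g :: "real \<Rightarrow> 'x \<Rightarrow>\<^sub>L real"
  proof (rule Bochner_Integration.integrable_bound)
    show "integrable (time_measure T) (\<lambda>t. 1 + norm (g t) powr q)"
      using that one by (simp add: Lp_space_def)
    show "AE t in time_measure T. norm (norm (g t)) \<le> norm (1 + norm (g t) powr q)"
      using le[OF norm_ge_zero] by (intro AE_I2) (simp add: add_nonneg_nonneg)
  qed (rule norm_meas[OF that])
  have int: "integrable (time_measure T) (\<lambda>t. blinfun_apply (g t) v)"
    if "g \<in> Lp_space q T" for g :: "real \<Rightarrow> 'x \<Rightarrow>\<^sub>L real"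
  proof (rule Bochner_Integration.integrable_bound)
    show "integrable (time_measure T) (\<lambda>t. norm (g t) * norm v)" using norm_int[OF that] by simp
    show "AE t in time_measure T. norm (blinfun_apply (g t) v) \<le> norm (norm (g t) * norm v)"
    proof (rule AE_I2)
      fix t
      show "norm (blinfun_apply (g t) v) \<le> norm (norm (g t) * norm v)"
        using norm_blinfun[of "g t" v] by (simp add: abs_mult)
    qed
  qed (rule meas[OF that])
  have "\<bar>LINT t|time_measure T. blinfun_apply (g t) v\<bar> \<le> norm v * (T + 1) * Lp_norm q T g"
    if g: "g \<in> Lp_space q T" for g :: "real \<Rightarrow> 'x \<Rightarrow>\<^sub>L real"
  proof -
    define I where "I = (LINT t|time_measure T. norm (g t) powr q)"
    have pint: "integrable (time_measure T) (\<lambda>t. norm (g t) powr q)" using g by (simp add: Lp_space_def)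
    have I0: "I \<ge> 0" unfolding I_def by (intro Bochner_Integration.integral_nonneg) auto
    have "\<bar>LINT t|time_measure T. blinfun_apply (g t) v\<bar> \<le> (LINT t|time_measure T. norm (blinfun_apply (g t) v))"
      using integral_norm_bound[of "time_measure T" "\<lambda>t. blinfun_apply (g t) v"] by simp
    also have "\<dots> \<le> (LINT t|time_measure T. norm (g t) * norm v)"
    proof (intro integral_mono)
      show "norm (blinfun_apply (g t) v) \<le> norm (g t) * norm v" for t by (rule norm_blinfun)
    qed (use int[OF g] norm_int[OF g] in auto)
    also have "\<dots> = norm v * (LINT t|time_measure T. norm (g t))" by simp
    also have "(LINT t|time_measure T. norm (g t)) \<le> (T + 1) * Lp_norm q T g"
    proof (cases "I = 0")
      case True
      have "AE t in time_measure T. norm (g t) powr q = 0"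
        using True pint unfolding I_def by (subst (asm) integral_nonneg_eq_0_iff_AE) auto
      then have "AE t in time_measure T. norm (g t) = 0" by eventually_elim simp
      then have "(LINT t|time_measure T. norm (g t)) = 0" by (rule integral_eq_zero_AE)
      then show ?thesis using T by (simp add: Lp_norm_def)
    next
      case False
      define L where "L = I powr (1 / q)"
      have L: "L > 0" "L powr q = I" using False I0 q by (auto simp: L_def powr_powr)
      have "(LINT t|time_measure T. norm (g t)) \<le> (LINT t|time_measure T. L * (1 + norm (g t) powr q / I))"
      proof (intro integral_mono norm_int[OF g])
        show "integrable (time_measure T) (\<lambda>t. L * (1 + norm (g t) powr q / I))"
          using pint one by simp
        fix t
        have "norm (g t) = L * (norm (g t) / L)" using L by simp
        also have "\<dots> \<le> L * (1 + (norm (g t) / L) powr q)"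
          using L le[of "norm (g t) / L"] by (intro mult_left_mono) auto
        also have "(norm (g t) / L) powr q = norm (g t) powr q / I"
          using L by (simp add: powr_divide)
        finally show "norm (g t) \<le> L * (1 + norm (g t) powr q / I)" .
      qed
      also have "\<dots> = L * (T + I / I)"
        using pint one one_val by (simp add: I_def)
      also have "\<dots> = (T + 1) * Lp_norm q T g"
        using False by (simp add: Lp_norm_def I_def L_def)
      finally show ?thesis .
    qed
    finally show ?thesis by (simp add: mult_left_mono mult.assoc)
  qed
  then show ?thesis
    unfolding Lp_functional_def
    by (intro conjI ballI allI exI[of _ "norm v * (T + 1)"])
       (auto simp: blinfun.add_left blinfun.scaleR_left int)
qed

text \<open>Oscillation in time between \<open>m + d\<close> and \<open>m - d\<close> converges weakly to \<open>m\<close>, whereas its image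
  converges weakly to the mean of the two values.\<close>

lemma weak_to_weak_continuous_imp_midpoint:
  fixes F :: "'x::real_normed_vector \<Rightarrow> ('x \<Rightarrow>\<^sub>L real)"
  assumes w: "weak_to_weak_continuous p q T F" and T: "T > 0" and p: "p \<ge> 1" and q: "q > 1"
  shows "F m = (1 / 2) *\<^sub>R (F (m + d) + F (m - d))"
proof (rule blinfun_eqI)
  fix v
  define us where "us n t = m + rademacher T n t *\<^sub>R d" for n t
  have us_mem: "us n \<in> Lp_space p T" for n
  proof (rule Lp_space_bounded)
    show "us n \<in> borel_measurable (time_measure T)"
      unfolding us_def by (rule scaleR_const_measurable) measurable
    show "norm (us n t) \<le> norm m + norm d" for t
      unfolding us_def by (rule norm_triangle_le) (simp add: abs_rademacher)
  qed (use p in simp)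
  have const_mem: "(\<lambda>t. m) \<in> Lp_space p T"
    by (rule Lp_space_bounded[where K = "norm m"]) (use p in auto)
  have osc_mem: "(\<lambda>t. rademacher T n t *\<^sub>R d) \<in> Lp_space p T" for n
    by (rule Lp_space_bounded[where K = "norm d"])
       (use p scaleR_const_measurable[of "rademacher T n" 0 d T] in \<open>auto simp: abs_rademacher\<close>)
  have "Lp_weakly_converges p T us (\<lambda>t. m)"
    unfolding Lp_weakly_converges_def
  proof (intro allI impI)
    fix \<Phi> :: "(real \<Rightarrow> 'x) \<Rightarrow> real" assume \<Phi>: "Lp_functional p T \<Phi>"
    then have "\<And>f g. f \<in> Lp_space p T \<Longrightarrow> g \<in> Lp_space p T \<Longrightarrow> \<Phi> (\<lambda>t. f t + g t) = \<Phi> f + \<Phi> g"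
      by (simp add: Lp_functional_def)
    from this[OF const_mem osc_mem]
    have "\<Phi> (us n) = \<Phi> (\<lambda>t. m) + \<Phi> (\<lambda>t. rademacher T n t *\<^sub>R d)" for n
      by (simp add: us_def[abs_def])
    then show "(\<lambda>n. \<Phi> (us n)) \<longlonglongrightarrow> \<Phi> (\<lambda>t. m)"
      using tendsto_add[OF tendsto_const Lp_functional_rademacher_tendsto_0[OF T p \<Phi>, of d], of "\<Phi> (\<lambda>t. m)"]
      by simp
  qed
  then have "Lp_weakly_converges q T (\<lambda>n t. F (us n t)) (\<lambda>t. F m)"
    using w us_mem const_mem unfolding weak_to_weak_continuous_def by blast
  then have lim: "(\<lambda>n. LINT t|time_measure T. F (us n t) v) \<longlonglongrightarrow> (LINT t|time_measure T. F m v)"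
    using Lp_functional_eval[OF q T, of v] unfolding Lp_weakly_converges_def by blast
  have const: "(LINT t|time_measure T. c) = c * T" for c
  proof -
    have "integrable (time_measure T) (\<lambda>_. c)" by (rule finite_measure.integrable_const[OF finite_measure_time])
    from time_integral_eq[OF this] show ?thesis using T by simp
  qed
  have val: "(LINT t|time_measure T. F (us n t) v) = (1 / 2) * (F (m + d) v + F (m - d) v) * T" for n
  proof -
    \<comment> \<open>A function of a variable with the two values 1 and -1 is affine in it, so its
      time integral is that of the constant part \<open>c\<close>.\<close>
    define c e where "c = (1 / 2) * (F (m + d) v + F (m - d) v)" and "e = (1 / 2) * (F (m + d) v - F (m - d) v)"
    have "F (us n t) v = c + e * rademacher T n t" for t
      using rademacher_cases[of T n t] by (auto simp: us_def c_def e_def field_simps)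
    moreover have r: "integrable (time_measure T) (rademacher T n)"
      by (rule time_integrable_bounded[where K = 1]) (auto intro: borel_imp_time_measurable simp: abs_rademacher)
    moreover have "(LINT t|time_measure T. rademacher T n t) = 0"
      using time_integral_eq[OF r] integral_rademacher[OF T] by simp
    ultimately have "(LINT t|time_measure T. F (us n t) v) = (LINT t|time_measure T. c)"
      using finite_measure.integrable_const[OF finite_measure_time, of T c] by simp
    then have "(LINT t|time_measure T. F (us n t) v) = c * T" unfolding const .
    then show ?thesis by (simp add: c_def)
  qed
  have "(\<lambda>n :: nat. (1 / 2) * (F (m + d) v + F (m - d) v) * T) \<longlonglongrightarrow> F m v * T"
    using lim unfolding val const .
  then have "F m v * T = (1 / 2) * (F (m + d) v + F (m - d) v) * T"
    unfolding LIMSEQ_const_iff by (rule sym)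
  then show "F m v = ((1 / 2) *\<^sub>R (F (m + d) + F (m - d))) v"
    using T by (simp add: blinfun.scaleR_left blinfun.add_left)
qed


text \<open>Once \<open>E' 0 = 0\<close> is known, the midpoint identity is Jensen's equation, so
  the gradient is additive and by continuity linear. Differentiating along rays then shows that
  \<open>E\<close> is its quadratic form up to the constant \<open>E 0\<close>.\<close>

theorem gradient_is_garding_form:
  fixes \<iota> :: "'x::banach \<Rightarrow>\<^sub>L 'h::{real_inner, banach}"
  assumes T: "T > 0" and emb: "compact_dense_embedding \<iota>" and smooth: "C1_functional E"
    and p: "p > 1" and C1: "C1 > 0"
    and growth: "\<And>v. norm (grad_H E v) \<le> C0 * norm v powr (p - 1) + C0"
    and coercive: "\<And>v. gateaux E v v \<ge> C1 * norm v powr p - C2 * (norm (blinfun_apply \<iota> v))\<^sup>2"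
    and weak: "weak_to_weak_continuous p (p / (p - 1)) T (grad_H E)"
  obtains A where "garding_form \<iota> A C1 C2" "\<And>v. grad_H E v = blinfun_apply A v"
    "\<And>v. E v = E 0 + A v v / 2"
proof -
  obtain E' where E': "\<And>u. (E has_derivative blinfun_apply (E' u)) (at u)" and cont: "continuous_on UNIV E'"
    using smooth unfolding C1_functional_def by blast
  have grad: "grad_H E = E'" using has_derivative_imp_grad_H[OF E'] by (simp add: fun_eq_iff)
  have gat: "gateaux E u v = E' u v" for u v by (rule has_derivative_imp_gateaux[OF E'])
  have mid: "E' m = (1 / 2) *\<^sub>R (E' (m + d) + E' (m - d))" for m d
    by (rule weak_to_weak_continuous_imp_midpoint[OF weak[unfolded grad] T]) (use p in \<open>auto simp: field_simps\<close>)
  \<comment> \<open>The coercivity at \<open>s *\<^sub>R v\<close>, divided by \<open>s\<close>, in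
    the limit from the right at 0. Applied also to \<open>- v\<close>, it gives
    \<open>E' 0 = 0\<close>.\<close>
  have nonneg: "0 \<le> E' 0 v" for v
  proof -
    have "((\<lambda>s. E' (s *\<^sub>R v) v) \<longlongrightarrow> E' (0 *\<^sub>R v) v) (at_right 0)"
      using cont by (intro tendsto_intros isCont_tendsto_compose[where g = E'])
        (auto simp: continuous_on_eq_continuous_at)
    moreover have "((\<lambda>s. - C2 * s * (norm (\<iota> v))\<^sup>2) \<longlongrightarrow> - C2 * 0 * (norm (\<iota> v))\<^sup>2) (at_right 0)"
      by (intro tendsto_intros)
    moreover have "\<forall>\<^sub>F s in at_right 0. - C2 * s * (norm (\<iota> v))\<^sup>2 \<le> E' (s *\<^sub>R v) v"
      using eventually_at_right_less[of 0]
    proof eventually_elim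
      case (elim s)
      have "0 \<le> C1 * norm (s *\<^sub>R v) powr p" using C1 by simp
      then have "- C2 * (norm (\<iota> (s *\<^sub>R v)))\<^sup>2 \<le> E' (s *\<^sub>R v) (s *\<^sub>R v)"
        using coercive[of "s *\<^sub>R v"] unfolding gat by linarith
      then have "s * (- C2 * s * (norm (\<iota> v))\<^sup>2) \<le> s * E' (s *\<^sub>R v) v"
        by (simp add: blinfun.scaleR_right power_mult_distrib power2_eq_square mult_ac)
      then show ?case using mult_le_cancel_left_pos[OF elim] by blast
    qed
    ultimately have "- C2 * 0 * (norm (\<iota> v))\<^sup>2 \<le> E' (0 *\<^sub>R v) v"
      by (intro tendsto_le[where F = "at_right 0"]) auto
    then show ?thesis by simp
  qed
  have E'0: "E' 0 = 0"
  proof (rule blinfun_eqI)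
    fix v show "blinfun_apply (E' 0) v = blinfun_apply 0 v" using nonneg[of v] nonneg[of "- v"] by (simp add: blinfun.minus_right)
  qed
  have double: "E' (x + x) = 2 *\<^sub>R E' x" for x
    using mid[of x x] E'0 by simp
  have add: "E' (x + y) = E' x + E' y" for x y
  proof -
    have "E' ((1 / 2) *\<^sub>R (x + y)) = (1 / 2) *\<^sub>R (E' ((1 / 2) *\<^sub>R (x + y) + (1 / 2) *\<^sub>R (x - y))
        + E' ((1 / 2) *\<^sub>R (x + y) - (1 / 2) *\<^sub>R (x - y)))" by (rule mid)
    also have "(1 / 2) *\<^sub>R (x + y) + (1 / 2) *\<^sub>R (x - y) = x"
      by (simp add: scaleR_add_right[symmetric] scaleR_2[symmetric])
    also have "(1 / 2) *\<^sub>R (x + y) - (1 / 2) *\<^sub>R (x - y) = y"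
      by (simp add: scaleR_diff_right[symmetric] scaleR_2[symmetric])
    finally have "2 *\<^sub>R E' ((1 / 2) *\<^sub>R (x + y)) = E' x + E' y" by simp
    moreover have "(1 / 2) *\<^sub>R (x + y) + (1 / 2) *\<^sub>R (x + y) = x + y"
      by (simp add: scaleR_2[symmetric])
    ultimately show ?thesis using double[of "(1 / 2) *\<^sub>R (x + y)"] by simp
  qed
  have scale: "E' (r *\<^sub>R x) = r *\<^sub>R E' x" for r x
    by (rule additive_continuous_imp_scaleR[OF add cont])
  have "bounded_linear E'"
  proof (rule bounded_linear_intro[OF add scale])
    fix x :: 'x
    show "norm (E' x) \<le> norm x * (2 * \<bar>C0\<bar>)"
    proof (cases "x = 0")
      case False
      define z where "z = (1 / norm x) *\<^sub>R x"
      have z: "norm z = 1" using False by (simp add: z_def)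
      have "norm (E' z) \<le> 2 * \<bar>C0\<bar>" using growth[of z] unfolding grad z by simp
      moreover have "E' x = norm x *\<^sub>R E' z" using scale[of "norm x" z] False by (simp add: z_def)
      ultimately show ?thesis by (simp add: mult_left_mono)
    qed (simp add: E'0)
  qed
  then obtain A where A: "\<And>v. blinfun_apply A v = E' v"
    by (metis bounded_linear_Blinfun_apply)
  have line: "((\<lambda>s. E (v + s *\<^sub>R w)) has_real_derivative A (v + s *\<^sub>R w) w) (at s)" for v w s
  proof -
    have "((\<lambda>s::real. v + s *\<^sub>R w) has_derivative (\<lambda>h. h *\<^sub>R w)) (at s)"
      by (auto intro!: derivative_eq_intros)
    from has_derivative_compose[OF this, of E "blinfun_apply (E' (v + s *\<^sub>R w))"] E'
    have "((\<lambda>s. E (v + s *\<^sub>R w)) has_derivative (\<lambda>h. E' (v + s *\<^sub>R w) (h *\<^sub>R w))) (at s)" by simp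
    then show ?thesis
      by (simp add: has_field_derivative_def blinfun.scaleR_right A mult.commute[of _ "E' (v + s *\<^sub>R w) w"])
  qed
  have energy: "E v = E 0 + A v v / 2" for v
  proof -
    have "((\<lambda>s. E (0 + s *\<^sub>R v) - s\<^sup>2 * A v v / 2) has_real_derivative 0) (at s)" for s
      using line[of 0 v s] by (auto intro!: derivative_eq_intros simp: blinfun.scaleR_right blinfun.scaleR_left)
    then have "E (0 + 1 *\<^sub>R v) - 1\<^sup>2 * A v v / 2 = E (0 + 0 *\<^sub>R v) - 0\<^sup>2 * A v v / 2"
      using DERIV_isconst_all[of "\<lambda>s. E (0 + s *\<^sub>R v) - s\<^sup>2 * A v v / 2" 1 0] by blast
    then show ?thesis by simp
  qed
  \<comment> \<open>The derivative of \<open>E\<close> along a line is computed from the gradient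
    and again from the quadratic formula; the latter symmetrizes \<open>A\<close>.\<close>
  have sym: "A v w = A w v" for v w
  proof -
    have "(\<lambda>s. E (v + s *\<^sub>R w)) = (\<lambda>s. E 0 + (A v v + s * A v w + s * A w v + s\<^sup>2 * A w w) / 2)"
      by (subst energy) (simp add: blinfun.add_left blinfun.add_right blinfun.scaleR_left
          blinfun.scaleR_right fun_eq_iff power2_eq_square algebra_simps)
    moreover have "((\<lambda>s. E 0 + (A v v + s * A v w + s * A w v + s\<^sup>2 * A w w) / 2)
        has_real_derivative (A v w + A w v) / 2) (at 0)"
      by (auto intro!: derivative_eq_intros)
    ultimately have "((\<lambda>s. E (v + s *\<^sub>R w)) has_real_derivative (A v w + A w v) / 2) (at 0)" by simp
    with line[of v w 0] have "A (v + 0 *\<^sub>R w) w = (A v w + A w v) / 2" by (rule DERIV_unique)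
    then show ?thesis by simp
  qed
  \<comment> \<open>By linearity \<open>Q\<close> is homogeneous of degree 2 in \<open>v\<close>,
    the coercive term of degree \<open>p\<close>. For \<open>p \<noteq> 2\<close> and
    \<open>v \<noteq> 0\<close> the multiple \<open>s\<close> with \<open>s powr (p - 2) = r\<close>
    leads to \<open>\<bar>Q\<bar> + 1 \<le> Q\<close>, so only the zero vector remains.\<close>
  have garding: "C1 * (norm v)\<^sup>2 \<le> A v v + C2 * (norm (\<iota> v))\<^sup>2" for v
  proof -
    define Q where "Q = A v v + C2 * (norm (\<iota> v))\<^sup>2"
    have scaled: "C1 * (s powr p * norm v powr p) \<le> s\<^sup>2 * Q" if "s > 0" for s
      using coercive[of "s *\<^sub>R v"] that unfolding gat A[symmetric] Q_def
      by (simp add: blinfun.scaleR_left blinfun.scaleR_right powr_mult power_mult_distrib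
          power2_eq_square algebra_simps)
    show ?thesis
    proof (cases "p = 2 \<or> v = 0")
      case True
      then show ?thesis using scaled[of 1] by (auto simp: Q_def)
    next
      case False
      define K where "K = C1 * norm v powr p"
      have K: "K > 0" using False C1 by (simp add: K_def)
      define r where "r = (\<bar>Q\<bar> + 1) / K"
      have r: "r > 0" using K by (simp add: r_def add_nonneg_pos)
      define s where "s = r powr (1 / (p - 2))"
      have s: "s > 0" using r by (simp add: s_def)
      have "s powr p = s powr (p - 2) * s powr 2" using powr_add[of s "p - 2" 2] by simp
      also have "s powr (p - 2) = r" using False r by (simp add: s_def powr_powr)
      finally have "s\<^sup>2 * (r * K) \<le> s\<^sup>2 * Q" using scaled[OF s] s by (simp add: K_def mult_ac)
      then have "r * K \<le> Q" using s by simp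
      then show ?thesis using K by (simp add: r_def)
    qed
  qed
  show thesis
  proof (rule that[of A])
    show "garding_form \<iota> A C1 C2"
      by unfold_locales (use emb sym C1 garding in auto)
    show "grad_H E v = blinfun_apply A v" for v by (simp add: grad A)
  qed (rule energy)
qed

section \<open>Test functions\<close>

text \<open>The derivative is quantified existentially, so that closure properties are proved from
  derivative rules without computing iterates of \<open>deriv\<close>; the form used in
  \<open>test_function\<close> is recovered at the end.\<close>

primrec times_differentiable :: "nat \<Rightarrow> (real \<Rightarrow> real) \<Rightarrow> bool" where
  "times_differentiable 0 f \<longleftrightarrow> True"
| "times_differentiable (Suc n) f \<longleftrightarrow>
     (\<exists>f'. (\<forall>x. (f has_real_derivative f' x) (at x)) \<and> times_differentiable n f')"

lemma times_differentiable_mono: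
  "times_differentiable (Suc n) f \<Longrightarrow> times_differentiable n f"
proof (induction n arbitrary: f)
  case (Suc n)
  then show ?case by (metis times_differentiable.simps(2))
qed simp

lemma times_differentiable_iterated_deriv:
  "times_differentiable (n + k) f \<Longrightarrow> times_differentiable k ((deriv ^^ n) f)"
proof (induction n arbitrary: f)
  case (Suc n)
  then obtain f' where "\<And>x. (f has_real_derivative f' x) (at x)" "times_differentiable (n + k) f'"
    by auto
  moreover from this have "deriv f = f'" by (auto intro: DERIV_imp_deriv)
  ultimately show ?case using Suc.IH[of f'] by (simp add: funpow_swap1)
qed simp

lemma times_differentiable_imp_field_differentiable:
  assumes "\<And>n. times_differentiable n f"
  shows "(deriv ^^ n) f field_differentiable at x"
proof -
  have "times_differentiable (Suc 0) ((deriv ^^ n) f)"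
    by (rule times_differentiable_iterated_deriv) (rule assms)
  then show ?thesis by (auto simp: field_differentiable_def)
qed

lemma times_differentiable_add:
  "times_differentiable n f \<Longrightarrow> times_differentiable n g \<Longrightarrow> times_differentiable n (\<lambda>x. f x + g x)"
proof (induction n arbitrary: f g)
  case (Suc n)
  then obtain f' g' where "\<forall>x. (f has_real_derivative f' x) (at x)" "times_differentiable n f'"
    "\<forall>x. (g has_real_derivative g' x) (at x)" "times_differentiable n g'" by auto
  then show ?case using Suc.IH
    by (auto intro!: exI[of _ "\<lambda>x. f' x + g' x"] DERIV_add)
qed simp

lemma times_differentiable_mult:
  "times_differentiable n f \<Longrightarrow> times_differentiable n g \<Longrightarrow> times_differentiable n (\<lambda>x. f x * g x)"
proof (induction n arbitrary: f g)
  case (Suc n)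
  then obtain f' g' where d: "\<forall>x. (f has_real_derivative f' x) (at x)" "times_differentiable n f'"
    "\<forall>x. (g has_real_derivative g' x) (at x)" "times_differentiable n g'" by auto
  have "times_differentiable n f" "times_differentiable n g"
    using Suc.prems times_differentiable_mono by blast+
  then have "times_differentiable n (\<lambda>x. f' x * g x + g' x * f x)"
    using d Suc.IH by (intro times_differentiable_add) auto
  moreover have "((\<lambda>x. f x * g x) has_real_derivative f' x * g x + g' x * f x) (at x)" for x
    using d DERIV_mult by blast
  ultimately show ?case by (auto intro!: exI[of _ "\<lambda>x. f' x * g x + g' x * f x"])
qed simp

lemma times_differentiable_const: "times_differentiable n (\<lambda>x. c)"
proof (induction n arbitrary: c)
  case (Suc n)
  then show ?case
    unfolding times_differentiable.simps by (intro exI[of _ "\<lambda>x. 0"] conjI allI DERIV_const)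
qed simp

lemma times_differentiable_diff:
  assumes "times_differentiable n f" "times_differentiable n g"
  shows "times_differentiable n (\<lambda>x. f x - g x)"
  using times_differentiable_add[OF assms(1) times_differentiable_mult[OF times_differentiable_const[of n "- 1"] assms(2)]]
  by simp

lemma times_differentiable_affine:
  "times_differentiable n f \<Longrightarrow> times_differentiable n (\<lambda>x. f (m * x + c))"
proof (induction n arbitrary: f)
  case (Suc n)
  then obtain f' where f': "\<And>x. (f has_real_derivative f' x) (at x)" "times_differentiable n f'"
    by auto
  have "times_differentiable n (\<lambda>x. f' (m * x + c) * m)"
    using f' Suc.IH by (intro times_differentiable_mult times_differentiable_const) auto
  moreover have "((\<lambda>x. f (m * x + c)) has_real_derivative f' (m * x + c) * m) (at x)" for x
    by (rule DERIV_chain2[OF f'(1)]) (auto intro!: derivative_eq_intros)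
  ultimately show ?case by (auto intro!: exI[of _ "\<lambda>x. f' (m * x + c) * m"])
qed simp

text \<open>The family \<open>P(1/x) e\<^bsup>-1/x\<^esup>\<close> (extended by \<open>0\<close> to \<open>x \<le> 0\<close>) is closed under differentiation.\<close>

definition flat_exp :: "real poly \<Rightarrow> real \<Rightarrow> real" where
  "flat_exp P x = (if x > 0 then poly P (1 / x) * exp (- (1 / x)) else 0)"

text \<open>The power \<open>y ^ k\<close> is carried along for the induction: the tail of
  \<open>pCons a P\<close> brings one more factor \<open>y\<close>.\<close>

lemma poly_times_exp_minus_tendsto_0:
  "((\<lambda>y. y ^ k * poly P y * exp (- y)) \<longlongrightarrow> (0 :: real)) at_top"
proof (induction P arbitrary: k)
  case (pCons a P)
  have "((\<lambda>y. a * (y ^ k / exp y) + y ^ Suc k * poly P y * exp (- y)) \<longlongrightarrow> a * 0 + 0) at_top"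
    by (intro tendsto_intros tendsto_power_div_exp_0 pCons)
  then show ?case by (simp add: exp_minus field_simps)
qed simp

text \<open>The factor \<open>monom 1 2\<close> is the \<open>1 / x\<^sup>2\<close> from the inner
  derivative of \<open>1 / x\<close>. At \<open>x = 0\<close> the right difference quotient, in the
  variable \<open>1 / h\<close>, is a polynomial against a decaying exponential.\<close>

lemma flat_exp_derivative:
  "(flat_exp P has_real_derivative flat_exp (monom 1 2 * (P - pderiv P)) x) (at x)"
proof (cases "x = 0")
  case False
  show ?thesis
  proof (cases "x > 0")
    case True
    have "((\<lambda>x. poly P (1 / x) * exp (- (1 / x))) has_real_derivative
        flat_exp (monom 1 2 * (P - pderiv P)) x) (at x)"
      using True by (auto intro!: derivative_eq_intros simp: flat_exp_def poly_monom power2_eq_square field_simps)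
    then show ?thesis
      by (rule has_field_derivative_transform_within_open[where S = "{0<..}"])
        (use True in \<open>auto simp: flat_exp_def\<close>)
  next
    case False
    then have "x < 0" using \<open>x \<noteq> 0\<close> by simp
    have "((\<lambda>x. 0) has_real_derivative flat_exp (monom 1 2 * (P - pderiv P)) x) (at x)"
      using \<open>x < 0\<close> by (auto simp: flat_exp_def)
    then show ?thesis
      by (rule has_field_derivative_transform_within_open[where S = "{..<0}"])
        (use \<open>x < 0\<close> in \<open>auto simp: flat_exp_def\<close>)
  qed
next
  case True
  have "((\<lambda>y. y ^ 1 * poly P y * exp (- y)) \<longlongrightarrow> 0) at_top" by (rule poly_times_exp_minus_tendsto_0)
  from filterlim_compose[OF this filterlim_inverse_at_top_right]
  have "((\<lambda>h. flat_exp P h / h) \<longlongrightarrow> 0) (at_right 0)"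
    by (rule Lim_transform_eventually)
       (auto simp: flat_exp_def eventually_at_right_field field_simps intro!: exI[of _ 1])
  moreover have "((\<lambda>h. flat_exp P h / h) \<longlongrightarrow> 0) (at_left 0)"
    by (rule Lim_transform_eventually[of "\<lambda>_. 0"])
       (auto simp: flat_exp_def eventually_at_left_field intro!: exI[of _ "-1"])
  ultimately have "((\<lambda>h. flat_exp P h / h) \<longlongrightarrow> 0) (at 0)"
    by (simp add: filterlim_split_at)
  then show ?thesis using True by (simp add: DERIV_def flat_exp_def)
qed

lemma times_differentiable_flat_exp: "times_differentiable n (flat_exp P)"
proof (induction n arbitrary: P)
  case (Suc n)
  then show ?case
    unfolding times_differentiable.simps using flat_exp_derivative by blast
qed simp

text \<open>Between -1 and 1 this is the standard bump
  \<open>exp (- 2 / (1 - x\<^sup>2))\<close>.\<close>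

definition bump :: "real \<Rightarrow> real" where
  "bump x = flat_exp 1 (1 + x) * flat_exp 1 (1 - x)"

lemma times_differentiable_bump: "times_differentiable n bump"
proof -
  have "times_differentiable n (\<lambda>x. flat_exp 1 (1 * x + 1) * flat_exp 1 (- 1 * x + 1))"
    by (intro times_differentiable_mult times_differentiable_affine times_differentiable_flat_exp)
  also have "(\<lambda>x. flat_exp 1 (1 * x + 1) * flat_exp 1 (- 1 * x + 1)) = bump"
    by (auto simp: bump_def add.commute)
  finally show ?thesis .
qed

lemma flat_exp_1: "x > 0 \<Longrightarrow> flat_exp 1 x > 0" "x \<le> 0 \<Longrightarrow> flat_exp 1 x = 0" "flat_exp 1 x \<ge> 0"
  by (auto simp: flat_exp_def)

lemma bump_nonneg: "bump x \<ge> 0"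
  unfolding bump_def by (intro mult_nonneg_nonneg flat_exp_1)

lemma bump_0: "bump 0 > 0"
  unfolding bump_def by (intro mult_pos_pos flat_exp_1) auto

lemma bump_eq_0: "\<bar>x\<bar> \<ge> 1 \<Longrightarrow> bump x = 0"
  unfolding bump_def using flat_exp_1(2)[of "1 + x"] flat_exp_1(2)[of "1 - x"]
  by (cases "x \<ge> 1") auto

lemma continuous_on_bump: "continuous_on S bump"
proof -
  obtain f' where "\<And>x. (bump has_real_derivative f' x) (at x)"
    using times_differentiable_bump[of 1] by auto
  then show ?thesis
    by (meson DERIV_isCont continuous_at_imp_continuous_on)
qed

lemma antiderivative_of_compact_support:
  fixes \<theta> :: "real \<Rightarrow> real"
  assumes cont: "continuous_on UNIV \<theta>" and zero: "\<And>x. x \<notin> {c..d} \<Longrightarrow> \<theta> x = 0"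
  shows "((\<lambda>x. integral {c..x} \<theta>) has_real_derivative \<theta> x) (at x)"
proof -
  define a where "a = min c x - 1"
  have eq: "integral {a..y} \<theta> = integral {c..y} \<theta>" if "y \<in> {a<..<x + 1}" for y
  proof (cases "y \<ge> c")
    case True
    have "integral {a..c} \<theta> + integral {c..y} \<theta> = integral {a..y} \<theta>"
      using True that by (intro Henstock_Kurzweil_Integration.integral_combine integrable_continuous_real
          continuous_on_subset[OF cont]) (auto simp: a_def)
    moreover have "integral {a..c} \<theta> = 0"
    proof -
      have "integral {a..c} \<theta> = integral {a..c} (\<lambda>_. 0)"
        using zero by (intro integral_spike[of "{c}"]) auto
      then show ?thesis by simp
    qed
    ultimately show ?thesis by simp
  next
    case False
    then have "integral {a..y} \<theta> = integral {a..y} (\<lambda>_. 0)"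
      using zero by (intro integral_cong) auto
    then show ?thesis using False by simp
  qed
  have "((\<lambda>y. integral {a..y} \<theta>) has_real_derivative \<theta> x) (at x within {a..x + 1})"
    by (intro integral_has_real_derivative continuous_on_subset[OF cont]) (auto simp: a_def)
  then have "((\<lambda>y. integral {a..y} \<theta>) has_real_derivative \<theta> x) (at x)"
    using at_within_Icc_at[of a x "x + 1"] by (simp add: a_def)
  then show ?thesis
    by (rule has_field_derivative_transform_within_open[where S = "{a<..<x + 1}"])
       (use eq in \<open>auto simp: a_def\<close>)
qed


text \<open>Mean zero makes the antiderivative vanish again to the right of \<open>d\<close>, so its
  support is compact.\<close>

lemma test_function_antiderivative:
  assumes \<theta>: "\<And>n. times_differentiable n \<theta>" and zero: "\<And>x. x \<notin> {c..d} \<Longrightarrow> \<theta> x = 0"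
    and int0: "integral {c..d} \<theta> = 0" and cd: "0 < c" "c \<le> d" "d < T"
  shows "test_function T (\<lambda>x. integral {c..x} \<theta>)" "deriv (\<lambda>x. integral {c..x} \<theta>) = \<theta>"
proof -
  let ?\<phi> = "\<lambda>x. integral {c..x} \<theta>"
  obtain \<theta>' where "\<And>x. (\<theta> has_real_derivative \<theta>' x) (at x)"
    using \<theta>[of 1] by auto
  then have cont: "continuous_on S \<theta>" for S
    by (meson DERIV_isCont continuous_at_imp_continuous_on)
  have D: "(?\<phi> has_real_derivative \<theta> x) (at x)" for x
    by (rule antiderivative_of_compact_support[OF cont zero])
  then show "deriv ?\<phi> = \<theta>" by (auto intro: DERIV_imp_deriv)
  have "times_differentiable n ?\<phi>" for n
    using D \<theta> by (cases n) auto
  then have "(deriv ^^ n) ?\<phi> field_differentiable at x" for n x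
    by (rule times_differentiable_imp_field_differentiable)
  moreover have "?\<phi> x = 0" if "x \<notin> {c..d}" for x
  proof (cases "x < c")
    case False
    then have "x > d" using that by auto
    have "integral {c..d} \<theta> + integral {d..x} \<theta> = integral {c..x} \<theta>"
      using \<open>x > d\<close> cd by (intro Henstock_Kurzweil_Integration.integral_combine
          integrable_continuous_real cont) auto
    moreover have "integral {d..x} \<theta> = integral {d..x} (\<lambda>_. 0)"
      using zero by (intro integral_spike[of "{d}"]) auto
    ultimately show ?thesis using int0 by simp
  qed simp
  ultimately show "test_function T ?\<phi>"
    unfolding test_function_def using cd by (intro conjI allI exI[of _ "{c..d}"]) auto
qed

text \<open>Test with the antiderivative of the difference of two narrow bumps centred at \<open>a\<close> and \<open>b\<close>.\<close>

lemma du_Bois_Reymond: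
  fixes \<psi> :: "real \<Rightarrow> real"
  assumes cont: "continuous_on {0<..<T} \<psi>"
    and test: "\<And>\<phi>. test_function T \<phi> \<Longrightarrow> continuous_on UNIV (deriv \<phi>) \<Longrightarrow>
      integral {0..T} (\<lambda>t. deriv \<phi> t * \<psi> t) = 0"
    and ab: "a \<in> {0<..<T}" "b \<in> {0<..<T}"
  shows "\<psi> a \<le> \<psi> b"
proof (rule ccontr)
  assume "\<not> \<psi> a \<le> \<psi> b"
  \<comment> \<open>The two values trisect the supposed gap and separate \<psi> near
    \<open>a\<close> from \<psi> near \<open>b\<close>. The claim is one-sided; exchanging
    \<open>a\<close> and \<open>b\<close> gives constancy.\<close>
  define m m' where "m = (2 * \<psi> a + \<psi> b) / 3" and "m' = (\<psi> a + 2 * \<psi> b) / 3"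
  have m: "\<psi> b < m'" "m' < m" "m < \<psi> a" using \<open>\<not> \<psi> a \<le> \<psi> b\<close> by (auto simp: m_def m'_def)
  have op: "open {0<..<T}" by simp
  have "isCont \<psi> a" "isCont \<psi> b"
    using cont ab continuous_on_eq_continuous_at[OF op] by blast+
  then have "\<forall>\<^sub>F x in nhds a. m < \<psi> x" "\<forall>\<^sub>F x in nhds b. \<psi> x < m'"
    using m by (auto simp: isCont_def tendsto_at_iff_tendsto_nhds dest: order_tendstoD)
  moreover have "\<forall>\<^sub>F x in nhds a. x \<in> {0<..<T}" "\<forall>\<^sub>F x in nhds b. x \<in> {0<..<T}"
    using ab op by (auto intro: eventually_nhds_in_open simp del: greaterThanLessThan_iff)
  ultimately have "\<forall>\<^sub>F x in nhds a. m < \<psi> x \<and> x \<in> {0<..<T}" "\<forall>\<^sub>F x in nhds b. \<psi> x < m' \<and> x \<in> {0<..<T}"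
    by (auto elim: eventually_elim2)
  then obtain \<epsilon>1 \<epsilon>2 where \<epsilon>12: "\<epsilon>1 > 0" "\<epsilon>2 > 0"
    "\<And>x. dist x a < \<epsilon>1 \<Longrightarrow> m < \<psi> x \<and> x \<in> {0<..<T}"
    "\<And>x. dist x b < \<epsilon>2 \<Longrightarrow> \<psi> x < m' \<and> x \<in> {0<..<T}"
    unfolding eventually_nhds_metric by metis
  define \<epsilon> where "\<epsilon> = min \<epsilon>1 \<epsilon>2 / 2"
  have \<epsilon>: "\<epsilon> > 0" using \<epsilon>12 by (auto simp: \<epsilon>_def)
  have near_a: "m < \<psi> x" "0 < x" "x < T" if "x \<in> {a - \<epsilon>..a + \<epsilon>}" for x
    using \<epsilon>12(3)[of x] \<epsilon>12(1,2) that by (auto simp: dist_real_def \<epsilon>_def)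
  have near_b: "\<psi> x < m'" "0 < x" "x < T" if "x \<in> {b - \<epsilon>..b + \<epsilon>}" for x
    using \<epsilon>12(4)[of x] \<epsilon>12(1,2) that by (auto simp: dist_real_def \<epsilon>_def)
  define \<kappa> where "\<kappa> c x = bump (1 / \<epsilon> * x + - c / \<epsilon>)" for c x
  have \<kappa>_smooth: "times_differentiable n (\<kappa> c)" for n c
    unfolding \<kappa>_def[abs_def] by (intro times_differentiable_affine times_differentiable_bump)
  have \<kappa>_cont: "continuous_on S (\<kappa> c)" for S c
    unfolding \<kappa>_def[abs_def]
    by (intro continuous_on_compose2[OF continuous_on_bump[of UNIV]] continuous_intros) auto
  have \<kappa>_zero: "\<kappa> c x = 0" if "x \<notin> {c - \<epsilon>..c + \<epsilon>}" for c x
    unfolding \<kappa>_def using that \<epsilon> by (intro bump_eq_0) (auto simp: abs_if field_simps)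
  have \<kappa>_nonneg: "\<kappa> c x \<ge> 0" for c x by (simp add: \<kappa>_def bump_nonneg)
  define I where "I = integral {0..T} (\<kappa> a)"
  have inside: "integral {0..T} f = integral {c - \<epsilon>..c + \<epsilon>} f"
    if "\<And>x. x \<notin> {c - \<epsilon>..c + \<epsilon>} \<Longrightarrow> f x = 0" "{c - \<epsilon>..c + \<epsilon>} \<subseteq> {0..T}" for c and f :: "real \<Rightarrow> real"
  proof -
    have "integral {0..T} f = integral {0..T} (\<lambda>x. if x \<in> {c - \<epsilon>..c + \<epsilon>} then f x else 0)"
      using that(1) by (intro integral_cong) auto
    also have "\<dots> = integral {c - \<epsilon>..c + \<epsilon>} f"
      unfolding integral_restrict_Int Int_absorb2[OF that(2)] ..
    finally show ?thesis .
  qed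
  have sub_a: "{a - \<epsilon>..a + \<epsilon>} \<subseteq> {0..T}" and sub_b: "{b - \<epsilon>..b + \<epsilon>} \<subseteq> {0..T}"
    using near_a near_b by (auto simp del: atLeastAtMost_iff simp: subset_eq) (auto intro: less_imp_le)
  \<comment> \<open>The mass of a bump does not depend on its centre, so the difference of two bumps
    has mean zero.\<close>
  define J where "J c = integral {c - \<epsilon>..c + \<epsilon>} (\<kappa> c)" for c
  have J_eq: "J c = J 0" for c
  proof -
    have "integral {0 - \<epsilon>..0 + \<epsilon>} (\<kappa> c \<circ> (\<lambda>x. x + c)) = integral {0 - \<epsilon> + c..0 + \<epsilon> + c} (\<kappa> c)"
      by (intro integral_shift \<kappa>_cont)
    moreover have "\<kappa> c \<circ> (\<lambda>x. x + c) = \<kappa> 0"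
      using \<epsilon> by (auto simp: \<kappa>_def fun_eq_iff field_simps)
    ultimately show ?thesis by (simp add: J_def add.commute)
  qed
  have J_pos: "J c > 0" for c
  proof -
    have "J 0 \<ge> 0" unfolding J_def by (intro Henstock_Kurzweil_Integration.integral_nonneg
          integrable_continuous_real \<kappa>_cont) (rule \<kappa>_nonneg)
    moreover have "J 0 \<noteq> 0"
    proof
      assume "J 0 = 0"
      then have "\<forall>x\<in>{0 - \<epsilon>..0 + \<epsilon>}. \<kappa> 0 x = 0"
        unfolding J_def using \<epsilon> by (subst (asm) integral_eq_0_iff) (auto intro: \<kappa>_cont \<kappa>_nonneg)
      then have "\<kappa> 0 0 = 0" using \<epsilon> by auto
      then show False using bump_0 by (simp add: \<kappa>_def)
    qed
    ultimately show ?thesis using J_eq[of c] by simp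
  qed
  define c where "c = min a b - \<epsilon>"
  define d where "d = max a b + \<epsilon>"
  define \<theta> where "\<theta> x = \<kappa> a x - \<kappa> b x" for x
  have \<theta>_zero: "\<theta> x = 0" if "x \<notin> {c..d}" for x
  proof -
    have "x \<notin> {a - \<epsilon>..a + \<epsilon>}" "x \<notin> {b - \<epsilon>..b + \<epsilon>}"
      using that by (auto simp: c_def d_def min_def max_def split: if_splits)
    then show ?thesis by (simp add: \<theta>_def \<kappa>_zero)
  qed
  have \<theta>_smooth: "times_differentiable n \<theta>" for n
    unfolding \<theta>_def[abs_def] by (intro times_differentiable_diff \<kappa>_smooth)
  have \<theta>_cont: "continuous_on S \<theta>" for S
    unfolding \<theta>_def[abs_def] by (intro continuous_intros \<kappa>_cont)
  have cd: "0 < c" "c \<le> d" "d < T"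
    using near_a(2)[of "a - \<epsilon>"] near_a(3)[of "a + \<epsilon>"] near_b(2)[of "b - \<epsilon>"] near_b(3)[of "b + \<epsilon>"] \<epsilon>
    by (auto simp: c_def d_def)
  have \<kappa>_int: "integral {0..T} (\<kappa> a) = J a" "integral {0..T} (\<kappa> b) = J b"
    unfolding J_def using \<kappa>_zero sub_a sub_b by (intro inside; blast)+
  have "integral {c..d} \<theta> = integral {0..T} (\<lambda>x. if x \<in> {c..d} then \<theta> x else 0)"
    using cd unfolding integral_restrict_Int by (subst Int_absorb2) auto
  also have "\<dots> = integral {0..T} \<theta>"
    using \<theta>_zero by (intro integral_cong) auto
  also have "\<dots> = J a - J b"
    unfolding \<theta>_def \<kappa>_int[symmetric]
    by (intro Henstock_Kurzweil_Integration.integral_diff integrable_continuous_real \<kappa>_cont)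
  finally have "integral {c..d} \<theta> = 0" using J_eq[of a] J_eq[of b] by simp
  then have tf: "test_function T (\<lambda>x. integral {c..x} \<theta>)" "deriv (\<lambda>x. integral {c..x} \<theta>) = \<theta>"
    using test_function_antiderivative[of \<theta> c d T] \<theta>_smooth \<theta>_zero cd by blast+
  have "integral {0..T} (\<lambda>t. \<theta> t * \<psi> t) = 0"
    using test[OF tf(1)] \<theta>_cont[of UNIV] unfolding tf(2) by blast
  moreover
  have \<psi>_cont: "continuous_on {a - \<epsilon>..a + \<epsilon>} \<psi>" "continuous_on {b - \<epsilon>..b + \<epsilon>} \<psi>"
    by (rule continuous_on_subset[OF cont], use near_a near_b in auto)+
  have ia: "(\<lambda>t. \<kappa> a t * \<psi> t) integrable_on {a - \<epsilon>..a + \<epsilon>}"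
    and ib: "(\<lambda>t. \<kappa> b t * \<psi> t) integrable_on {b - \<epsilon>..b + \<epsilon>}"
    by (intro integrable_continuous_real continuous_intros \<kappa>_cont \<psi>_cont)+
  have Ia: "integral {0..T} (\<lambda>t. \<kappa> a t * \<psi> t) = integral {a - \<epsilon>..a + \<epsilon>} (\<lambda>t. \<kappa> a t * \<psi> t)"
    and Ib: "integral {0..T} (\<lambda>t. \<kappa> b t * \<psi> t) = integral {b - \<epsilon>..b + \<epsilon>} (\<lambda>t. \<kappa> b t * \<psi> t)"
    using \<kappa>_zero sub_a sub_b by (intro inside; simp)+
  have ext: "f integrable_on {0..T}" if "f integrable_on {c - \<epsilon>..c + \<epsilon>}"
    "\<And>x. x \<notin> {c - \<epsilon>..c + \<epsilon>} \<Longrightarrow> f x = 0" "{c - \<epsilon>..c + \<epsilon>} \<subseteq> {0..T}" for c and f :: "real \<Rightarrow> real"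
    by (rule integrable_on_superset[OF that(1)]) (use that in auto)
  have "integral {0..T} (\<lambda>t. \<theta> t * \<psi> t)
      = integral {0..T} (\<lambda>t. \<kappa> a t * \<psi> t) - integral {0..T} (\<lambda>t. \<kappa> b t * \<psi> t)"
    unfolding \<theta>_def left_diff_distrib
    using \<kappa>_zero ia ib sub_a sub_b
    by (intro Henstock_Kurzweil_Integration.integral_diff ext[where c = a] ext[where c = b]) auto
  moreover have "m * J a \<le> integral {a - \<epsilon>..a + \<epsilon>} (\<lambda>t. \<kappa> a t * \<psi> t)"
  proof -
    have "m * J a = integral {a - \<epsilon>..a + \<epsilon>} (\<lambda>t. m * \<kappa> a t)" by (simp add: J_def)
    also have "\<dots> \<le> integral {a - \<epsilon>..a + \<epsilon>} (\<lambda>t. \<kappa> a t * \<psi> t)"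
    proof (intro Henstock_Kurzweil_Integration.integral_le ia)
      fix t assume "t \<in> {a - \<epsilon>..a + \<epsilon>}"
      then have "\<kappa> a t * m \<le> \<kappa> a t * \<psi> t"
        using near_a(1)[of t] \<kappa>_nonneg[of a t] by (intro mult_left_mono) auto
      then show "m * \<kappa> a t \<le> \<kappa> a t * \<psi> t" by (simp add: mult.commute)
    qed (intro integrable_continuous_real continuous_intros \<kappa>_cont)
    finally show ?thesis .
  qed
  moreover have "integral {b - \<epsilon>..b + \<epsilon>} (\<lambda>t. \<kappa> b t * \<psi> t) \<le> m' * J b"
  proof -
    have "integral {b - \<epsilon>..b + \<epsilon>} (\<lambda>t. \<kappa> b t * \<psi> t) \<le> integral {b - \<epsilon>..b + \<epsilon>} (\<lambda>t. m' * \<kappa> b t)"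
    proof (intro Henstock_Kurzweil_Integration.integral_le ib)
      fix t assume "t \<in> {b - \<epsilon>..b + \<epsilon>}"
      then have "\<kappa> b t * \<psi> t \<le> \<kappa> b t * m'"
        using near_b(1)[of t] \<kappa>_nonneg[of b t] by (intro mult_left_mono) auto
      then show "\<kappa> b t * \<psi> t \<le> m' * \<kappa> b t" by (simp add: mult.commute)
    qed (intro integrable_continuous_real continuous_intros \<kappa>_cont)
    also have "\<dots> = m' * J b" by (simp add: J_def)
    finally show ?thesis .
  qed
  ultimately have "m * J a \<le> m' * J b" unfolding Ia Ib by simp
  then have "m * J 0 \<le> m' * J 0" using J_eq[of a] J_eq[of b] by simp
  then show False using m J_pos[of 0] by simp
qed

section \<open>Dissipation for scalar equations with memory\<close>

text \<open>The total mass of \<mu> may be infinite. By Tonelli the last assumption says that the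
  superposition of the exponentials \<open>exp (- \<sigma> x * r)\<close> is integrable in
  \<open>r\<close> over \<open>{0..T}\<close>.\<close>

locale memory_kernel = sigma_finite_measure \<mu> for \<mu> :: "'c measure" +
  fixes \<sigma> :: "'c \<Rightarrow> real" and T :: real
  assumes \<sigma>_measurable [measurable]: "\<sigma> \<in> borel_measurable \<mu>"
    and \<sigma>_pos: "\<And>x. \<sigma> x > 0"
    and T_pos: "T > 0"
    and dominator_integrable: "integrable \<mu> (\<lambda>x. (1 - exp (- \<sigma> x * T)) / \<sigma> x)"
begin

definition B :: "'c \<Rightarrow> real" where
  "B x = (1 - exp (- \<sigma> x * T)) / \<sigma> x"

lemma B_nonneg: "B x \<ge> 0"
  using \<sigma>_pos[of x] T_pos by (simp add: B_def)

text \<open>Absorbs the possibly unbounded \<sigma>: a mode bounded by \<open>M * B x\<close> has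
  \<open>\<sigma> x * f\<^sup>2 \<le> M\<^sup>2 * B x\<close>, an integrable majorant.\<close>

lemma \<sigma>_B_le_1: "\<sigma> x * B x \<le> 1"
  using \<sigma>_pos[of x] by (simp add: B_def)

lemma B_measurable [measurable]: "B \<in> borel_measurable \<mu>"
  unfolding B_def[abs_def] by measurable

lemma B_integrable: "integrable \<mu> B"
  using dominator_integrable by (simp add: B_def[abs_def])

end

text \<open>Kept apart from the continuous case because the modes of a merely measurable coefficient
  are used to construct its continuous representative.\<close>

locale memory_input = memory_kernel +
  fixes y :: "real \<Rightarrow> real" and M :: real
  assumes y_measurable [measurable]: "y \<in> borel_measurable borel"
    and y_bound: "\<And>t. \<bar>y t\<bar> \<le> M"
begin

definition Z :: "real \<Rightarrow> 'a \<Rightarrow> real" where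
  "Z t x = integral {0..t} (\<lambda>s. exp (- \<sigma> x * (t - s)) * y s)"

lemma M_nonneg: "M \<ge> 0"
  using y_bound[of 0] by linarith

lemma set_integrable_cont_mult_y:
  assumes f: "continuous_on UNIV f"
  shows "set_integrable lborel {a..b} (\<lambda>s. f s * y s)"
proof -
  obtain K where K: "\<And>s. s \<in> {a..b} \<Longrightarrow> \<bar>f s\<bar> \<le> K"
    using f by (rule continuous_bounded_on_Icc) blast
  have [measurable]: "f \<in> borel_measurable borel" using f by (rule borel_measurable_continuous_onI)
  show ?thesis
  proof (rule set_integrable_bounded_borel)
    show "\<bar>f s * y s\<bar> \<le> K * M" if "s \<in> {a..b}" for s
      unfolding abs_mult using K[OF that] y_bound[of s] by (intro mult_mono) auto
  qed measurable
qed

lemma y_integrable_on: "y integrable_on {a..b}"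
  using set_integrable_cont_mult_y[of "\<lambda>_. 1" a b] set_borel_integral_eq_integral(1) by auto

lemma exp_y_integrable_on: "(\<lambda>s. exp (c * (t - s)) * y s) integrable_on {a..b}"
  by (intro set_borel_integral_eq_integral(1) set_integrable_cont_mult_y continuous_intros)

text \<open>With the limits of integration moved into the integrand, joint measurability in
  \<open>t\<close> and \<open>x\<close> can be read off.\<close>

lemma Z_eq_lebesgue:
  "Z t x = (LINT s|lborel. (if 0 \<le> s \<and> s \<le> t then exp (- \<sigma> x * (t - s)) * y s else 0))"
proof -
  have "Z t x = (LINT s:{0..t}|lborel. exp (- \<sigma> x * (t - s)) * y s)"
    unfolding Z_def
    by (intro set_borel_integral_eq_integral(2)[symmetric] set_integrable_cont_mult_y continuous_intros)
  also have "\<dots> = (LINT s|lborel. (if 0 \<le> s \<and> s \<le> t then exp (- \<sigma> x * (t - s)) * y s else 0))"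
    unfolding set_lebesgue_integral_def by (intro Bochner_Integration.integral_cong) auto
  finally show ?thesis .
qed

lemma Z_measurable_pair [measurable]: "(\<lambda>(t, x). Z t x) \<in> borel_measurable (borel \<Otimes>\<^sub>M \<mu>)"
  unfolding Z_eq_lebesgue by measurable

lemma Z_measurable [measurable]: "Z t \<in> borel_measurable \<mu>"
  using measurable_compose[OF measurable_Pair1' Z_measurable_pair, of t] by simp

lemma Z_bound:
  assumes "0 \<le> t" "t \<le> T"
  shows "\<bar>Z t x\<bar> \<le> M * B x"
proof -
  have "norm (Z t x) \<le> integral {0..t} (\<lambda>s. M * exp (- \<sigma> x * (t - s)))"
    unfolding Z_def
  proof (rule integral_norm_bound_integral)
    show "(\<lambda>s. M * exp (- \<sigma> x * (t - s))) integrable_on {0..t}"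
      by (intro integrable_continuous_real continuous_intros)
    show "norm (exp (- \<sigma> x * (t - s)) * y s) \<le> M * exp (- \<sigma> x * (t - s))" for s
      using y_bound[of s] by (simp add: abs_mult mult.commute mult_right_mono)
  qed (rule exp_y_integrable_on)
  also have "\<dots> = M * ((1 - exp (- \<sigma> x * t)) / \<sigma> x)"
    unfolding integral_mult_right
    using integral_unique[OF exp_decay_has_integral(2)[OF less_imp_neq[OF \<sigma>_pos[of x], THEN not_sym] assms(1)]]
    by presburger
  also have "\<dots> \<le> M * B x"
    unfolding B_def using assms \<sigma>_pos[of x] M_nonneg by (intro mult_left_mono divide_right_mono) auto
  finally show ?thesis by simp
qed

lemma \<sigma>_sq_bound:
  assumes "\<bar>f\<bar> \<le> M * B x" shows "\<bar>\<sigma> x * f\<^sup>2\<bar> \<le> M\<^sup>2 * B x"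
proof -
  have "f\<^sup>2 \<le> (M * B x)\<^sup>2"
    using assms by (metis abs_ge_zero power2_abs power_mono)
  then have "\<sigma> x * f\<^sup>2 \<le> \<sigma> x * (M * B x)\<^sup>2"
    using \<sigma>_pos[of x] by (intro mult_left_mono) auto
  also have "\<dots> = M\<^sup>2 * B x * (\<sigma> x * B x)" by (simp add: power2_eq_square)
  also have "\<dots> \<le> M\<^sup>2 * B x * 1" using \<sigma>_B_le_1 B_nonneg by (intro mult_left_mono) auto
  finally show ?thesis using \<sigma>_pos[of x] by (simp add: abs_mult)
qed

lemma \<sigma>_sq_integrable:
  assumes "f \<in> borel_measurable \<mu>" "\<And>x. \<bar>f x\<bar> \<le> M * B x"
  shows "integrable \<mu> (\<lambda>x. \<sigma> x * (f x)\<^sup>2)"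
proof (rule Bochner_Integration.integrable_bound)
  show "integrable \<mu> (\<lambda>x. M\<^sup>2 * B x)" using B_integrable by simp
  show "AE x in \<mu>. norm (\<sigma> x * (f x)\<^sup>2) \<le> norm (M\<^sup>2 * B x)"
    using \<sigma>_sq_bound[OF assms(2)] by (intro AE_I2) (simp add: order_trans[OF _ abs_ge_self])
qed (use assms(1) in measurable)

lemma Z_integrable:
  assumes "0 \<le> t" "t \<le> T" shows "integrable \<mu> (Z t)"
proof (rule Bochner_Integration.integrable_bound)
  show "integrable \<mu> (\<lambda>x. M * B x)" using B_integrable by simp
  show "AE x in \<mu>. norm (Z t x) \<le> norm (M * B x)"
    using Z_bound[OF assms] M_nonneg B_nonneg by (intro AE_I2) (simp add: abs_mult)
qed simp

text \<open>Factoring the exponential takes \<open>r\<close> out of the integrand, so regularity in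
  time is that of an indefinite integral.\<close>

lemma Z_eq_exp: "Z r x = exp (- \<sigma> x * r) * integral {0..r} (\<lambda>s. exp (\<sigma> x * s) * y s)"
proof -
  have "exp (- \<sigma> x * (r - s)) = exp (- \<sigma> x * r) * exp (\<sigma> x * s)" for s
    by (simp add: exp_add[symmetric] algebra_simps)
  then show ?thesis by (simp add: Z_def mult.assoc)
qed

lemma exp_y_integrable_on': "(\<lambda>s. exp (c * s) * y s) integrable_on {a..b}"
  using exp_y_integrable_on[of "- c" 0 a b] by simp

lemma Z_continuous: "continuous_on {0..T} (\<lambda>t. Z t x)"
  unfolding Z_eq_exp
  by (intro continuous_intros indefinite_integral_continuous_1 exp_y_integrable_on')

lemma integral_Z_continuous: "continuous_on {0..T} (\<lambda>t. LINT x|\<mu>. Z t x)"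
  unfolding continuous_on_sequentially o_def
proof (intro allI ballI impI, elim conjE)
  fix r :: "nat \<Rightarrow> real" and t
  assume t: "t \<in> {0..T}" and r: "\<forall>n. r n \<in> {0..T}" "r \<longlonglongrightarrow> t"
  show "(\<lambda>n. LINT x|\<mu>. Z (r n) x) \<longlonglongrightarrow> (LINT x|\<mu>. Z t x)"
  proof (rule integral_dominated_convergence)
    show "integrable \<mu> (\<lambda>x. M * B x)" using B_integrable by simp
    show "AE x in \<mu>. (\<lambda>n. Z (r n) x) \<longlonglongrightarrow> Z t x"
      using Z_continuous t r unfolding continuous_on_sequentially o_def by (intro AE_I2) blast
    show "AE x in \<mu>. norm (Z (r n) x) \<le> M * B x" for n
      using Z_bound[of "r n"] r(1) by (intro AE_I2) simp
  qed measurable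
qed

end

locale memory_solution = memory_input +
  assumes y_cont: "continuous_on {0<..<T} y"
begin

lemma Z_derivative:
  assumes "t \<in> {0<..<T}"
  shows "((\<lambda>t. Z t x) has_real_derivative y t - \<sigma> x * Z t x) (at t)"
proof -
  let ?f = "\<lambda>s. exp (\<sigma> x * s) * y s"
  have y_at: "continuous (at t) y"
    using y_cont assms continuous_on_eq_continuous_at[of "{0<..<T}" y] by auto
  have "((\<lambda>r. integral {0..r} ?f) has_vector_derivative ?f t) (at t within {0..T})"
  proof -
    have 1: "?f integrable_on {0..T}" by (rule exp_y_integrable_on')
    have "continuous (at t) ?f" by (intro continuous_intros y_at)
    then have 2: "continuous (at t within ({0..T} - {})) ?f"
      by (rule continuous_at_imp_continuous_at_within)
    show ?thesis
      using integral_has_vector_derivative_continuous_at[OF 1 _ _ 2] assms by simp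
  qed
  then have "((\<lambda>r. integral {0..r} ?f) has_real_derivative ?f t) (at t)"
    using assms by (simp add: has_real_derivative_iff_has_vector_derivative at_within_Icc_at)
  then have "((\<lambda>r. exp (- \<sigma> x * r) * integral {0..r} ?f) has_real_derivative
      (- \<sigma> x * exp (- \<sigma> x * t)) * integral {0..t} ?f + exp (- \<sigma> x * t) * ?f t) (at t)"
    by (auto intro!: derivative_eq_intros)
  moreover have "exp (- \<sigma> x * t) * ?f t = y t"
    by (simp add: mult.assoc[symmetric] exp_add[symmetric])
  ultimately have "((\<lambda>r. exp (- \<sigma> x * r) * integral {0..r} ?f) has_real_derivative
      (- \<sigma> x * exp (- \<sigma> x * t)) * integral {0..t} ?f + y t) (at t)" by (simp only:)
  also have "(- \<sigma> x * exp (- \<sigma> x * t)) * integral {0..t} ?f + y t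
      = y t - \<sigma> x * (exp (- \<sigma> x * t) * integral {0..t} ?f)" by (simp add: mult.assoc)
  finally show ?thesis unfolding Z_eq_exp .
qed

lemma Z_cont: "continuous_on {0<..<T} (\<lambda>t. Z t x)"
  by (intro continuous_at_imp_continuous_on ballI) (use Z_derivative DERIV_isCont in blast)

section \<open>Backward time averages and dissipation\<close>

definition avg :: "real \<Rightarrow> (real \<Rightarrow> real) \<Rightarrow> real \<Rightarrow> real" where
  "avg h f t = integral {t - h..t} f / h"

text \<open>Averaging gains one derivative on a merely continuous function. The window looks
  backward, so for \<open>h < t < T\<close> it stays inside the open interval where continuity is
  known.\<close>

lemma avg_derivative:
  assumes f: "continuous_on {0<..<T} f" and h: "0 < h" "h < t" "t < T"
  shows "(avg h f has_real_derivative (f t - f (t - h)) / h) (at t)"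
proof -
  define a where "a = (t - h) / 2"
  define b where "b = (t + T) / 2"
  have ab: "0 < a" "a < t - h" "t < b" "b < T" using h by (auto simp: a_def b_def)
  let ?F = "\<lambda>r. integral {a..r} f"
  have F: "(?F has_real_derivative f r) (at r)" if "a < r" "r < b" for r
  proof -
    have "(?F has_real_derivative f r) (at r within {a..b})"
      using that ab by (intro integral_has_real_derivative continuous_on_subset[OF f]) auto
    then show ?thesis using that by (simp add: at_within_Icc_at)
  qed
  have "((\<lambda>r. (?F r - ?F (r - h)) / h) has_real_derivative (f t - f (t - h)) / h) (at t)"
    using ab h by (auto intro!: derivative_eq_intros F DERIV_chain2[OF F, of _ _ 1])
  then show ?thesis
  proof (rule has_field_derivative_transform_within_open[where S = "{a + h<..<b}"])
    fix r assume r: "r \<in> {a + h<..<b}"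
    have "?F (r - h) + integral {r - h..r} f = ?F r"
      using r ab h by (intro Henstock_Kurzweil_Integration.integral_combine integrable_continuous_real
          continuous_on_subset[OF f]) auto
    then show "(?F r - ?F (r - h)) / h = avg h f r" by (simp add: avg_def algebra_simps)
  qed (use ab h in auto)
qed

lemma avg_bound:
  assumes f: "continuous_on {0<..<T} f" and h: "0 < h" "h < t" "t < T"
    and K: "\<And>r. r \<in> {0<..<T} \<Longrightarrow> \<bar>f r\<bar> \<le> K"
  shows "\<bar>avg h f t\<bar> \<le> K"
proof -
  have "norm (integral {t - h..t} f) \<le> integral {t - h..t} (\<lambda>_. K)"
    using h K by (intro integral_norm_bound_integral integrable_continuous_real
        continuous_on_subset[OF f]) auto
  then show ?thesis using h by (simp add: avg_def field_simps)
qed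

lemma avg_tendsto:
  assumes f: "continuous_on {0<..<T} f" and t: "0 < t" "t < T"
    and h: "h \<longlonglongrightarrow> 0" "\<And>n. 0 < h n" "\<And>n. h n < t / 2"
  shows "(\<lambda>n. avg (h n) f t) \<longlonglongrightarrow> f t"
proof -
  \<comment> \<open>As \<open>h n < t / 2\<close>, this base point lies left of every window and
    still inside the interval of continuity.\<close>
  define a where "a = t / 4"
  define b where "b = (t + T) / 2"
  have ab: "0 < a" "a < t / 2" "t < b" "b < T" using t by (auto simp: a_def b_def)
  let ?F = "\<lambda>r. integral {a..r} f"
  have "(?F has_real_derivative f t) (at t within {a..b})"
    using t ab by (intro integral_has_real_derivative continuous_on_subset[OF f]) auto
  then have "(?F has_real_derivative f t) (at t)" using ab t by (simp add: at_within_Icc_at)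
  then have "((\<lambda>k. (?F (t + k) - ?F t) / k) \<longlongrightarrow> f t) (at 0)" by (simp add: DERIV_def)
  moreover have "filterlim (\<lambda>n. - h n) (at 0) sequentially"
    unfolding filterlim_at using h tendsto_minus[OF h(1)]
    by (auto intro!: always_eventually simp: less_imp_neq[THEN not_sym])
  ultimately have "(\<lambda>n. (?F (t + - h n) - ?F t) / - h n) \<longlonglongrightarrow> f t"
    by (rule filterlim_compose)
  moreover have "(?F (t + - h n) - ?F t) / - h n = avg (h n) f t" for n
  proof -
    have "?F (t - h n) + integral {t - h n..t} f = ?F t"
      using t ab h(2,3)[of n] by (intro Henstock_Kurzweil_Integration.integral_combine
          integrable_continuous_real continuous_on_subset[OF f]) auto
    then have "?F (t + - h n) - ?F t = - integral {t - h n..t} f" by simp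
    then show ?thesis by (simp add: avg_def)
  qed
  ultimately show ?thesis by simp
qed

text \<open>The equation \<open>Z' = y - \<sigma> Z\<close>, integrated over the window: the
  averages satisfy the same linear equation.\<close>

lemma increment_Z:
  assumes h: "0 < h" "h < t" "t < T"
  shows "(Z t x - Z (t - h) x) / h = avg h y t - \<sigma> x * avg h (\<lambda>t. Z t x) t"
proof -
  have "((\<lambda>s. y s - \<sigma> x * Z s x) has_integral (Z t x - Z (t - h) x)) {t - h..t}"
    using h by (intro fundamental_theorem_real Z_derivative) auto
  then have "Z t x - Z (t - h) x = integral {t - h..t} (\<lambda>s. y s - \<sigma> x * Z s x)"
    by (simp add: integral_unique)
  also have "\<dots> = integral {t - h..t} y - integral {t - h..t} (\<lambda>s. \<sigma> x * Z s x)"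
    using h by (intro Henstock_Kurzweil_Integration.integral_diff integrable_continuous_real
        continuous_intros continuous_on_subset[OF y_cont] continuous_on_subset[OF Z_cont]) auto
  finally show ?thesis by (simp add: avg_def diff_divide_distrib)
qed

text \<open>Time averages make the equation differentiable in time.  In the variable \<open>x\<close> the derivative
  of the averaged \<open>\<sigma> Z\<^sup>2 / 2\<close> is \<open>(v - W) W \<le> v W\<close> with \<open>W = Z'\<close>, and the
  integral of \<open>\<nu> W\<close> over \<open>x\<close> is \<open>- v'\<close>.\<close>

lemma averaged_energy_decreasing:
  assumes eq: "\<And>t. t \<in> {0<..<T} \<Longrightarrow> y t = c - \<nu> * (LINT x|\<mu>. Z t x)"
    and h: "0 < h" "h < t1" and t: "t1 \<le> t2" "t2 < T"
  shows "\<nu> * (avg h y t2)\<^sup>2 + \<nu>\<^sup>2 * (LINT x|\<mu>. \<sigma> x * (avg h (\<lambda>t. Z t x) t2)\<^sup>2)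
      \<le> \<nu> * (avg h y t1)\<^sup>2 + \<nu>\<^sup>2 * (LINT x|\<mu>. \<sigma> x * (avg h (\<lambda>t. Z t x) t1)\<^sup>2)"
proof -
  define v where "v = avg h y"
  define v' where "v' t = (y t - y (t - h)) / h" for t
  define Zh where "Zh t x = avg h (\<lambda>t. Z t x) t" for t x
  define W where "W t x = (Z t x - Z (t - h) x) / h" for t x
  have ht: "h < t" "t < T" "0 < t" "0 < t - h" if "t \<in> {t1..t2}" for t using that assms by auto
  have v_D: "(v has_real_derivative v' t) (at t)" if "t \<in> {t1..t2}" for t
    unfolding v_def v'_def using ht[OF that] h by (intro avg_derivative y_cont) auto
  have Zh_D: "((\<lambda>t. Zh t x) has_real_derivative W t x) (at t)" if "t \<in> {t1..t2}" for t x
    unfolding Zh_def W_def using ht[OF that] h by (intro avg_derivative Z_cont) auto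
  have W_eq: "W t x = v t - \<sigma> x * Zh t x" if "t \<in> {t1..t2}" for t x
    unfolding W_def v_def Zh_def using ht[OF that] h by (intro increment_Z) auto
  have v_cont: "continuous_on {t1..t2} v"
    by (intro continuous_at_imp_continuous_on ballI) (use v_D DERIV_isCont in blast)
  have v'_cont: "continuous_on {t1..t2} v'"
    unfolding v'_def[abs_def] using ht h t
    by (intro continuous_intros continuous_on_subset[OF y_cont]
        continuous_on_compose2[OF y_cont, of _ "\<lambda>t. t - h"]) auto
  have W_cont: "continuous_on {t1..t2} (\<lambda>t. W t x)" for x
    unfolding W_def using ht h t
    by (intro continuous_intros continuous_on_subset[OF Z_cont]
        continuous_on_compose2[OF Z_cont, of _ "\<lambda>t. t - h"]) auto
  have v_le: "\<bar>v t\<bar> \<le> M" if "t \<in> {t1..t2}" for t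
    unfolding v_def using ht[OF that] h y_bound by (intro avg_bound y_cont) auto
  have W_le: "\<bar>W t x\<bar> \<le> 2 * M / h * B x" if "t \<in> {t1..t2}" for t x
  proof -
    have "\<bar>Z t x - Z (t - h) x\<bar> \<le> M * B x + M * B x"
      using Z_bound[of t x] Z_bound[of "t - h" x] ht[OF that] h by linarith
    then show ?thesis using h by (simp add: W_def field_simps)
  qed
  have W_int: "\<nu> * (LINT x|\<mu>. W t x) = - v' t" if "t \<in> {t1..t2}" for t
  proof -
    have "\<nu> * (LINT x|\<mu>. W t x) = (\<nu> * (LINT x|\<mu>. Z t x) - \<nu> * (LINT x|\<mu>. Z (t - h) x)) / h"
      unfolding W_def using Z_integrable ht[OF that] h by (simp add: right_diff_distrib)
    also have "\<dots> = - v' t"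
      using eq[of t] eq[of "t - h"] ht[OF that] h by (simp add: v'_def diff_divide_distrib)
    finally show ?thesis .
  qed
  define K where "K t x = (indicator {t1..t2} t *\<^sub>R v t) * W t x" for t x
  interpret P: pair_sigma_finite lborel \<mu> ..
  have f_meas [measurable]: "(\<lambda>t. indicator {t1..t2} t *\<^sub>R v t) \<in> borel_measurable borel"
    using v_cont by (intro borel_measurable_continuous_on_indicator) auto
  have W_meas [measurable]: "(\<lambda>(t, x). W t x) \<in> borel_measurable (lborel \<Otimes>\<^sub>M \<mu>)"
    unfolding W_def by measurable
  have K_meas: "(\<lambda>(t, x). K t x) \<in> borel_measurable (lborel \<Otimes>\<^sub>M \<mu>)"
    unfolding K_def by measurable
  \<comment> \<open>The majorant contains \<open>1 / h\<close> and degenerates as \<open>h\<close>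
    tends to 0. For fixed \<open>h\<close> it justifies Fubini, and the resulting inequality no
    longer contains it.\<close>
  define L where "L = M * (2 * M / h)"
  have K_le: "\<bar>K t x\<bar> \<le> indicator {t1..t2} t * (L * B x)" for t x
  proof (cases "t \<in> {t1..t2}")
    case True
    have "\<bar>v t\<bar> * \<bar>W t x\<bar> \<le> M * (2 * M / h * B x)"
      using v_le[OF True] W_le[OF True, of x] M_nonneg by (intro mult_mono) auto
    then show ?thesis using True by (simp add: K_def L_def abs_mult mult.assoc)
  qed (simp add: K_def)
  have L0: "L \<ge> 0" using M_nonneg h by (simp add: L_def)
  have D_int: "integrable (lborel \<Otimes>\<^sub>M \<mu>) (\<lambda>(t, x). indicator {t1..t2} t * (L * B x) :: real)"
  proof (rule P.Fubini_integrable)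
    have "(\<lambda>t. LINT x|\<mu>. norm (case (t, x) of (t, x) \<Rightarrow> indicator {t1..t2} t * (L * B x)))
        = (\<lambda>t. indicator {t1..t2} t * (L * (LINT x|\<mu>. B x)))"
      using L0 B_nonneg by (simp add: fun_eq_iff abs_mult)
    moreover have "integrable lborel (\<lambda>t. indicator {t1..t2} t * (L * (LINT x|\<mu>. B x)))"
      by (intro integrable_mult_left integrable_real_indicator) (auto simp: emeasure_lborel_Icc_eq)
    ultimately show "integrable lborel
       (\<lambda>t. LINT x|\<mu>. norm (case (t, x) of (t, x) \<Rightarrow> indicator {t1..t2} t * (L * B x)))" by simp
    show "AE t in lborel. integrable \<mu> (\<lambda>x. case (t, x) of (t, x) \<Rightarrow> indicator {t1..t2} t * (L * B x))"
      using B_integrable by simp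
  qed measurable
  have K_int: "integrable (lborel \<Otimes>\<^sub>M \<mu>) (\<lambda>(t, x). K t x)"
    by (rule Bochner_Integration.integrable_bound[OF D_int K_meas])
       (use K_le L0 B_nonneg in \<open>auto simp: abs_mult\<close>)
  have pointwise: "\<sigma> x * (Zh t2 x)\<^sup>2 / 2 - \<sigma> x * (Zh t1 x)\<^sup>2 / 2 \<le> (LINT t|lborel. K t x)" for x
  proof -
    have "((\<lambda>t. (v t - W t x) * W t x) has_integral
        (\<sigma> x * (Zh t2 x)\<^sup>2 / 2 - \<sigma> x * (Zh t1 x)\<^sup>2 / 2)) {t1..t2}"
    proof (rule fundamental_theorem_real[OF t(1)])
      fix t assume t: "t \<in> {t1..t2}"
      have "((\<lambda>t. \<sigma> x * (Zh t x)\<^sup>2 / 2) has_real_derivative \<sigma> x * Zh t x * W t x) (at t)"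
        using Zh_D[OF t, of x] by (auto intro!: derivative_eq_intros)
      then show "((\<lambda>t. \<sigma> x * (Zh t x)\<^sup>2 / 2) has_real_derivative (v t - W t x) * W t x) (at t)"
        using W_eq[OF t, of x] by simp
    qed
    moreover have "set_integrable lborel {t1..t2} (\<lambda>t. v t * W t x)"
      unfolding set_integrable_def
      by (intro borel_integrable_compact continuous_intros v_cont W_cont) auto
    from set_borel_integral_eq_integral[OF this]
    have "(\<lambda>t. v t * W t x) integrable_on {t1..t2}"
      and "integral {t1..t2} (\<lambda>t. v t * W t x) = (LINT t|lborel. K t x)"
      by (simp_all add: set_lebesgue_integral_def K_def mult.assoc)
    then have "((\<lambda>t. v t * W t x) has_integral (LINT t|lborel. K t x)) {t1..t2}"
      by (simp add: has_integral_integral)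
    ultimately show ?thesis
      by (rule has_integral_le) (simp add: left_diff_distrib)
  qed
  have Zh_sq_int: "integrable \<mu> (\<lambda>x. \<sigma> x * (Zh t x)\<^sup>2)" if "t \<in> {t1..t2}" for t
  proof (rule \<sigma>_sq_integrable)
    \<comment> \<open>Measurability in \<open>x\<close> is obtained by solving \<open>W_eq\<close>
      for the averaged mode.\<close>
    have "Zh t = (\<lambda>x. (v t - W t x) / \<sigma> x)"
      using W_eq[OF that] \<sigma>_pos by (simp add: fun_eq_iff less_imp_neq[THEN not_sym])
    also have "\<dots> \<in> borel_measurable \<mu>" unfolding W_def by measurable
    finally show "Zh t \<in> borel_measurable \<mu>" .
    show "\<bar>Zh t x\<bar> \<le> M * B x" for x
      unfolding Zh_def using ht[OF that] h Z_bound by (intro avg_bound Z_cont) auto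
  qed
  have "(LINT x|\<mu>. \<sigma> x * (Zh t2 x)\<^sup>2 / 2) - (LINT x|\<mu>. \<sigma> x * (Zh t1 x)\<^sup>2 / 2)
      = (LINT x|\<mu>. \<sigma> x * (Zh t2 x)\<^sup>2 / 2 - \<sigma> x * (Zh t1 x)\<^sup>2 / 2)"
    using t Zh_sq_int by simp
  also have "\<dots> \<le> (LINT x|\<mu>. LINT t|lborel. K t x)"
    using t Zh_sq_int P.integrable_snd[OF K_int] pointwise
    by (intro integral_mono) (auto simp: split_def)
  also have "\<dots> = (LINT t|lborel. LINT x|\<mu>. K t x)"
    by (rule P.Fubini_integral) (use K_int in \<open>simp add: split_def\<close>)
  finally have "\<nu>\<^sup>2 * ((LINT x|\<mu>. \<sigma> x * (Zh t2 x)\<^sup>2 / 2) - (LINT x|\<mu>. \<sigma> x * (Zh t1 x)\<^sup>2 / 2))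
      \<le> \<nu>\<^sup>2 * (LINT t|lborel. LINT x|\<mu>. K t x)"
    by (rule mult_left_mono) simp
  \<comment> \<open>One factor \<nu> turns the integral of \<open>W\<close> over the modes into
    \<open>- v'\<close>, the other stays; so the argument holds for either sign of \<nu>.\<close>
  also have "\<dots> = \<nu> * (LINT t|lborel. \<nu> * (LINT x|\<mu>. K t x))"
    by (simp add: power2_eq_square mult.assoc)
  also have "(\<lambda>t. \<nu> * (LINT x|\<mu>. K t x)) = (\<lambda>t. indicator {t1..t2} t *\<^sub>R (- (v t * v' t)))"
  proof
    fix t
    have "\<nu> * (LINT x|\<mu>. K t x) = indicator {t1..t2} t * (v t * (\<nu> * (LINT x|\<mu>. W t x)))"
      by (simp add: K_def)
    also have "\<dots> = indicator {t1..t2} t *\<^sub>R (- (v t * v' t))"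
    proof (cases "t \<in> {t1..t2}")
      case True
      then show ?thesis unfolding W_int[OF True] by simp
    qed simp
    finally show "\<nu> * (LINT x|\<mu>. K t x) = indicator {t1..t2} t *\<^sub>R (- (v t * v' t))" .
  qed
  also have "(LINT t|lborel. indicator {t1..t2} t *\<^sub>R (- (v t * v' t))) = integral {t1..t2} (\<lambda>t. - (v t * v' t))"
    unfolding set_lebesgue_integral_def[symmetric]
    by (intro set_borel_integral_eq_integral(2), unfold set_integrable_def)
       (intro borel_integrable_compact continuous_intros v_cont v'_cont compact_Icc)
  also have "\<dots> = - (v t2)\<^sup>2 / 2 - - (v t1)\<^sup>2 / 2"
    using v_D by (intro integral_unique fundamental_theorem_real[OF t(1)]) (auto intro!: derivative_eq_intros)
  finally show ?thesis
    unfolding v_def[symmetric] Zh_def[symmetric] by (simp add: algebra_simps)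
qed

theorem memory_energy_decreasing:
  assumes eq: "\<And>t. t \<in> {0<..<T} \<Longrightarrow> y t = c - \<nu> * (LINT x|\<mu>. Z t x)"
    and t: "0 < t1" "t1 \<le> t2" "t2 < T"
  shows "\<nu> * (y t2)\<^sup>2 + \<nu>\<^sup>2 * (LINT x|\<mu>. \<sigma> x * (Z t2 x)\<^sup>2)
      \<le> \<nu> * (y t1)\<^sup>2 + \<nu>\<^sup>2 * (LINT x|\<mu>. \<sigma> x * (Z t1 x)\<^sup>2)"
proof -
  \<comment> \<open>The last factor \<open>1 / 2\<close> makes \<open>h n < t1 / 2\<close> strict
    already at \<open>n = 0\<close>; the windows then fit before both \<open>t1\<close> and
    \<open>t2\<close>.\<close>
  define h where "h n = t1 / 2 * inverse (real (Suc n)) * (1 / 2)" for n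
  have "(\<lambda>n. t1 / 2 * inverse (real (Suc n)) * (1 / 2)) \<longlonglongrightarrow> t1 / 2 * 0 * (1 / 2)"
    by (intro tendsto_intros LIMSEQ_inverse_real_of_nat)
  then have h0: "h \<longlonglongrightarrow> 0" by (simp add: h_def[abs_def])
  have h: "0 < h n" "h n < t1 / 2" for n
  proof -
    have "inverse (real (Suc n)) \<le> 1" by (simp add: field_simps)
    then have "t1 / 2 * inverse (real (Suc n)) \<le> t1 / 2 * 1" using t by (intro mult_left_mono) auto
    then show "h n < t1 / 2" using t(1) unfolding h_def by linarith
  qed (use t in \<open>simp add: h_def\<close>)
  define Ea where "Ea n t = \<nu> * (avg (h n) y t)\<^sup>2
      + \<nu>\<^sup>2 * (LINT x|\<mu>. \<sigma> x * (avg (h n) (\<lambda>t. Z t x) t)\<^sup>2)" for n t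
  have lim: "(\<lambda>n. Ea n t) \<longlonglongrightarrow> \<nu> * (y t)\<^sup>2 + \<nu>\<^sup>2 * (LINT x|\<mu>. \<sigma> x * (Z t x)\<^sup>2)"
    if t': "t \<in> {t1..t2}" for t
  proof -
    have ht: "0 < t" "t < T" "h n < t / 2" "h n < t" for n using t t' h[of n] by auto
    have "(\<lambda>n. LINT x|\<mu>. \<sigma> x * (avg (h n) (\<lambda>t. Z t x) t)\<^sup>2) \<longlonglongrightarrow> (LINT x|\<mu>. \<sigma> x * (Z t x)\<^sup>2)"
    proof (rule integral_dominated_convergence)
      show "integrable \<mu> (\<lambda>x. M\<^sup>2 * B x)" using B_integrable by simp
      show "AE x in \<mu>. (\<lambda>n. \<sigma> x * (avg (h n) (\<lambda>t. Z t x) t)\<^sup>2) \<longlonglongrightarrow> \<sigma> x * (Z t x)\<^sup>2"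
        using ht by (intro AE_I2 tendsto_intros avg_tendsto Z_cont h0 h) auto
      show "AE x in \<mu>. norm (\<sigma> x * (avg (h n) (\<lambda>t. Z t x) t)\<^sup>2) \<le> M\<^sup>2 * B x" for n
      proof (rule AE_I2)
        fix x
        have "\<bar>avg (h n) (\<lambda>t. Z t x) t\<bar> \<le> M * B x"
          using ht Z_bound by (intro avg_bound Z_cont h) auto
        from \<sigma>_sq_bound[OF this]
        show "norm (\<sigma> x * (avg (h n) (\<lambda>t. Z t x) t)\<^sup>2) \<le> M\<^sup>2 * B x" by simp
      qed
      have "(\<lambda>x. avg (h n) (\<lambda>t. Z t x) t) = (\<lambda>x. (avg (h n) y t - (Z t x - Z (t - h n) x) / h n) / \<sigma> x)" for n
        using increment_Z[of "h n" t] h[of n] ht \<sigma>_pos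
        by (simp add: fun_eq_iff less_imp_neq[THEN not_sym])
      then have "(\<lambda>x. avg (h n) (\<lambda>t. Z t x) t) \<in> borel_measurable \<mu>" for n by simp
      then show "(\<lambda>x. \<sigma> x * (avg (h n) (\<lambda>t. Z t x) t)\<^sup>2) \<in> borel_measurable \<mu>" for n by measurable
    qed measurable
    then show ?thesis
      unfolding Ea_def using ht by (intro tendsto_intros avg_tendsto y_cont h0 h) auto
  qed
  have "Ea n t2 \<le> Ea n t1" for n
    unfolding Ea_def using h[of n] t by (intro averaged_energy_decreasing[where c = c] eq) auto
  then show ?thesis
    using lim[of t1] lim[of t2] t by (intro LIMSEQ_le) auto
qed

end

section \<open>The kernel as a superposition of exponentials\<close>

lemma g_ker_nonneg: "\<alpha> > 0 \<Longrightarrow> g_ker \<alpha> t \<ge> 0"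
  by (simp add: g_ker_def Gamma_real_nonneg)

lemma g_ker_measurable [measurable]: "g_ker \<alpha> \<in> borel_measurable borel"
  unfolding g_ker_def[abs_def] by measurable

lemma w_weight_measurable [measurable]: "w_weight \<alpha> \<in> borel_measurable borel"
  unfolding w_weight_def[abs_def] by measurable

lemma w_weight_nonneg: "0 < \<alpha> \<Longrightarrow> \<alpha> < 1 \<Longrightarrow> w_weight \<alpha> \<theta> \<ge> 0"
  by (simp add: w_weight_def g_ker_nonneg)

lemma c0_measurable [measurable]: "c0 \<in> borel_measurable borel"
  unfolding c0_def[abs_def] by measurable

text \<open>The substitution \<open>x = t \<theta> / (1 - \<theta>)\<close> turns the Gamma integral into a superposition of
  exponentials.\<close>

lemma g_ker_has_integral:
  assumes \<alpha>: "0 < \<alpha>" "\<alpha> < 1" and t: "t > 0"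
  shows "((\<lambda>\<theta>. w_weight \<alpha> \<theta> * c0 \<theta> * exp (- c1 \<theta> * t)) has_integral g_ker \<alpha> t) {0<..<1}"
proof -
  define f where "f x = x powr (- \<alpha>) / exp x" for x :: real
  define g where "g \<theta> = t * \<theta> / (1 - \<theta>)" for \<theta>
  define g' where "g' \<theta> = t / (1 - \<theta>)\<^sup>2" for \<theta>
  have "(f has_integral Gamma (1 - \<alpha>)) {0..}"
    using Gamma_integral_real[of "1 - \<alpha>"] \<alpha> by (simp add: f_def[abs_def])
  moreover have "(f has_integral Gamma (1 - \<alpha>)) {0..} \<longleftrightarrow> (f has_integral Gamma (1 - \<alpha>)) {0<..}"
    by (rule has_integral_spike_set_eq) (auto intro: negligible_subset[of "{0}"] empty_imp_negligible)
  ultimately have f_int: "(f has_integral Gamma (1 - \<alpha>)) {0<..}" by blast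
  have f_abs: "f absolutely_integrable_on {0<..}"
    using f_int by (intro nonnegative_absolutely_integrable_1) (auto simp: f_def)
  have image: "g ` {0<..<1} = {0<..}"
  proof
    show "g ` {0<..<1} \<subseteq> {0<..}" using t by (auto simp: g_def)
    show "{0<..} \<subseteq> g ` {0<..<1}"
    proof
      fix x :: real assume x: "x \<in> {0<..}"
      have "x / (t + x) \<in> {0<..<1}" using x t by auto
      moreover have "g (x / (t + x)) = x"
      proof -
        have "1 - x / (t + x) = t / (t + x)" using x t by (simp add: field_simps)
        then show ?thesis using x t by (simp add: g_def)
      qed
      ultimately show "x \<in> g ` {0<..<1}" by (metis imageI)
    qed
  qed
  have inj: "inj_on g {0<..<1}"
    by (rule inj_onI) (use t in \<open>auto simp: g_def field_simps\<close>)
  have der: "(g has_real_derivative g' \<theta>) (at \<theta> within {0<..<1})" if "\<theta> \<in> {0<..<1}" for \<theta>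
    unfolding g_def g'_def using that
    by (auto intro!: derivative_eq_intros simp: field_simps power2_eq_square)
  have "(\<lambda>\<theta>. \<bar>g' \<theta>\<bar> * f (g \<theta>)) absolutely_integrable_on {0<..<1} \<and>
      integral {0<..<1} (\<lambda>\<theta>. \<bar>g' \<theta>\<bar> * f (g \<theta>)) = Gamma (1 - \<alpha>)"
    using has_absolute_integral_change_of_variables_1'[OF _ der inj, where f = f and b = "Gamma (1 - \<alpha>)"]
      f_abs f_int by (simp add: image integral_unique)
  then have "((\<lambda>\<theta>. \<bar>g' \<theta>\<bar> * f (g \<theta>)) has_integral Gamma (1 - \<alpha>)) {0<..<1}"
    by (auto simp: has_integral_iff absolutely_integrable_on_def)
  then have "((\<lambda>\<theta>. t powr (\<alpha> - 1) / (Gamma \<alpha> * Gamma (1 - \<alpha>)) * (\<bar>g' \<theta>\<bar> * f (g \<theta>))) has_integral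
      t powr (\<alpha> - 1) / (Gamma \<alpha> * Gamma (1 - \<alpha>)) * Gamma (1 - \<alpha>)) {0<..<1}"
    by (rule has_integral_mult_right)
  moreover have "t powr (\<alpha> - 1) / (Gamma \<alpha> * Gamma (1 - \<alpha>)) * Gamma (1 - \<alpha>) = g_ker \<alpha> t"
    using less_imp_neq[OF Gamma_real_pos[of "1 - \<alpha>"]] \<alpha> by (simp add: g_ker_def)
  moreover have "t powr (\<alpha> - 1) / (Gamma \<alpha> * Gamma (1 - \<alpha>)) * (\<bar>g' \<theta>\<bar> * f (g \<theta>))
      = w_weight \<alpha> \<theta> * c0 \<theta> * exp (- c1 \<theta> * t)" if \<theta>: "\<theta> \<in> {0<..<1}" for \<theta>
  proof -
    define r where "r = 1 - \<theta>"
    have r: "r > 0" "\<theta> > 0" using \<theta> by (auto simp: r_def)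
    have 1: "f (g \<theta>) = t powr (- \<alpha>) * \<theta> powr (- \<alpha>) * r powr \<alpha> * exp (- c1 \<theta> * t)"
      using t r by (simp add: f_def g_def c1_def r_def[symmetric] powr_divide powr_mult exp_minus
          powr_minus field_simps)
    have 2: "\<bar>g' \<theta>\<bar> = t / r\<^sup>2" using t by (simp add: g'_def r_def)
    have "t powr (\<alpha> - 1) * (t / r\<^sup>2 * (t powr (- \<alpha>) * \<theta> powr (- \<alpha>) * r powr \<alpha>))
        = (t powr (\<alpha> - 1) * t powr 1 * t powr (- \<alpha>)) * \<theta> powr (- \<alpha>) * (r powr \<alpha> / r\<^sup>2)"
      using t by simp
    also have "t powr (\<alpha> - 1) * t powr 1 * t powr (- \<alpha>) = 1"
      using t by (simp add: powr_diff powr_minus)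
    also have "r powr \<alpha> / r\<^sup>2 = r powr (\<alpha> - 1) * (1 / r)"
      using r by (simp add: powr_diff power2_eq_square)
    finally have 3: "t powr (\<alpha> - 1) * (t / r\<^sup>2 * (t powr (- \<alpha>) * \<theta> powr (- \<alpha>) * r powr \<alpha>))
        = \<theta> powr (- \<alpha>) * (r powr (\<alpha> - 1) * (1 / r))" by simp
    have "t powr (\<alpha> - 1) / (Gamma \<alpha> * Gamma (1 - \<alpha>)) * (\<bar>g' \<theta>\<bar> * f (g \<theta>))
      = t powr (\<alpha> - 1) * (t / r\<^sup>2 * (t powr (- \<alpha>) * \<theta> powr (- \<alpha>) * r powr \<alpha>))
          / (Gamma \<alpha> * Gamma (1 - \<alpha>)) * exp (- c1 \<theta> * t)"
      unfolding 1 2 by (simp add: mult_ac)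
    also have "\<dots> = w_weight \<alpha> \<theta> * c0 \<theta> * exp (- c1 \<theta> * t)"
      unfolding 3 by (simp add: mult_ac w_weight_def g_ker_def c0_def r_def[symmetric])
    finally show ?thesis .
  qed
  ultimately show ?thesis by (metis (no_types, lifting) has_integral_eq)
qed

text \<open>The value 1 outside the open unit interval keeps the rate positive everywhere, as
  \<open>memory_kernel\<close> demands; \<open>mode_measure\<close> gives no mass to these
  points.\<close>

definition mode_rate :: "real \<Rightarrow> real" where
  "mode_rate \<theta> = (if 0 < \<theta> \<and> \<theta> < 1 then c1 \<theta> else 1)"

text \<open>Chosen so that \<open>c1 \<theta>\<close> times the density is \<open>\<theta> *
  w_weight \<alpha> \<theta> * (c0 \<theta>)\<^sup>2\<close>: the weight of the history energy times
  the squared prefactor of \<open>G_aug\<close>.\<close>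

definition mode_measure :: "real \<Rightarrow> real measure" where
  "mode_measure \<alpha> = density lborel (\<lambda>\<theta>. ennreal (indicator {0<..<1} \<theta> * (w_weight \<alpha> \<theta> * c0 \<theta>)))"

lemma mode_rate_pos: "mode_rate \<theta> > 0"
  by (simp add: mode_rate_def c1_def)

lemma mode_rate_measurable [measurable]: "mode_rate \<in> borel_measurable borel"
  unfolding mode_rate_def[abs_def] c1_def by measurable

lemma sets_mode_measure [simp, measurable_cong]: "sets (mode_measure \<alpha>) = sets borel"
  by (simp add: mode_measure_def)

lemma c0_nonneg: "\<theta> < 1 \<Longrightarrow> c0 \<theta> \<ge> 0"
  by (simp add: c0_def)

lemma nn_integral_mode_measure:
  assumes "f \<in> borel_measurable borel"
  shows "(\<integral>\<^sup>+\<theta>. f \<theta> \<partial>mode_measure \<alpha>)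
    = (\<integral>\<^sup>+\<theta>. ennreal (indicator {0<..<1} \<theta> * (w_weight \<alpha> \<theta> * c0 \<theta>)) * f \<theta> \<partial>lborel)"
  using assms by (simp add: mode_measure_def nn_integral_density)

lemma sigma_finite_mode_measure: "sigma_finite_measure (mode_measure \<alpha>)"
  unfolding mode_measure_def by (rule sigma_finite_measure.sigma_finite_iff_density_finite[THEN iffD2, OF sigma_finite_lborel]) auto

lemma nn_integral_exp_mode_measure:
  assumes \<alpha>: "0 < \<alpha>" "\<alpha> < 1" and t: "t > 0"
  shows "(\<integral>\<^sup>+\<theta>. ennreal (exp (- mode_rate \<theta> * t)) \<partial>mode_measure \<alpha>) = ennreal (g_ker \<alpha> t)"
proof -
  have "(\<integral>\<^sup>+\<theta>. ennreal (exp (- mode_rate \<theta> * t)) \<partial>mode_measure \<alpha>)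
      = (\<integral>\<^sup>+\<theta>. ennreal (w_weight \<alpha> \<theta> * c0 \<theta> * exp (- c1 \<theta> * t)) * indicator {0<..<1} \<theta> \<partial>lborel)"
  proof (subst nn_integral_mode_measure, measurable, rule nn_integral_cong)
    fix \<theta> :: real
    show "ennreal (indicator {0<..<1} \<theta> * (w_weight \<alpha> \<theta> * c0 \<theta>)) * ennreal (exp (- mode_rate \<theta> * t))
        = ennreal (w_weight \<alpha> \<theta> * c0 \<theta> * exp (- c1 \<theta> * t)) * indicator {0<..<1} \<theta>"
      using w_weight_nonneg[OF \<alpha>, of \<theta>] c0_nonneg[of \<theta>]
      by (cases "\<theta> \<in> {0<..<1}") (auto simp: ennreal_mult mode_rate_def)
  qed
  also have "\<dots> = ennreal (g_ker \<alpha> t)"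
    using \<alpha> w_weight_nonneg[OF \<alpha>] c0_nonneg
    by (intro nn_integral_has_integral_lebesgue' g_ker_has_integral t) auto
  finally show ?thesis .
qed

lemma integrable_exp_mode_measure:
  assumes \<alpha>: "0 < \<alpha>" "\<alpha> < 1" and t: "t > 0"
  shows "has_bochner_integral (mode_measure \<alpha>) (\<lambda>\<theta>. exp (- mode_rate \<theta> * t)) (g_ker \<alpha> t)"
  using nn_integral_exp_mode_measure[OF assms] \<alpha>
  by (intro has_bochner_integral_nn_integral) (auto simp: g_ker_nonneg)

lemma g_ker_integral:
  assumes "0 < \<alpha>" "0 \<le> t"
  shows "(g_ker \<alpha> has_integral (t powr \<alpha> / (\<alpha> * Gamma \<alpha>))) {0..t}"
  using has_integral_divide[OF has_integral_powr_from_0[of "\<alpha> - 1" t], of "Gamma \<alpha>"] assms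
  by (simp add: g_ker_def[abs_def])

text \<open>The dominator is a time integral of exponentials; exchanging the integrals leaves the
  integral of \<open>g_ker \<alpha>\<close> over \<open>{0..T}\<close>, which is finite.\<close>

lemma dominator_mode_integrable:
  assumes \<alpha>: "0 < \<alpha>" "\<alpha> < 1" and T: "T > 0"
  shows "integrable (mode_measure \<alpha>) (\<lambda>x. (1 - exp (- mode_rate x * T)) / mode_rate x)"
proof (rule integrableI_nonneg)
  interpret M: sigma_finite_measure "mode_measure \<alpha>" by (rule sigma_finite_mode_measure)
  interpret P: pair_sigma_finite lborel "mode_measure \<alpha>" ..
  have "(\<integral>\<^sup>+x. ennreal ((1 - exp (- mode_rate x * T)) / mode_rate x) \<partial>mode_measure \<alpha>)
      = (\<integral>\<^sup>+x. (\<integral>\<^sup>+r. ennreal (exp (- mode_rate x * r)) * indicator {0..T} r \<partial>lborel) \<partial>mode_measure \<alpha>)"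
  proof (rule nn_integral_cong)
    fix x
    have "((\<lambda>r. exp (- mode_rate x * r)) has_integral (1 - exp (- mode_rate x * T)) / mode_rate x) {0..T}"
      using mode_rate_pos[of x] T by (intro exp_decay_has_integral) auto
    from nn_integral_has_integral_lebesgue'[OF _ this]
    show "ennreal ((1 - exp (- mode_rate x * T)) / mode_rate x)
        = (\<integral>\<^sup>+r. ennreal (exp (- mode_rate x * r)) * indicator {0..T} r \<partial>lborel)" by simp
  qed
  also have "\<dots> = (\<integral>\<^sup>+r. (\<integral>\<^sup>+x. ennreal (exp (- mode_rate x * r)) * indicator {0..T} r \<partial>mode_measure \<alpha>) \<partial>lborel)"
    by (rule P.Fubini') measurable
  also have "\<dots> = (\<integral>\<^sup>+r. ennreal (g_ker \<alpha> r) * indicator {0..T} r \<partial>lborel)"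
  proof (rule nn_integral_cong_AE)
    \<comment> \<open>At \<open>r = 0\<close> the two sides differ: the measure has infinite mass,
      whereas \<open>g_ker \<alpha> 0 = 0\<close> because \<open>0 powr x = 0\<close>.\<close>
    have "AE r in lborel. r \<noteq> (0 :: real)" by (rule AE_lborel_singleton)
    then show "AE r in lborel. (\<integral>\<^sup>+x. ennreal (exp (- mode_rate x * r)) * indicator {0..T} r \<partial>mode_measure \<alpha>)
        = ennreal (g_ker \<alpha> r) * indicator {0..T} r"
    proof eventually_elim
      case (elim r)
      show ?case
      proof (cases "r \<in> {0..T}")
        case True
        then show ?thesis using elim nn_integral_exp_mode_measure[OF \<alpha>, of r] by simp
      qed simp
    qed
  qed
  also have "\<dots> = ennreal (T powr \<alpha> / (\<alpha> * Gamma \<alpha>))"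
    using \<alpha> T by (intro nn_integral_has_integral_lebesgue' g_ker_integral g_ker_nonneg) auto
  also have "\<dots> < \<infinity>" by simp
  finally show "(\<integral>\<^sup>+x. ennreal ((1 - exp (- mode_rate x * T)) / mode_rate x) \<partial>mode_measure \<alpha>) < \<infinity>" .
  show "AE x in mode_measure \<alpha>. 0 \<le> (1 - exp (- mode_rate x * T)) / mode_rate x"
    using mode_rate_pos T by (intro AE_I2 divide_nonneg_pos) (auto simp: less_imp_le)
qed measurable

section \<open>Abel inversion and the scalar modes\<close>

text \<open>Taken over the whole line. For functions that vanish on the negative half-line it is the
  causal convolution, while commutativity and associativity are a change of variable and
  Fubini.\<close>

definition cnv :: "(real \<Rightarrow> real) \<Rightarrow> (real \<Rightarrow> real) \<Rightarrow> real \<Rightarrow> real" where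
  "cnv a b t = (LINT s|lborel. a (t - s) * b s)"

lemma cnv_commute: "cnv a b t = cnv b a t"
  unfolding cnv_def
  using lborel_integral_real_affine[of "-1" "\<lambda>s. a (t - s) * b s" t]
  by (simp add: mult.commute)

lemma cnv_measurable [measurable]:
  assumes [measurable]: "a \<in> borel_measurable borel" "b \<in> borel_measurable borel"
  shows "cnv a b \<in> borel_measurable borel"
  unfolding cnv_def[abs_def] by measurable

lemma cnv_bound:
  assumes a: "integrable lborel a" and b: "b \<in> borel_measurable borel" "\<And>s. \<bar>b s\<bar> \<le> M"
  shows "\<bar>cnv a b t\<bar> \<le> (LINT s|lborel. \<bar>a s\<bar>) * M"
    and "integrable lborel (\<lambda>s. a (t - s) * b s)"
proof -
  have a': "integrable lborel (\<lambda>s. a (t - s))"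
    using lborel_integrable_real_affine[OF a, of "-1" t] by simp
  have [measurable]: "a \<in> borel_measurable borel" using borel_measurable_integrable[OF a] by simp
  note b(1) [measurable]
  have bound: "\<bar>a (t - s) * b s\<bar> \<le> \<bar>a (t - s)\<bar> * M" for s
    unfolding abs_mult using b(2) by (intro mult_left_mono) auto
  have "0 \<le> M" using b(2)[of 0] by linarith
  show int: "integrable lborel (\<lambda>s. a (t - s) * b s)"
  proof (rule Bochner_Integration.integrable_bound)
    show "integrable lborel (\<lambda>s. \<bar>a (t - s)\<bar> * M)" using a' by simp
    show "AE s in lborel. norm (a (t - s) * b s) \<le> norm (\<bar>a (t - s)\<bar> * M)"
      using bound \<open>0 \<le> M\<close> by (intro AE_I2) simp
  qed measurable
  have "norm (cnv a b t) \<le> (LINT s|lborel. norm (a (t - s) * b s))"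
    unfolding cnv_def by (rule integral_norm_bound)
  also have "\<dots> \<le> (LINT s|lborel. \<bar>a (t - s)\<bar> * M)"
    using a' int bound by (intro integral_mono) auto
  also have "\<dots> = (LINT s|lborel. \<bar>a s\<bar>) * M"
    using lborel_integral_real_affine[of "-1" "\<lambda>s. \<bar>a s\<bar>" t] by simp
  finally show "\<bar>cnv a b t\<bar> \<le> (LINT s|lborel. \<bar>a s\<bar>) * M" by simp
qed

lemma cnv_assoc:
  assumes a: "integrable lborel a" and b: "integrable lborel b"
    and f: "f \<in> borel_measurable borel" "\<And>s. \<bar>f s\<bar> \<le> M"
  shows "cnv a (cnv b f) t = cnv (cnv a b) f t"
proof -
  have [measurable]: "a \<in> borel_measurable borel" "b \<in> borel_measurable borel"
    using borel_measurable_integrable[OF a] borel_measurable_integrable[OF b] by simp_all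
  note f(1) [measurable]
  have M: "0 \<le> M" using f(2)[of 0] by linarith
  have a': "integrable lborel (\<lambda>s. a (t - s))"
    using lborel_integrable_real_affine[OF a, of "-1" t] by simp
  have b': "integrable lborel (\<lambda>r. b (s - r))" for s
    using lborel_integrable_real_affine[OF b, of "-1" s] by simp
  define G where "G s r = a (t - s) * (b (s - r) * f r)" for s r
  have D: "integrable (lborel \<Otimes>\<^sub>M lborel) (\<lambda>(s, r). \<bar>a (t - s)\<bar> * (\<bar>b (s - r)\<bar> * M))"
  proof (rule lborel_pair.Fubini_integrable)
    have "(LINT r|lborel. norm (case (s, r) of (s, r) \<Rightarrow> \<bar>a (t - s)\<bar> * (\<bar>b (s - r)\<bar> * M)))
        = \<bar>a (t - s)\<bar> * ((LINT r|lborel. \<bar>b r\<bar>) * M)" for s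
      using lborel_integral_real_affine[of "-1" "\<lambda>s. \<bar>b s\<bar>" s] M by (simp add: abs_mult)
    then show "integrable lborel
        (\<lambda>s. LINT r|lborel. norm (case (s, r) of (s, r) \<Rightarrow> \<bar>a (t - s)\<bar> * (\<bar>b (s - r)\<bar> * M)))"
      using a' by simp
    show "AE s in lborel. integrable lborel (\<lambda>r. case (s, r) of (s, r) \<Rightarrow> \<bar>a (t - s)\<bar> * (\<bar>b (s - r)\<bar> * M))"
      using b' by simp
  qed measurable
  have G: "integrable (lborel \<Otimes>\<^sub>M lborel) (\<lambda>(s, r). G s r)"
  proof (rule Bochner_Integration.integrable_bound[OF D])
    have "norm (G s r) \<le> \<bar>a (t - s)\<bar> * (\<bar>b (s - r)\<bar> * M)" for s r
      unfolding G_def real_norm_def abs_mult using f(2) by (intro mult_left_mono) auto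
    moreover have "0 \<le> \<bar>a (t - s)\<bar> * (\<bar>b (s - r)\<bar> * M)" for s r using M by simp
    ultimately show "AE x in lborel \<Otimes>\<^sub>M lborel. norm (case x of (s, r) \<Rightarrow> G s r)
        \<le> norm (case x of (s, r) \<Rightarrow> \<bar>a (t - s)\<bar> * (\<bar>b (s - r)\<bar> * M))"
      by (intro AE_I2) (simp add: split_beta)
  qed (unfold G_def, measurable)
  have "cnv a (cnv b f) t = (LINT s|lborel. LINT r|lborel. G s r)"
    unfolding cnv_def G_def by (intro Bochner_Integration.integral_cong refl) simp
  also have "\<dots> = (LINT r|lborel. LINT s|lborel. G s r)"
    using lborel_pair.Fubini_integral[of G] G by simp
  also have "\<dots> = cnv (cnv a b) f t"
    unfolding cnv_def
  proof (intro Bochner_Integration.integral_cong refl)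
    fix r
    have "(LINT s|lborel. G s r) = (LINT s|lborel. a (t - s) * b (s - r)) * f r"
      by (simp add: G_def mult.assoc[symmetric])
    also have "(LINT s|lborel. a (t - s) * b (s - r)) = (LINT s|lborel. a (t - r - s) * b s)"
      using lborel_integral_real_affine[of 1 "\<lambda>s. a (t - s) * b (s - r)" r] by (simp add: diff_diff_eq)
    finally show "(LINT s|lborel. G s r) = (LINT s|lborel. a (t - r - s) * b s) * f r" .
  qed
  finally show ?thesis .
qed

text \<open>The cut at \<open>T\<close> makes the kernel integrable on the line and is not felt by
  causal convolutions at times up to \<open>T\<close>.\<close>

definition g_trunc :: "real \<Rightarrow> real \<Rightarrow> real \<Rightarrow> real" where
  "g_trunc T \<beta> x = indicator {0<..T} x * g_ker \<beta> x"

lemma g_trunc_measurable [measurable]: "g_trunc T \<beta> \<in> borel_measurable borel"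
  unfolding g_trunc_def[abs_def] by measurable

lemma g_trunc_integrable:
  assumes \<beta>: "\<beta> > 0" and T: "T \<ge> 0"
  shows "integrable lborel (g_trunc T \<beta>)"
proof (rule integrableI_nonneg)
  have "(\<integral>\<^sup>+x. ennreal (g_trunc T \<beta> x) \<partial>lborel) \<le> (\<integral>\<^sup>+x. ennreal (g_ker \<beta> x) * indicator {0..T} x \<partial>lborel)"
    by (intro nn_integral_mono) (auto simp: g_trunc_def indicator_def)
  also have "\<dots> = ennreal (T powr \<beta> / (\<beta> * Gamma \<beta>))"
    using \<beta> T by (intro nn_integral_has_integral_lebesgue' g_ker_integral g_ker_nonneg) auto
  also have "\<dots> < \<infinity>" by simp
  finally show "(\<integral>\<^sup>+x. ennreal (g_trunc T \<beta> x) \<partial>lborel) < \<infinity>" .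
  show "AE x in lborel. 0 \<le> g_trunc T \<beta> x"
    using \<beta> by (intro AE_I2) (simp add: g_trunc_def g_ker_nonneg)
qed measurable

lemma cnv_g_trunc_eq_integral:
  assumes \<beta>: "\<beta> > 0"
    and f: "f \<in> borel_measurable borel" "\<And>s. \<bar>f s\<bar> \<le> M" "\<And>s. s \<notin> {0<..<T} \<Longrightarrow> f s = 0"
    and t: "0 \<le> t" "t \<le> T"
  shows "integral {0..t} (\<lambda>s. g_ker \<beta> (t - s) * f s) = cnv (g_trunc T \<beta>) f t"
proof -
  \<comment> \<open>At \<open>s = t\<close> both sides vanish, since
    \<open>0 powr x = 0\<close>.\<close>
  have eq: "indicator {0..t} s *\<^sub>R (g_ker \<beta> (t - s) * f s) = g_trunc T \<beta> (t - s) * f s" for s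
    using f(3)[of s] t
    by (cases "s = t"; cases "s \<in> {0<..<T}") (auto simp: g_trunc_def g_ker_def indicator_def)
  have "set_integrable lborel {0..t} (\<lambda>s. g_ker \<beta> (t - s) * f s)"
    unfolding set_integrable_def eq using t by (intro cnv_bound(2)[OF g_trunc_integrable[OF \<beta>] f(1,2)]) auto
  from set_borel_integral_eq_integral(2)[OF this] show ?thesis
    by (simp add: set_lebesgue_integral_def eq[unfolded real_scaleR_def] cnv_def)
qed

lemma cnv_g_trunc_1_eq_integral:
  assumes f: "f \<in> borel_measurable borel" "\<And>s. \<bar>f s\<bar> \<le> M" "\<And>s. s \<notin> {0<..<T} \<Longrightarrow> f s = 0"
    and t: "0 \<le> t" "t \<le> T"
  shows "integral {0..t} f = cnv (g_trunc T 1) f t"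
proof -
  \<comment> \<open>\<open>g_ker 1\<close> is \<open>1\<close> except at \<open>0\<close>, because \<open>0 powr 0 = 0\<close>.\<close>
  have "integral {0..t} f = integral {0..t} (\<lambda>s. g_ker 1 (t - s) * f s)"
    by (rule integral_spike[of "{t}"]) (auto simp: g_ker_def)
  also have "\<dots> = cnv (g_trunc T 1) f t" by (rule cnv_g_trunc_eq_integral[OF _ assms]) simp
  finally show ?thesis .
qed

lemma cnv_eq_0:
  assumes "\<And>x. x \<le> 0 \<Longrightarrow> a x = 0" "\<And>s. s \<le> 0 \<Longrightarrow> b s = 0" "t \<le> 0"
  shows "cnv a b t = 0"
proof -
  have "(\<lambda>s. a (t - s) * b s) = (\<lambda>s. 0)"
  proof
    fix s show "a (t - s) * b s = 0" using assms(1)[of "t - s"] assms(2)[of s] assms(3) by fastforce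
  qed
  then show ?thesis by (simp add: cnv_def)
qed

text \<open>The substitution \<open>s = x * r\<close> leaves the integral of
  \<open>Beta (1 - \<alpha>) \<alpha>\<close>; the powers of \<open>x\<close> cancel, and the Beta
  value cancels the Gamma factors of the kernels.\<close>

lemma cnv_g_trunc:
  assumes \<alpha>: "0 < \<alpha>" "\<alpha> < 1" and x: "0 < x" "x \<le> T"
  shows "cnv (g_trunc T \<alpha>) (g_trunc T (1 - \<alpha>)) x = 1"
proof -
  define c where "c = 1 / (Gamma \<alpha> * Gamma (1 - \<alpha>))"
  have "cnv (g_trunc T \<alpha>) (g_trunc T (1 - \<alpha>)) x
      = (LINT r|lborel. x * (g_trunc T \<alpha> (x - x * r) * g_trunc T (1 - \<alpha>) (x * r)))"
    unfolding cnv_def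
    using lborel_integral_real_affine[of x "\<lambda>s. g_trunc T \<alpha> (x - s) * g_trunc T (1 - \<alpha>) s" 0] x by simp
  also have "\<dots> = (LINT r|lborel. c * (indicator {0..1} r *\<^sub>R (r powr (1 - \<alpha> - 1) * (1 - r) powr (\<alpha> - 1))))"
  proof (rule integral_cong_AE)
    have "AE r in lborel. r \<noteq> (0 :: real)" "AE r in lborel. r \<noteq> (1 :: real)"
      by (rule AE_lborel_singleton)+
    then show "AE r in lborel. x * (g_trunc T \<alpha> (x - x * r) * g_trunc T (1 - \<alpha>) (x * r))
        = c * (indicator {0..1} r *\<^sub>R (r powr (1 - \<alpha> - 1) * (1 - r) powr (\<alpha> - 1)))"
    proof eventually_elim
      case (elim r)
      show ?case
      proof (cases "0 < r \<and> r < 1")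
        case True
        have xr: "x - x * r = x * (1 - r)" by (simp add: algebra_simps)
        have "x * r \<le> x * 1" "x * (1 - r) \<le> x * 1" using True x by (intro mult_left_mono; simp)+
        then have "x * r \<le> T" "x * (1 - r) \<le> T" using x by linarith+
        then have "x * r \<in> {0<..T}" "x * (1 - r) \<in> {0<..T}" using True x by auto
        then have "g_trunc T \<alpha> (x - x * r) = x powr (\<alpha> - 1) * (1 - r) powr (\<alpha> - 1) / Gamma \<alpha>"
          "g_trunc T (1 - \<alpha>) (x * r) = x powr (1 - \<alpha> - 1) * r powr (1 - \<alpha> - 1) / Gamma (1 - \<alpha>)"
          using True x unfolding xr by (simp_all add: g_trunc_def g_ker_def powr_mult)
        moreover have "x * (x powr (\<alpha> - 1) * x powr (1 - \<alpha> - 1)) = 1"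
          using x by (simp add: powr_diff powr_minus)
        ultimately show ?thesis using True
          by (simp add: c_def field_simps)
      next
        case False
        then have "x * r \<le> 0 \<or> x - x * r \<le> 0" using x elim
          by (auto simp: not_less mult_nonneg_nonpos)
        moreover have "r < 0 \<or> r > 1" using False elim by auto
        ultimately show ?thesis by (auto simp: g_trunc_def)
      qed
    qed
  qed measurable
  also have "\<dots> = c * (LINT r:{0..1}|lborel. r powr (1 - \<alpha> - 1) * (1 - r) powr (\<alpha> - 1))"
    by (simp add: set_lebesgue_integral_def)
  also have "(LINT r:{0..1}|lborel. r powr (1 - \<alpha> - 1) * (1 - r) powr (\<alpha> - 1)) = Beta (1 - \<alpha>) \<alpha>"
    using set_borel_integral_eq_integral(2)[OF integrable_Beta[of "1 - \<alpha>" \<alpha>]]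
      has_integral_Beta_real[of "1 - \<alpha>" \<alpha>] \<alpha> by (simp add: integral_unique)
  also have "Beta (1 - \<alpha>) \<alpha> = Gamma (1 - \<alpha>) * Gamma \<alpha>"
    by (simp add: Beta_def)
  also have "c * \<dots> = 1"
    using less_imp_neq[OF Gamma_real_pos[of \<alpha>]] less_imp_neq[OF Gamma_real_pos[of "1 - \<alpha>"]] \<alpha>
    by (simp add: c_def)
  finally show ?thesis .
qed

text \<open>The integrals over all half-lines \<open>{x<..}\<close> vanish too, so the finite
  measures with densities the positive and the negative part of \<open>h\<close> agree on a
  generator; uniqueness of densities makes the two parts equal, hence zero.\<close>

lemma AE_zero_if_integrals_zero:
  fixes h :: "real \<Rightarrow> real"
  assumes h: "integrable lborel h" "\<And>t. t \<notin> {0<..<T} \<Longrightarrow> h t = 0"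
    and zero: "\<And>t. 0 \<le> t \<Longrightarrow> t \<le> T \<Longrightarrow> (LINT s:{0..t}|lborel. h s) = 0" and T: "T \<ge> 0"
  shows "AE t in lborel. h t = 0"
proof -
  have [measurable]: "h \<in> borel_measurable borel" using borel_measurable_integrable[OF h(1)] by simp
  have total: "(LINT s|lborel. h s) = 0"
  proof -
    have "indicator {0..T} s *\<^sub>R h s = h s" for s
      using h(2)[of s] by (cases "s \<in> {0<..<T}") auto
    then have "(\<lambda>s. indicator {0..T} s *\<^sub>R h s) = h" by (rule ext)
    then show ?thesis using zero[of T] T unfolding set_lebesgue_integral_def by simp
  qed
  have half: "(LINT s|lborel. indicator {x<..} s * h s) = 0" for x
  proof (cases "x \<in> {0..T}")
    case True
    have "indicator {x<..} s * h s = h s - indicator {0..x} s *\<^sub>R h s" for s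
      using h(2)[of s] True by (cases "s \<in> {0<..<T}") (auto simp: indicator_def)
    moreover have "integrable lborel (\<lambda>s. indicator {0..x} s *\<^sub>R h s)"
      using h(1) by (intro integrable_mult_indicator) auto
    ultimately show ?thesis
      using zero[of x] True total h(1) by (simp add: set_lebesgue_integral_def)
  next
    case False
    then have "(\<lambda>s. indicator {x<..} s * h s) = (if x < 0 then h else (\<lambda>_. 0))"
      using h(2) by (auto simp: indicator_def fun_eq_iff)
    then show ?thesis using total by simp
  qed
  have fin: "(\<integral>\<^sup>+s. ennreal (indicator {x<..} s * h s) \<partial>lborel) < \<infinity>"
    "(\<integral>\<^sup>+s. ennreal (- (indicator {x<..} s * h s)) \<partial>lborel) < \<infinity>" for x
  proof -
    have "integrable lborel (\<lambda>s. indicator {x<..} s * h s)"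
      using integrable_mult_indicator[of "{x<..}" lborel h] h(1) by simp
    then show "(\<integral>\<^sup>+s. ennreal (indicator {x<..} s * h s) \<partial>lborel) < \<infinity>"
      "(\<integral>\<^sup>+s. ennreal (- (indicator {x<..} s * h s)) \<partial>lborel) < \<infinity>"
      unfolding real_integrable_def by (auto simp: less_top)
  qed
  have em: "emeasure (density lborel (\<lambda>s. ennreal (h s))) {x<..} = (\<integral>\<^sup>+s. ennreal (indicator {x<..} s * h s) \<partial>lborel)"
    "emeasure (density lborel (\<lambda>s. ennreal (- h s))) {x<..} = (\<integral>\<^sup>+s. ennreal (- (indicator {x<..} s * h s)) \<partial>lborel)" for x
    by (auto simp: emeasure_density indicator_def intro!: nn_integral_cong)
  have "density lborel (\<lambda>s. ennreal (h s)) = density lborel (\<lambda>s. ennreal (- h s))"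
  proof (rule measure_eqI_lessThan)
    show "emeasure (density lborel (\<lambda>s. ennreal (h s))) {x<..} < \<infinity>" for x
      unfolding em by (rule fin)
    show "emeasure (density lborel (\<lambda>s. ennreal (h s))) {x<..}
        = emeasure (density lborel (\<lambda>s. ennreal (- h s))) {x<..}" for x
    proof -
      have "integrable lborel (\<lambda>s. indicator {x<..} s * h s)"
        using integrable_mult_indicator[of "{x<..}" lborel h] h(1) by simp
      from real_lebesgue_integral_def[OF this] half[of x]
      have "enn2real (\<integral>\<^sup>+s. ennreal (indicator {x<..} s * h s) \<partial>lborel)
          = enn2real (\<integral>\<^sup>+s. ennreal (- (indicator {x<..} s * h s)) \<partial>lborel)" by simp
      then show ?thesis unfolding em using fin[of x]
        by (metis ennreal_enn2real infinity_ennreal_def)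
    qed
  qed simp_all
  then have "AE s in lborel. ennreal (h s) = ennreal (- h s)"
    by (subst (asm) sigma_finite_measure.density_unique_iff[OF sigma_finite_lborel]) auto
  then show ?thesis
  proof eventually_elim
    case (elim s)
    then show ?case by (cases "h s \<ge> 0") (auto simp: ennreal_neg ennreal_eq_0_iff)
  qed
qed


text \<open>Convolution of the equation with \<open>g\<^bsub>\<alpha>\<^esub>\<close> inverts the operator \<open>g\<^bsub>1-\<alpha>\<^esub> *\<close>, because
  \<open>g\<^bsub>\<alpha>\<^esub> * g\<^bsub>1-\<alpha>\<^esub> = 1\<close>.\<close>

lemma abel_inversion:
  assumes \<alpha>: "0 < \<alpha>" "\<alpha> < 1" and T: "T > 0"
    and y: "y \<in> borel_measurable borel" "\<And>t. \<bar>y t\<bar> \<le> M" "\<And>t. t \<notin> {0<..<T} \<Longrightarrow> y t = 0"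
    and eq: "\<And>t. t \<in> {0<..<T} \<Longrightarrow>
      integral {0..t} (\<lambda>s. g_ker (1 - \<alpha>) (t - s) * (y s - y0)) = - \<nu> * integral {0..t} y"
  shows "AE t in lborel. t \<in> {0<..<T} \<longrightarrow>
      y t = y0 - \<nu> * integral {0..t} (\<lambda>s. g_ker \<alpha> (t - s) * y s)"
proof -
  note y(1) [measurable]
  define a where "a = g_trunc T \<alpha>"
  define b where "b = g_trunc T (1 - \<alpha>)"
  define one where "one = g_trunc T 1"
  define f where "f s = indicator {0<..<T} s * (y s - y0)" for s
  have [measurable]: "a \<in> borel_measurable borel" "b \<in> borel_measurable borel"
    "one \<in> borel_measurable borel" "f \<in> borel_measurable borel"
    unfolding a_def b_def one_def f_def[abs_def] by measurable
  have a_int: "integrable lborel a" and b_int: "integrable lborel b" and one_int: "integrable lborel one"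
    using \<alpha> T by (auto simp: a_def b_def one_def intro: g_trunc_integrable)
  have M: "0 \<le> M" using y(2)[of 0] by linarith
  have f_bound: "\<bar>f s\<bar> \<le> M + \<bar>y0\<bar>" for s
    using y(2)[of s] M by (auto simp: f_def indicator_def)
  have f_zero: "f s = 0" if "s \<notin> {0<..<T}" for s using that by (simp add: f_def)
  have neg: "a x = 0" "b x = 0" "one x = 0" if "x \<le> 0" for x
    using that by (auto simp: a_def b_def one_def g_trunc_def)
  have one_cnv: "integral {0..t} h = cnv one h t"
    if "h \<in> borel_measurable borel" "\<And>s. \<bar>h s\<bar> \<le> K" "\<And>s. s \<notin> {0<..<T} \<Longrightarrow> h s = 0" "0 \<le> t" "t \<le> T" for h K t
    unfolding one_def by (rule cnv_g_trunc_1_eq_integral[OF that])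
  \<comment> \<open>The equation is given on the open interval only; in the convolution with
    \<open>a\<close> at a time \<open>t \<le> T\<close> only \<open>s < t\<close> matter.\<close>
  have K_eq: "cnv b f s = - \<nu> * cnv one y s" if "s \<le> T" "s \<noteq> T" for s
  proof (cases "s > 0")
    case True
    have "cnv b f s = integral {0..s} (\<lambda>r. g_ker (1 - \<alpha>) (s - r) * f r)"
      unfolding b_def using \<alpha> that True f_bound f_zero
      by (intro cnv_g_trunc_eq_integral[symmetric]) auto
    also have "\<dots> = integral {0..s} (\<lambda>r. g_ker (1 - \<alpha>) (s - r) * (y r - y0))"
      using True that by (intro integral_spike[of "{0}"]) (auto simp: f_def)
    also have "\<dots> = - \<nu> * integral {0..s} y" using True that by (intro eq) auto
    also have "integral {0..s} y = cnv one y s"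
      using True that y by (intro one_cnv) auto
    finally show ?thesis .
  next
    case False
    have "cnv b f s = 0" "cnv one y s = 0"
      using False neg f_zero y(3) by (auto intro!: cnv_eq_0)
    then show ?thesis by simp
  qed
  have ay_bound: "\<bar>cnv a y s\<bar> \<le> (LINT s|lborel. \<bar>a s\<bar>) * M" for s
    by (rule cnv_bound(1)[OF a_int y(1,2)])
  \<comment> \<open>The defect of the asserted identity. It is shown to have vanishing integrals
    over every \<open>{0..t}\<close>.\<close>
  define h where "h s = f s + \<nu> * (indicator {0<..<T} s * cnv a y s)" for s
  have h_meas [measurable]: "h \<in> borel_measurable borel" unfolding h_def[abs_def] by measurable
  define L where "L = M + \<bar>y0\<bar> + \<bar>\<nu>\<bar> * ((LINT s|lborel. \<bar>a s\<bar>) * M)"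
  have ind_bound: "\<bar>indicator {0<..<T} s * cnv a y s\<bar> \<le> (LINT s|lborel. \<bar>a s\<bar>) * M" for s
    using ay_bound[of s] order_trans[OF abs_ge_zero ay_bound[of s]] by (auto simp: indicator_def)
  have h_bound: "\<bar>h s\<bar> \<le> L" for s
  proof -
    have "\<bar>h s\<bar> \<le> \<bar>f s\<bar> + \<bar>\<nu>\<bar> * \<bar>indicator {0<..<T} s * cnv a y s\<bar>"
      unfolding h_def abs_mult[symmetric] by (rule abs_triangle_ineq)
    also have "\<dots> \<le> L" unfolding L_def
      using f_bound ind_bound by (intro add_mono mult_left_mono) auto
    finally show ?thesis .
  qed
  have h_zero: "h s = 0" if "s \<notin> {0<..<T}" for s using that f_zero by (simp add: h_def)
  \<comment> \<open>Convolving \<open>b * f = - \<nu> (one * y)\<close> with \<open>a\<close> gives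
    \<open>one * f\<close> on the left and \<open>- \<nu> (one * (a * y))\<close> on the right;
    convolution with \<open>one\<close> is integration from 0.\<close>
  have h_int0: "integral {0..t} h = 0" if t: "0 \<le> t" "t \<le> T" for t
  proof -
    have "cnv a (cnv b f) t = cnv (cnv a b) f t"
      by (rule cnv_assoc[OF a_int b_int _ f_bound]) measurable
    also have "\<dots> = cnv one f t"
      unfolding cnv_def[of _ f]
    proof (intro Bochner_Integration.integral_cong refl)
      fix s
      show "cnv a b (t - s) * f s = one (t - s) * f s"
      proof (cases "s \<in> {0<..<T} \<and> s < t")
        case True
        then show ?thesis using t cnv_g_trunc[OF \<alpha>, of "t - s" T] by (auto simp: a_def b_def one_def g_trunc_def g_ker_def)
      next
        case False
        then have "f s = 0 \<or> t - s \<le> 0" using f_zero by auto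
        moreover have "cnv a b (t - s) = 0" if "t - s \<le> 0"
          using that neg by (intro cnv_eq_0) auto
        ultimately show ?thesis using neg(3)[of "t - s"] by auto
      qed
    qed
    also have "\<dots> = integral {0..t} f"
      using t f_bound f_zero by (intro one_cnv[symmetric]) auto
    finally have 1: "cnv a (cnv b f) t = integral {0..t} f" .
    have "cnv a (cnv b f) t = cnv a (\<lambda>s. - \<nu> * cnv one y s) t"
      unfolding cnv_def[of a]
    proof (intro Bochner_Integration.integral_cong refl)
      fix s
      show "a (t - s) * cnv b f s = a (t - s) * (- \<nu> * cnv one y s)"
        using K_eq[of s] neg(1)[of "t - s"] t by (cases "s < t") auto
    qed
    also have "\<dots> = - \<nu> * cnv a (cnv one y) t"
      by (simp add: cnv_def[of a] mult.left_commute)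
    also have "cnv a (cnv one y) t = cnv (cnv a one) y t"
      by (rule cnv_assoc[OF a_int one_int y(1,2)])
    also have "cnv a one = cnv one a" by (rule ext) (rule cnv_commute)
    also have "cnv (cnv one a) y t = cnv one (cnv a y) t"
      by (rule cnv_assoc[OF one_int a_int y(1,2), symmetric])
    also have "\<dots> = cnv one (\<lambda>s. indicator {0<..<T} s * cnv a y s) t"
      unfolding cnv_def[of one]
    proof (intro Bochner_Integration.integral_cong refl)
      fix s
      show "one (t - s) * cnv a y s = one (t - s) * (indicator {0<..<T} s * cnv a y s)"
      proof (cases "0 < s \<and> s < t")
        case False
        then show ?thesis using neg(3)[of "t - s"] cnv_eq_0[of a y s] neg(1) y(3) by fastforce
      qed (use t in auto)
    qed
    also have "\<dots> = integral {0..t} (\<lambda>s. indicator {0<..<T} s * cnv a y s)"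
      using t ind_bound by (intro one_cnv[symmetric]) auto
    finally have 2: "cnv a (cnv b f) t = - \<nu> * integral {0..t} (\<lambda>s. indicator {0<..<T} s * cnv a y s)" .
    have "(\<lambda>s. indicator {0<..<T} s * cnv a y s) integrable_on {0..t}"
      using ind_bound by (intro bounded_borel_integrable_on) measurable
    moreover have "f integrable_on {0..t}"
      using f_bound by (intro bounded_borel_integrable_on) measurable
    moreover from calculation have "(\<lambda>s. \<nu> * (indicator {0<..<T} s * cnv a y s)) integrable_on {0..t}"
      using integrable_cmul[of "\<lambda>s. indicator {0<..<T} s * cnv a y s" "{0..t}" \<nu>] by simp
    ultimately have "integral {0..t} h = integral {0..t} f
        + \<nu> * integral {0..t} (\<lambda>s. indicator {0<..<T} s * cnv a y s)"
      unfolding h_def by (subst Henstock_Kurzweil_Integration.integral_add) auto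
    then show ?thesis using 1 2 by simp
  qed
  have hi: "integrable lborel h"
  proof (rule Bochner_Integration.integrable_bound)
    show "integrable lborel (\<lambda>s. indicator {0..T} s * L :: real)"
      using T by (intro integrable_mult_left integrable_real_indicator) auto
    show "AE s in lborel. norm (h s) \<le> norm (indicator {0..T} s * L)"
    proof (rule AE_I2)
      fix s show "norm (h s) \<le> norm (indicator {0..T} s * L)"
        using h_bound[of s] h_zero[of s] by (cases "s \<in> {0<..<T}") auto
    qed
  qed measurable
  have "AE t in lborel. h t = 0"
  proof (rule AE_zero_if_integrals_zero[OF hi h_zero])
    fix t assume t: "0 \<le> t" "t \<le> T"
    have "set_integrable lborel {0..t} h"
      unfolding set_integrable_def using hi by (intro integrable_mult_indicator) auto
    from set_borel_integral_eq_integral(2)[OF this] h_int0[OF t]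
    show "(LINT s:{0..t}|lborel. h s) = 0" by simp
  qed (use T in auto)
  then show ?thesis
  proof eventually_elim
    case (elim t)
    show ?case
    proof
      assume t: "t \<in> {0<..<T}"
      have "integral {0..t} (\<lambda>s. g_ker \<alpha> (t - s) * y s) = cnv a y t"
        unfolding a_def using \<alpha> t y by (intro cnv_g_trunc_eq_integral) auto
      then show "y t = y0 - \<nu> * integral {0..t} (\<lambda>s. g_ker \<alpha> (t - s) * y s)"
        using elim t by (simp add: h_def f_def)
    qed
  qed
qed


section \<open>The energy of a single mode\<close>

definition mode :: "(real \<Rightarrow> real) \<Rightarrow> real \<Rightarrow> real \<Rightarrow> real" where
  "mode y t \<theta> = integral {0..t} (\<lambda>s. exp (- c1 \<theta> * (t - s)) * y s)"

text \<open>The history part for one coefficient, without the factor \<open>1 / 2\<close>.\<close>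

definition mode_energy :: "real \<Rightarrow> real \<Rightarrow> (real \<Rightarrow> real) \<Rightarrow> real \<Rightarrow> ennreal" where
  "mode_energy \<alpha> \<nu> y t = (\<integral>\<^sup>+\<theta>. ennreal (\<theta> * w_weight \<alpha> \<theta>) * ennreal ((\<nu> * (c0 \<theta> * mode y t \<theta>))\<^sup>2)
     * indicator {0<..<1} \<theta> \<partial>lebesgue)"

lemma memory_kernel_mode_measure:
  assumes "0 < \<alpha>" "\<alpha> < 1" "T > 0"
  shows "memory_kernel (mode_measure \<alpha>) mode_rate T"
proof -
  interpret M: sigma_finite_measure "mode_measure \<alpha>" by (rule sigma_finite_mode_measure)
  show ?thesis
    by unfold_locales (use assms mode_rate_pos dominator_mode_integrable in auto)
qed

text \<open>Fubini and the superposition formula recover \<open>g_ker \<alpha>\<close>, which brings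
  the inverted Abel equation into the form required by
  \<open>memory_energy_decreasing\<close>.\<close>

lemma integral_Z_mode_measure:
  assumes input: "memory_input (mode_measure \<alpha>) mode_rate T y M" and \<alpha>: "0 < \<alpha>" "\<alpha> < 1" and t: "0 \<le> t"
  shows "(LINT x|mode_measure \<alpha>. memory_input.Z mode_rate y t x)
      = integral {0..t} (\<lambda>s. g_ker \<alpha> (t - s) * y s)"
proof -
  interpret I: memory_input "mode_measure \<alpha>" mode_rate T y M by (rule input)
  interpret P: pair_sigma_finite lborel "mode_measure \<alpha>" ..
  define F where "F s x = (if 0 \<le> s \<and> s \<le> t then exp (- mode_rate x * (t - s)) * y s else 0)" for s x
  have F_meas: "(\<lambda>(s, x). F s x) \<in> borel_measurable (lborel \<Otimes>\<^sub>M mode_measure \<alpha>)"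
    unfolding F_def by measurable
  have g_int: "integrable lborel (\<lambda>s. indicator {0..t} s *\<^sub>R (g_ker \<alpha> (t - s) * f s))"
    if f: "f \<in> borel_measurable borel" "\<And>s. \<bar>f s\<bar> \<le> M" for f
  proof -
    have "indicator {0..t} s *\<^sub>R (g_ker \<alpha> (t - s) * f s) = g_trunc t \<alpha> (t - s) * f s" for s
      by (cases "s = t") (auto simp: g_trunc_def g_ker_def indicator_def)
    then show ?thesis
      using cnv_bound(2)[OF g_trunc_integrable[OF \<alpha>(1) t] f, of t] by presburger
  qed
  have inner: "AE s in lborel. (LINT x|mode_measure \<alpha>. F s x) = indicator {0..t} s *\<^sub>R (g_ker \<alpha> (t - s) * y s)
      \<and> (LINT x|mode_measure \<alpha>. norm (F s x)) = indicator {0..t} s *\<^sub>R (g_ker \<alpha> (t - s) * \<bar>y s\<bar>)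
      \<and> integrable (mode_measure \<alpha>) (F s)"
  proof -
    \<comment> \<open>At \<open>s = t\<close> the exponential is the constant 1, and the measure has
      infinite mass.\<close>
    have "AE s in lborel. s \<noteq> t" by (rule AE_lborel_singleton)
    then show ?thesis
    proof eventually_elim
      case (elim s)
      show ?case
      proof (cases "0 \<le> s \<and> s \<le> t")
        case True
        then have "0 < t - s" using elim by simp
        from integrable_exp_mode_measure[OF \<alpha> this]
        have "integrable (mode_measure \<alpha>) (\<lambda>x. exp (- mode_rate x * (t - s)))"
          "(LINT x|mode_measure \<alpha>. exp (- mode_rate x * (t - s))) = g_ker \<alpha> (t - s)"
          by (simp_all add: has_bochner_integral_iff)
        then show ?thesis using True by (simp add: F_def[abs_def] abs_mult)
      qed (auto simp: F_def[abs_def])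
    qed
  qed
  have "integrable (lborel \<Otimes>\<^sub>M mode_measure \<alpha>) (\<lambda>(s, x). F s x)"
  proof (rule P.Fubini_integrable[OF F_meas])
    have "integrable lborel (\<lambda>s. indicator {0..t} s *\<^sub>R (g_ker \<alpha> (t - s) * \<bar>y s\<bar>))"
      using I.y_bound by (intro g_int) auto
    moreover have "AE s in lborel. (LINT x|mode_measure \<alpha>. norm (F s x)) = indicator {0..t} s *\<^sub>R (g_ker \<alpha> (t - s) * \<bar>y s\<bar>)"
      using inner by eventually_elim simp
    moreover have "(\<lambda>s. LINT x|mode_measure \<alpha>. norm (F s x)) \<in> borel_measurable lborel"
      using F_meas by measurable
    ultimately have "integrable lborel (\<lambda>s. LINT x|mode_measure \<alpha>. norm (F s x))"
      by (subst integrable_cong_AE) auto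
    then show "integrable lborel (\<lambda>s. LINT x|mode_measure \<alpha>. norm (case (s, x) of (s, x) \<Rightarrow> F s x))" by simp
    show "AE s in lborel. integrable (mode_measure \<alpha>) (\<lambda>x. case (s, x) of (s, x) \<Rightarrow> F s x)"
      using inner by eventually_elim simp
  qed
  from P.Fubini_integral[OF this]
  have "(LINT x|mode_measure \<alpha>. I.Z t x) = (LINT s|lborel. LINT x|mode_measure \<alpha>. F s x)"
    by (simp add: I.Z_eq_lebesgue F_def)
  also have "\<dots> = (LINT s|lborel. indicator {0..t} s *\<^sub>R (g_ker \<alpha> (t - s) * y s))"
  proof (rule integral_cong_AE)
    show "(\<lambda>s. LINT x|mode_measure \<alpha>. F s x) \<in> borel_measurable lborel"
      using F_meas by measurable
    show "AE s in lborel. (LINT x|mode_measure \<alpha>. F s x) = indicator {0..t} s *\<^sub>R (g_ker \<alpha> (t - s) * y s)"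
      using inner by eventually_elim simp
  qed measurable
  also have "\<dots> = integral {0..t} (\<lambda>s. g_ker \<alpha> (t - s) * y s)"
    using set_borel_integral_eq_integral(2)[of "{0..t}" "\<lambda>s. g_ker \<alpha> (t - s) * y s"]
      g_int[of y] I.y_bound by (simp add: set_integrable_def set_lebesgue_integral_def)
  finally show ?thesis .
qed

text \<open>The inverted equation holds only almost everywhere, but its right side is continuous and
  so defines a representative \<open>yc\<close> with the same modes. The dissipation inequality
  holds for \<open>yc\<close>, hence for \<open>y\<close> off the null set where they
  differ.\<close>

theorem scalar_mode_energy_decreasing:
  assumes \<alpha>: "0 < \<alpha>" "\<alpha> < 1" and T: "T > 0"
    and y: "y \<in> borel_measurable borel" "\<And>t. \<bar>y t\<bar> \<le> M" "\<And>t. t \<notin> {0<..<T} \<Longrightarrow> y t = 0"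
    and eq: "\<And>t. t \<in> {0<..<T} \<Longrightarrow>
      integral {0..t} (\<lambda>s. g_ker (1 - \<alpha>) (t - s) * (y s - y0)) = - \<nu> * integral {0..t} y"
  obtains N where "N \<in> null_sets lborel"
    "\<And>t. t \<in> {0<..<T} \<Longrightarrow> mode_energy \<alpha> \<nu> y t < \<infinity>"
    "\<And>t1 t2. t1 \<in> {0<..<T} - N \<Longrightarrow> t2 \<in> {0<..<T} - N \<Longrightarrow> t1 \<le> t2 \<Longrightarrow>
      \<nu> * (y t2)\<^sup>2 + enn2real (mode_energy \<alpha> \<nu> y t2) \<le> \<nu> * (y t1)\<^sup>2 + enn2real (mode_energy \<alpha> \<nu> y t1)"
proof -
  interpret K: memory_kernel "mode_measure \<alpha>" mode_rate T
    using \<alpha> T by (rule memory_kernel_mode_measure)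
  interpret I: memory_input "mode_measure \<alpha>" mode_rate T y M
    by unfold_locales (use y in auto)
  define yc where "yc t = indicator {0<..<T} t * (y0 - \<nu> * (LINT x|mode_measure \<alpha>. I.Z t x))" for t
  have yc_eq: "yc t = y0 - \<nu> * (LINT x|mode_measure \<alpha>. I.Z t x)" if "t \<in> {0<..<T}" for t
    using that by (simp add: yc_def)
  have "AE t in lborel. t \<in> {0<..<T} \<longrightarrow>
      y t = y0 - \<nu> * integral {0..t} (\<lambda>s. g_ker \<alpha> (t - s) * y s)"
    by (rule abel_inversion) (use \<alpha> T y eq in auto)
  then have "AE t in lborel. t \<in> {0<..<T} \<longrightarrow> y t = yc t"
    by eventually_elim
      (use integral_Z_mode_measure[OF I.memory_input_axioms \<alpha>] in \<open>auto simp: yc_def\<close>)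
  then have "AE t in lborel. y t = yc t"
  proof eventually_elim
    case (elim t)
    then show ?case using y(3)[of t] by (cases "t \<in> {0<..<T}") (auto simp: yc_def)
  qed
  then obtain N where N: "N \<in> null_sets lborel" "{t. y t \<noteq> yc t} \<subseteq> N"
    unfolding eventually_ae_filter by auto
  have y_eq: "y t = yc t" if "t \<notin> N" for t using N(2) that by blast
  have N_neg: "negligible N"
    using N(1) by (simp add: negligible_iff_null_sets null_sets_completionI)
  have yc_meas: "yc \<in> borel_measurable borel"
    unfolding yc_def[abs_def] by measurable
  have yc_cont: "continuous_on {0<..<T} yc"
  proof -
    have "continuous_on {0<..<T} (\<lambda>t. y0 - \<nu> * (LINT x|mode_measure \<alpha>. I.Z t x))"
      by (intro continuous_intros continuous_on_subset[OF I.integral_Z_continuous]) auto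
    then show ?thesis by (rule continuous_on_eq) (simp add: yc_eq)
  qed
  define M' where "M' = \<bar>y0\<bar> + \<bar>\<nu>\<bar> * (LINT x|mode_measure \<alpha>. M * K.B x)"
  have yc_bound: "\<bar>yc t\<bar> \<le> M'" for t
  proof (cases "t \<in> {0<..<T}")
    case True
    have "norm (LINT x|mode_measure \<alpha>. I.Z t x) \<le> (LINT x|mode_measure \<alpha>. norm (I.Z t x))"
      by (rule integral_norm_bound)
    also have "\<dots> \<le> (LINT x|mode_measure \<alpha>. M * K.B x)"
      using True I.Z_bound[of t] I.Z_integrable[of t] K.B_integrable by (intro integral_mono) auto
    finally have "\<bar>\<nu>\<bar> * \<bar>LINT x|mode_measure \<alpha>. I.Z t x\<bar> \<le> \<bar>\<nu>\<bar> * (LINT x|mode_measure \<alpha>. M * K.B x)"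
      by (intro mult_left_mono) auto
    then show ?thesis
      unfolding yc_eq[OF True] M'_def using abs_triangle_ineq4[of y0 "\<nu> * (LINT x|mode_measure \<alpha>. I.Z t x)"]
      by (simp add: abs_mult)
  next
    case False
    have "0 \<le> (LINT x|mode_measure \<alpha>. M * K.B x)"
      using I.M_nonneg K.B_nonneg by (intro Bochner_Integration.integral_nonneg) auto
    then show ?thesis using False by (simp add: yc_def M'_def)
  qed
  interpret S: memory_solution "mode_measure \<alpha>" mode_rate T yc M'
    by unfold_locales (use yc_meas yc_bound yc_cont in auto)
  have Z_eq: "I.Z t x = S.Z t x" for t x
    unfolding I.Z_def S.Z_def by (intro integral_spike[OF N_neg]) (auto simp: y_eq)
  have energy: "mode_energy \<alpha> \<nu> y t = ennreal (\<nu>\<^sup>2 * (LINT x|mode_measure \<alpha>. mode_rate x * (S.Z t x)\<^sup>2))"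
    if t: "t \<in> {0<..<T}" for t
  proof -
    have "integrable (mode_measure \<alpha>) (\<lambda>x. mode_rate x * (S.Z t x)\<^sup>2)"
      using t S.Z_bound[of t] by (intro S.\<sigma>_sq_integrable) auto
    then have "ennreal (\<nu>\<^sup>2 * (LINT x|mode_measure \<alpha>. mode_rate x * (S.Z t x)\<^sup>2))
        = (\<integral>\<^sup>+x. ennreal (\<nu>\<^sup>2 * (mode_rate x * (S.Z t x)\<^sup>2)) \<partial>mode_measure \<alpha>)"
      using less_imp_le[OF mode_rate_pos] by (subst nn_integral_eq_integral) auto
    also have "\<dots> = (\<integral>\<^sup>+\<theta>. ennreal (indicator {0<..<1} \<theta> * (w_weight \<alpha> \<theta> * c0 \<theta>))
        * ennreal (\<nu>\<^sup>2 * (mode_rate \<theta> * (S.Z t \<theta>)\<^sup>2)) \<partial>lborel)"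
      using S.Z_measurable[of t] by (subst nn_integral_mode_measure) (auto intro!: measurable_cong)
    also have "\<dots> = mode_energy \<alpha> \<nu> y t"
      unfolding mode_energy_def nn_integral_completion
    proof (rule nn_integral_cong)
      fix \<theta> :: real
      show "ennreal (indicator {0<..<1} \<theta> * (w_weight \<alpha> \<theta> * c0 \<theta>)) * ennreal (\<nu>\<^sup>2 * (mode_rate \<theta> * (S.Z t \<theta>)\<^sup>2))
        = ennreal (\<theta> * w_weight \<alpha> \<theta>) * ennreal ((\<nu> * (c0 \<theta> * mode y t \<theta>))\<^sup>2) * indicator {0<..<1} \<theta>"
      proof (cases "\<theta> \<in> {0<..<1}")
        case True
        have "mode y t \<theta> = S.Z t \<theta>"
          using True unfolding Z_eq[symmetric] mode_def I.Z_def by (simp add: mode_rate_def)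
        moreover have weights: "w_weight \<alpha> \<theta> * c0 \<theta> * (\<nu>\<^sup>2 * (mode_rate \<theta> * (S.Z t \<theta>)\<^sup>2))
            = \<theta> * w_weight \<alpha> \<theta> * (\<nu> * (c0 \<theta> * S.Z t \<theta>))\<^sup>2"
          using True by (simp add: mode_rate_def c0_def c1_def power2_eq_square)
        moreover have "ennreal (w_weight \<alpha> \<theta> * c0 \<theta>) * ennreal (\<nu>\<^sup>2 * (mode_rate \<theta> * (S.Z t \<theta>)\<^sup>2))
            = ennreal (w_weight \<alpha> \<theta> * c0 \<theta> * (\<nu>\<^sup>2 * (mode_rate \<theta> * (S.Z t \<theta>)\<^sup>2)))"
          using True w_weight_nonneg[OF \<alpha>, of \<theta>] c0_nonneg[of \<theta>]
          by (intro ennreal_mult'[symmetric]) auto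
        ultimately show ?thesis
          unfolding weights
          using True w_weight_nonneg[OF \<alpha>, of \<theta>] c0_nonneg[of \<theta>]
          by (simp add: ennreal_mult')
      qed simp
    qed
    finally show ?thesis ..
  qed
  have yc_Z: "yc t = y0 - \<nu> * (LINT x|mode_measure \<alpha>. S.Z t x)" if "t \<in> {0<..<T}" for t
    using yc_eq[OF that] by (simp add: Z_eq)
  show thesis
  proof (rule that[OF N(1)])
    show "mode_energy \<alpha> \<nu> y t < \<infinity>" if "t \<in> {0<..<T}" for t
      using energy[OF that] by simp
    fix t1 t2 assume t: "t1 \<in> {0<..<T} - N" "t2 \<in> {0<..<T} - N" "t1 \<le> t2"
    then have "y t1 = yc t1" "y t2 = yc t2" by (auto simp: y_eq)
    moreover have "\<nu> * (yc t2)\<^sup>2 + \<nu>\<^sup>2 * (LINT x|mode_measure \<alpha>. mode_rate x * (S.Z t2 x)\<^sup>2)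
        \<le> \<nu> * (yc t1)\<^sup>2 + \<nu>\<^sup>2 * (LINT x|mode_measure \<alpha>. mode_rate x * (S.Z t1 x)\<^sup>2)"
      by (rule S.memory_energy_decreasing[where c = y0]) (use t yc_Z in auto)
    moreover have "0 \<le> \<nu>\<^sup>2 * (LINT x|mode_measure \<alpha>. mode_rate x * (S.Z t x)\<^sup>2)" for t
      using less_imp_le[OF mode_rate_pos]
      by (intro mult_nonneg_nonneg Bochner_Integration.integral_nonneg) auto
    ultimately show "\<nu> * (y t2)\<^sup>2 + enn2real (mode_energy \<alpha> \<nu> y t2) \<le> \<nu> * (y t1)\<^sup>2 + enn2real (mode_energy \<alpha> \<nu> y t1)"
      using t by (simp add: energy)
  qed
qed

section \<open>Reduction to scalar equations\<close>

lemma dual_emb_bounded_linear: "bounded_linear (dual_emb \<iota>)"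
  unfolding dual_emb_def
  by (rule bounded_linear_compose[OF bounded_bilinear.bounded_linear_left[OF bounded_bilinear_blinfun_compose]
      bounded_linear_blinfun_inner_right])

text \<open>Clipping at the bound and extending by zero turns properties that hold almost everywhere
  into ones that hold everywhere, as \<open>memory_input\<close> demands.\<close>

lemma borel_representative:
  fixes f :: "real \<Rightarrow> real"
  assumes f: "f \<in> borel_measurable (time_measure T)" and bound: "AE t in time_measure T. \<bar>f t\<bar> \<le> M" and M: "0 \<le> M"
  obtains y N where "y \<in> borel_measurable borel" "\<And>t. \<bar>y t\<bar> \<le> M" "\<And>t. t \<notin> {0<..<T} \<Longrightarrow> y t = 0"
    "negligible N" "\<And>t. t \<in> {0<..<T} \<Longrightarrow> t \<notin> N \<Longrightarrow> y t = f t"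
proof -
  have "(\<lambda>t. indicator {0<..<T} t *\<^sub>R f t) \<in> borel_measurable lebesgue"
    using f by (subst (asm) borel_measurable_restrict_space_iff) auto
  then obtain g where g [measurable]: "g \<in> borel_measurable borel"
    and gf: "AE t in lborel. indicator {0<..<T} t *\<^sub>R f t = g t"
    by (auto dest: completion_ex_borel_measurable_real)
  define y where "y t = indicator {0<..<T} t * max (- M) (min M (g t))" for t
  have "AE t in lebesgue. t \<in> {0<..<T} \<longrightarrow> \<bar>f t\<bar> \<le> M"
    using bound by (subst (asm) AE_restrict_space_iff) auto
  moreover have "AE t in lebesgue. indicator {0<..<T} t *\<^sub>R f t = g t"
    using gf by (rule AE_completion)
  ultimately have "AE t in lebesgue. t \<in> {0<..<T} \<longrightarrow> y t = f t"
  proof eventually_elim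
    case (elim t)
    then show ?case by (auto simp: y_def)
  qed
  then obtain N where N: "N \<in> null_sets lebesgue" "{t. \<not> (t \<in> {0<..<T} \<longrightarrow> y t = f t)} \<subseteq> N"
    unfolding eventually_ae_filter by auto
  show thesis
  proof (rule that[of y N])
    show "y \<in> borel_measurable borel" unfolding y_def[abs_def] by measurable
    show "\<bar>y t\<bar> \<le> M" for t using M by (auto simp: y_def indicator_def)
    show "negligible N" using N(1) by (simp add: negligible_iff_null_sets)
  qed (use N(2) in \<open>auto simp: y_def\<close>)
qed

text \<open>The antiderivative of a merely measurable \<open>y\<close> need not be differentiable
  everywhere; instead Fubini is applied to \<open>\<phi>' s * y r\<close> on the triangle
  \<open>0 \<le> r \<le> s \<le> T\<close>.\<close>

lemma integral_by_parts_test_function: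
  fixes y \<phi> \<phi>' :: "real \<Rightarrow> real"
  assumes y: "y \<in> borel_measurable borel" "\<And>t. \<bar>y t\<bar> \<le> M"
    and \<phi>: "\<And>t. (\<phi> has_real_derivative \<phi>' t) (at t)" "continuous_on UNIV \<phi>'" "\<phi> T = 0" and T: "T \<ge> 0"
  shows "integral {0..T} (\<lambda>t. \<phi> t * y t) = - integral {0..T} (\<lambda>t. \<phi>' t * integral {0..t} y)"
proof -
  note y(1) [measurable]
  have [measurable]: "\<phi>' \<in> borel_measurable borel" using \<phi>(2) by (rule borel_measurable_continuous_onI)
  obtain K where K: "\<And>s. s \<in> {0..T} \<Longrightarrow> \<bar>\<phi>' s\<bar> \<le> K"
    using \<phi>(2) by (rule continuous_bounded_on_Icc) blast
  define G where "G s r = (if 0 \<le> r \<and> r \<le> s \<and> s \<le> T then \<phi>' s * y r else 0)" for s r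
  have G_meas: "(\<lambda>(s, r). G s r) \<in> borel_measurable (lborel \<Otimes>\<^sub>M lborel)"
    unfolding G_def by measurable
  have "emeasure (lborel \<Otimes>\<^sub>M lborel) ({0..T} \<times> {0..T}) = emeasure lborel {0..T} * emeasure lborel {0..T}"
    by (rule lborel.emeasure_pair_measure_Times) auto
  also have "\<dots> < \<infinity>" by (simp add: emeasure_lborel_Icc_eq ennreal_mult_less_top)
  finally have "integrable (lborel \<Otimes>\<^sub>M lborel) (\<lambda>x. indicator ({0..T} \<times> {0..T}) x * (K * M) :: real)"
    by (intro integrable_mult_left integrable_real_indicator) auto
  then have "integrable (lborel \<Otimes>\<^sub>M lborel) (\<lambda>(s, r). G s r)"
  proof (rule Bochner_Integration.integrable_bound[OF _ G_meas AE_I2])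
    fix x :: "real \<times> real"
    obtain s r where x: "x = (s, r)" by (cases x)
    show "norm (case x of (s, r) \<Rightarrow> G s r) \<le> norm (indicator ({0..T} \<times> {0..T}) x * (K * M))"
    proof (cases "0 \<le> r \<and> r \<le> s \<and> s \<le> T")
      case True
      then have "\<bar>\<phi>' s\<bar> * \<bar>y r\<bar> \<le> K * M" using K[of s] y(2)[of r] by (intro mult_mono) auto
      then have "\<bar>\<phi>' s * y r\<bar> \<le> \<bar>K * M\<bar>" unfolding abs_mult[of "\<phi>' s"] by linarith
      then show ?thesis using True by (simp add: x G_def)
    next
      case False
      then have "G s r = 0" by (auto simp: G_def)
      then show ?thesis by (simp add: x)
    qed
  qed
  from lborel_pair.Fubini_integral[OF this]
  have fubini: "(LINT r|lborel. LINT s|lborel. G s r) = (LINT s|lborel. LINT r|lborel. G s r)" .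
  have \<phi>'_int: "set_integrable lborel {a..b} \<phi>'" for a b
    unfolding set_integrable_def
    by (intro borel_integrable_compact compact_Icc continuous_on_subset[OF \<phi>(2)]) auto
  have inner_s: "(LINT s|lborel. G s r) = indicator {0..T} r * (- \<phi> r * y r)" for r
  proof (cases "r \<in> {0..T}")
    case True
    have "(\<phi>' has_integral \<phi> T - \<phi> r) {r..T}"
      using True \<phi>(1) by (intro fundamental_theorem_real) auto
    then have "(LINT s:{r..T}|lborel. \<phi>' s) = - \<phi> r"
      using set_borel_integral_eq_integral(2)[OF \<phi>'_int] \<phi>(3) by (simp add: integral_unique)
    moreover have "(LINT s|lborel. G s r) = (LINT s|lborel. (indicator {r..T} s *\<^sub>R \<phi>' s) * y r)"
      using True by (intro Bochner_Integration.integral_cong) (auto simp: G_def indicator_def)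
    ultimately show ?thesis using True by (simp add: set_lebesgue_integral_def)
  next
    case False
    then have "(\<lambda>s. G s r) = (\<lambda>s. 0)" by (auto simp: G_def fun_eq_iff)
    then show ?thesis using False by simp
  qed
  have inner_r: "(LINT r|lborel. G s r) = indicator {0..T} s * (\<phi>' s * integral {0..s} y)" for s
  proof (cases "s \<in> {0..T}")
    case True
    have "(LINT r|lborel. G s r) = (LINT r|lborel. \<phi>' s * (indicator {0..s} r *\<^sub>R y r))"
      using True by (intro Bochner_Integration.integral_cong) (auto simp: G_def indicator_def)
    also have "\<dots> = \<phi>' s * integral {0..s} y"
      using set_borel_integral_eq_integral(2)[OF set_integrable_bounded_borel[OF y(1), of 0 s M]] y(2)
      by (simp add: set_lebesgue_integral_def)
    finally show ?thesis using True by simp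
  next
    case False
    then have "(\<lambda>r. G s r) = (\<lambda>r. 0)" by (auto simp: G_def fun_eq_iff)
    then show ?thesis using False by simp
  qed
  have \<phi>_cont: "continuous_on UNIV \<phi>" using \<phi>(1) by (meson DERIV_isCont continuous_at_imp_continuous_on)
  then have [measurable]: "\<phi> \<in> borel_measurable borel" by (rule borel_measurable_continuous_onI)
  obtain L where L: "\<And>s. s \<in> {0..T} \<Longrightarrow> \<bar>\<phi> s\<bar> \<le> L"
    using \<phi>_cont by (rule continuous_bounded_on_Icc) blast
  have "set_integrable lborel {0..T} (\<lambda>t. - \<phi> t * y t)"
  proof (rule set_integrable_bounded_borel[where K = "L * M"])
    show "\<bar>- \<phi> t * y t\<bar> \<le> L * M" if "t \<in> {0..T}" for t
      using L[OF that] y(2)[of t] by (auto simp: abs_mult intro!: mult_mono)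
  qed measurable
  from set_borel_integral_eq_integral(2)[OF this]
  have 1: "(LINT r|lborel. LINT s|lborel. G s r) = - integral {0..T} (\<lambda>t. \<phi> t * y t)"
    unfolding inner_s by (simp add: set_lebesgue_integral_def)
  have "continuous_on {0..T} (\<lambda>t. integral {0..t} y)"
    by (intro indefinite_integral_continuous_1 bounded_borel_integrable_on[OF y])
  then have "set_integrable lborel {0..T} (\<lambda>t. \<phi>' t * integral {0..t} y)"
    unfolding set_integrable_def
    by (intro borel_integrable_compact compact_Icc continuous_intros continuous_on_subset[OF \<phi>(2)]) auto
  from set_borel_integral_eq_integral(2)[OF this]
  have 2: "(LINT s|lborel. LINT r|lborel. G s r) = integral {0..T} (\<lambda>t. \<phi>' t * integral {0..t} y)"
    unfolding inner_r by (simp add: set_lebesgue_integral_def)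
  show ?thesis using fubini 1 2 by simp
qed


text \<open>An infinite history sum at the earlier time leaves nothing to show. If it is finite,
  \<open>h2 k \<le> e1 k + h1 k - e2 k\<close> makes the later sum finite too, even when some
  \<open>e1 k\<close> or \<open>e2 k\<close> are negative.\<close>

lemma sum_energy_mono:
  fixes e1 e2 h1 h2 :: "nat \<Rightarrow> real"
  assumes e: "e1 sums s1" "e2 sums s2" and h: "\<And>k. 0 \<le> h1 k" "\<And>k. 0 \<le> h2 k"
    and le: "\<And>k. e2 k + h2 k \<le> e1 k + h1 k"
  shows "ereal s2 + enn2ereal (\<Sum>k. ennreal (h2 k)) \<le> ereal s1 + enn2ereal (\<Sum>k. ennreal (h1 k))"
proof (cases "summable h1")
  case True
  have "summable (\<lambda>k. e1 k + h1 k - e2 k)"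
    using e True by (intro summable_add summable_diff) (auto simp: sums_iff)
  then have h2: "summable h2"
    by (rule summable_comparison_test') (use h le in \<open>auto simp: le_diff_eq add.commute\<close>)
  have "(\<Sum>k. e2 k + h2 k) \<le> (\<Sum>k. e1 k + h1 k)"
    using e True h2 le by (intro suminf_le summable_add) (auto simp: sums_iff)
  then have "s2 + suminf h2 \<le> s1 + suminf h1"
    using e True h2 by (simp add: suminf_add[symmetric] sums_iff)
  then show ?thesis
    using True h2 h by (simp add: suminf_ennreal2 suminf_nonneg)
next
  case False
  then have "(\<Sum>k. ennreal (h1 k)) = top"
    using h by (metis summable_suminf_not_top)
  then show ?thesis by simp
qed

lemma mode_measurable:
  assumes \<alpha>: "0 < \<alpha>" "\<alpha> < 1"
    and y: "y \<in> borel_measurable borel" "\<And>t. \<bar>y t\<bar> \<le> M"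
  shows "(\<lambda>\<theta>. ennreal (\<theta> * w_weight \<alpha> \<theta>) * ennreal ((\<nu> * (c0 \<theta> * mode y t \<theta>))\<^sup>2)
     * indicator {0<..<1} \<theta>) \<in> borel_measurable lebesgue"
proof -
  \<comment> \<open>Any horizon would do: \<open>Z\<close> and its measurability in \<open>x\<close>
    do not depend on it.\<close>
  interpret K: memory_kernel "mode_measure \<alpha>" mode_rate 1
    using \<alpha> by (rule memory_kernel_mode_measure) simp
  interpret I: memory_input "mode_measure \<alpha>" mode_rate 1 y M
    by unfold_locales (use y in auto)
  have [measurable]: "I.Z t \<in> borel_measurable borel"
    using I.Z_measurable[of t] by (simp cong: measurable_cong_sets)
  have "(\<lambda>\<theta>. ennreal (\<theta> * w_weight \<alpha> \<theta>) * ennreal ((\<nu> * (c0 \<theta> * mode y t \<theta>))\<^sup>2) * indicator {0<..<1} \<theta>)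
    = (\<lambda>\<theta>. ennreal (\<theta> * w_weight \<alpha> \<theta>) * ennreal ((\<nu> * (c0 \<theta> * I.Z t \<theta>))\<^sup>2) * indicator {0<..<1} \<theta>)"
    by (auto simp: fun_eq_iff indicator_def mode_def I.Z_def mode_rate_def)
  also have "\<dots> \<in> borel_measurable lborel" by measurable
  finally show ?thesis by (rule measurable_completion)
qed

section \<open>Integrability in time and the weak formulation\<close>

lemma Lp_imp_time_integrable:
  fixes u :: "real \<Rightarrow> 'x::{banach, second_countable_topology}"
  assumes u: "u \<in> Lp_space p T" and p: "p \<ge> 1"
  shows "integrable (time_measure T) u"
proof (rule Bochner_Integration.integrable_bound)
  show "u \<in> borel_measurable (time_measure T)" using u by (simp add: Lp_space_def)
  show "integrable (time_measure T) (\<lambda>t. 1 + norm (u t) powr p)"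
    using u finite_measure.integrable_const[OF finite_measure_time, of T "1::real"]
    by (simp add: Lp_space_def)
  show "AE t in time_measure T. norm (u t) \<le> norm (1 + norm (u t) powr p)"
    using le_1_plus_powr[OF norm_ge_zero p] by (intro AE_I2) (simp add: abs_of_nonneg)
qed

lemma integrable_on_continuous_scaleR:
  fixes u :: "real \<Rightarrow> 'x::{banach, second_countable_topology}"
  assumes u: "integrable (time_measure T) u" and k: "continuous_on UNIV k" and cd: "{c..d} \<subseteq> {0..T}"
  shows "(\<lambda>s. k s *\<^sub>R u s) integrable_on {c..d}"
proof (rule integrable_lebesgue_on_imp_integrable_on[OF _ cd])
  obtain L where L: "\<And>s. s \<in> {0..T} \<Longrightarrow> \<bar>k s\<bar> \<le> L"
    using k by (rule continuous_bounded_on_Icc) blast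
  show "integrable (time_measure T) (\<lambda>s. k s *\<^sub>R u s)"
  proof (rule Bochner_Integration.integrable_bound)
    show "integrable (time_measure T) (\<lambda>s. L * norm (u s))" using u by simp
    have "k \<in> borel_measurable (time_measure T)"
      by (intro borel_imp_time_measurable borel_measurable_continuous_onI k)
    then show "(\<lambda>s. k s *\<^sub>R u s) \<in> borel_measurable (time_measure T)"
      using borel_measurable_integrable[OF u] by (rule borel_measurable_scaleR)
    show "AE s in time_measure T. norm (k s *\<^sub>R u s) \<le> norm (L * norm (u s))"
    proof (rule AE_I2)
      fix s assume "s \<in> space (time_measure T)"
      then have "\<bar>k s\<bar> \<le> \<bar>L\<bar>" using L[of s] by (simp add: space_restrict_space)
      then show "norm (k s *\<^sub>R u s) \<le> norm (L * norm (u s))" by (simp add: abs_mult mult_right_mono)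
    qed
  qed
qed

text \<open>A bounded function against an integrable singular kernel. Existence of this integral in
  \<open>H\<close> at every \<open>t\<close> is what allows linear maps to be taken through the
  convolution.\<close>

lemma Linf_conv_integrable_on:
  fixes w :: "real \<Rightarrow> 'h::{banach, second_countable_topology}"
  assumes "w \<in> Linf_space T" and \<beta>: "\<beta> > 0" and t: "0 \<le> t" "t \<le> T"
  shows "(\<lambda>s. g_ker \<beta> (t - s) *\<^sub>R (w s - w0)) integrable_on {0..t}"
proof -
  obtain C0 where w: "w \<in> borel_measurable (time_measure T)" "AE t in time_measure T. norm (w t) \<le> C0"
    using assms(1) by (auto simp: Linf_space_def)
  define C where "C = C0 + norm w0"
  define F where "F s = g_trunc T \<beta> (t - s) *\<^sub>R (indicator {0<..<T} s *\<^sub>R (w s - w0))" for s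
  have "(\<lambda>s. w s - w0) \<in> borel_measurable (time_measure T)" using w(1) by measurable
  then have [measurable]: "(\<lambda>s. indicator {0<..<T} s *\<^sub>R (w s - w0)) \<in> borel_measurable lebesgue"
    by (subst (asm) borel_measurable_restrict_space_iff) auto
  have [measurable]: "(\<lambda>s. g_trunc T \<beta> (t - s)) \<in> borel_measurable lebesgue"
    by (rule measurable_completion) measurable
  have g: "integrable lebesgue (\<lambda>s. g_trunc T \<beta> (t - s))"
    using lborel_integrable_real_affine[OF g_trunc_integrable[OF \<beta>, of T], of "-1" t] t
    by (subst integrable_completion) auto
  have "integrable lebesgue F"
  proof (rule Bochner_Integration.integrable_bound)
    show "integrable lebesgue (\<lambda>s. g_trunc T \<beta> (t - s) * \<bar>C\<bar>)" using g by simp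
    show "F \<in> borel_measurable lebesgue" unfolding F_def by measurable
    have "AE s in lebesgue. s \<in> {0<..<T} \<longrightarrow> norm (w s) \<le> C0"
      using w(2) by (subst (asm) AE_restrict_space_iff) auto
    then show "AE s in lebesgue. norm (F s) \<le> norm (g_trunc T \<beta> (t - s) * \<bar>C\<bar>)"
    proof eventually_elim
      case (elim s)
      then have "norm (indicator {0<..<T} s *\<^sub>R (w s - w0)) \<le> \<bar>C\<bar>"
        using norm_triangle_ineq4[of "w s" w0] by (auto simp: indicator_def C_def)
      from mult_left_mono[OF this abs_ge_zero[of "g_trunc T \<beta> (t - s)"]]
      show ?case by (simp add: F_def abs_mult mult.assoc)
    qed
  qed
  then have "F integrable_on {0..t}"
    by (metis integrable_lebesgue_imp_integrable_on_cbox box_real(2))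
  then show ?thesis
    by (rule integrable_spike[where S = "{0, t}"])
       (use t in \<open>auto simp: F_def g_trunc_def g_ker_def\<close>)
qed

text \<open>Both sides of the distributional equation in \<open>X'\<close> are images of integrals
  in \<open>X\<close> and in \<open>H\<close> under the bounded maps \<open>A\<close> and
  \<open>dual_emb \<iota>\<close>; pairing with \<open>v\<close> therefore reduces them to real
  integrals.\<close>

lemma has_caputo_derivative_dual_emb:
  fixes \<iota> :: "'x::{banach, second_countable_topology} \<Rightarrow>\<^sub>L 'h::{real_inner, banach, second_countable_topology}"
  assumes \<alpha>: "\<alpha> < 1" and u: "integrable (time_measure T) u"
    and bdd: "(\<lambda>t. blinfun_apply \<iota> (u t)) \<in> Linf_space T"
    and caputo: "has_caputo_derivative \<alpha> T (dual_emb \<iota> u0) (\<lambda>t. dual_emb \<iota> (blinfun_apply \<iota> (u t))) z"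
    and eq: "\<And>v. AE t in time_measure T. blinfun_apply (z t + blinfun_apply A (u t)) v = 0"
    and cont: "continuous_on {0..T} (conv (g_ker (1 - \<alpha>)) (\<lambda>s. blinfun_apply \<iota> (u s) - u0))"
    and \<phi>: "test_function T \<phi>" "continuous_on UNIV (deriv \<phi>)"
  shows "integral {0..T} (\<lambda>t. \<phi> t * A (u t) v)
      = integral {0..T} (\<lambda>t. deriv \<phi> t * (conv (g_ker (1 - \<alpha>)) (\<lambda>s. \<iota> (u s) - u0) t \<bullet> \<iota> v))"
proof -
  define K where "K = conv (g_ker (1 - \<alpha>)) (\<lambda>s. \<iota> (u s) - u0)"
  \<comment> \<open>The exceptional null set of the equation depends on the test vector; a countable
    dense set of test vectors makes it uniform.\<close>
  obtain D :: "'x set" where D: "countable D" "\<And>X. open X \<Longrightarrow> X \<noteq> {} \<Longrightarrow> \<exists>d\<in>D. d \<in> X"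
    by (rule countable_dense_setE) blast
  have dense: "closure D = UNIV"
  proof (intro UNIV_eq_I[symmetric] iffD2[OF closure_approachable] allI impI)
    fix x :: 'x and e :: real assume "e > 0"
    then show "\<exists>y\<in>D. dist y x < e" using D(2)[of "ball x e"] by (auto simp: dist_commute)
  qed
  have "AE t in time_measure T. \<forall>v\<in>D. (z t + A (u t)) v = 0"
    using eq D(1) by (simp add: AE_ball_countable)
  then have z_eq: "AE t in time_measure T. z t = - A (u t)"
  proof eventually_elim
    case (elim t)
    have "closed {v. (z t + A (u t)) v = 0}" by (intro closed_Collect_eq continuous_intros)
    moreover have "D \<subseteq> {v. (z t + A (u t)) v = 0}" using elim by blast
    ultimately have "closure D \<subseteq> {v. (z t + A (u t)) v = 0}" by (rule closure_minimal[rotated])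
    then have "z t + A (u t) = 0" using dense by (intro blinfun_eqI) auto
    then show ?case by (simp add: eq_neg_iff_add_eq_0)
  qed
  have "AE t in lebesgue. t \<in> {0<..<T} \<longrightarrow> z t = - A (u t)"
    using z_eq by (subst (asm) AE_restrict_space_iff) auto
  then obtain N where N: "N \<in> null_sets lebesgue" "{t. \<not> (t \<in> {0<..<T} \<longrightarrow> z t = - A (u t))} \<subseteq> N"
    unfolding eventually_ae_filter by auto
  have \<phi>_cont: "continuous_on UNIV \<phi>"
  proof -
    have "(deriv ^^ 0) \<phi> field_differentiable at x" for x
      using \<phi>(1) unfolding test_function_def by blast
    then show ?thesis
      by (auto intro!: continuous_at_imp_continuous_on field_differentiable_imp_continuous_at)
  qed
  have \<phi>u: "(\<lambda>t. \<phi> t *\<^sub>R u t) integrable_on {0..T}"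
    by (rule integrable_on_continuous_scaleR[OF u \<phi>_cont]) simp
  have "integral {0..T} (\<lambda>t. \<phi> t *\<^sub>R z t) = integral {0..T} (\<lambda>t. - A (\<phi> t *\<^sub>R u t))"
  proof (rule integral_spike[of "N \<union> {0, T}"])
    show "negligible (N \<union> {0, T})" using N(1) by (simp add: negligible_iff_null_sets)
    fix t assume "t \<in> {0..T} - (N \<union> {0, T})"
    then have "t \<in> {0<..<T}" "t \<notin> N" by auto
    then have "z t = - A (u t)" using N(2) by blast
    then show "- A (\<phi> t *\<^sub>R u t) = \<phi> t *\<^sub>R z t" by (simp add: blinfun.scaleR_right)
  qed
  also have "\<dots> = - A (integral {0..T} (\<lambda>t. \<phi> t *\<^sub>R u t))"
    using integral_linear[OF \<phi>u blinfun.bounded_linear_right[of A]] by (simp add: o_def)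
  finally have left: "integral {0..T} (\<lambda>t. \<phi> t *\<^sub>R z t) = - A (integral {0..T} (\<lambda>t. \<phi> t *\<^sub>R u t))" .
  have left': "A (integral {0..T} (\<lambda>t. \<phi> t *\<^sub>R u t)) v = integral {0..T} (\<lambda>t. \<phi> t * A (u t) v)"
    using integral_linear[OF \<phi>u bounded_linear_compose[OF blinfun.bounded_linear_left[of v] blinfun.bounded_linear_right[of A]]]
    by (simp add: o_def blinfun.scaleR_right blinfun.scaleR_left)
  have conv_int: "(\<lambda>s. g_ker (1 - \<alpha>) (t - s) *\<^sub>R (\<iota> (u s) - u0)) integrable_on {0..t}" if "t \<in> {0..T}" for t
    by (rule Linf_conv_integrable_on[OF bdd]) (use that \<alpha> in auto)
  have "conv (g_ker (1 - \<alpha>)) (\<lambda>s. dual_emb \<iota> (\<iota> (u s)) - dual_emb \<iota> u0) t = dual_emb \<iota> (K t)"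
    if "t \<in> {0..T}" for t
    using integral_linear[OF conv_int[OF that] dual_emb_bounded_linear[of \<iota>]]
    by (simp add: conv_def K_def o_def linear_diff[OF bounded_linear.linear[OF dual_emb_bounded_linear]]
        linear_scale[OF bounded_linear.linear[OF dual_emb_bounded_linear]])
  then have "integral {0..T} (\<lambda>t. deriv \<phi> t *\<^sub>R conv (g_ker (1 - \<alpha>)) (\<lambda>s. dual_emb \<iota> (\<iota> (u s)) - dual_emb \<iota> u0) t)
      = integral {0..T} (\<lambda>t. dual_emb \<iota> (deriv \<phi> t *\<^sub>R K t))"
    by (intro integral_cong) (simp add: linear_scale[OF bounded_linear.linear[OF dual_emb_bounded_linear]])
  moreover have K_int: "(\<lambda>t. deriv \<phi> t *\<^sub>R K t) integrable_on {0..T}"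
    unfolding K_def
    by (intro integrable_continuous_real continuous_on_scaleR cont continuous_on_subset[OF \<phi>(2)]) auto
  moreover have "dual_emb \<iota> (integral {0..T} (\<lambda>t. deriv \<phi> t *\<^sub>R K t)) = integral {0..T} (\<lambda>t. dual_emb \<iota> (deriv \<phi> t *\<^sub>R K t))"
    using integral_linear[OF K_int dual_emb_bounded_linear[of \<iota>]] by (simp add: o_def)
  ultimately have right: "integral {0..T} (\<lambda>t. deriv \<phi> t *\<^sub>R conv (g_ker (1 - \<alpha>)) (\<lambda>s. dual_emb \<iota> (\<iota> (u s)) - dual_emb \<iota> u0) t)
      = dual_emb \<iota> (integral {0..T} (\<lambda>t. deriv \<phi> t *\<^sub>R K t))" by simp
  have right': "dual_emb \<iota> (integral {0..T} (\<lambda>t. deriv \<phi> t *\<^sub>R K t)) v = integral {0..T} (\<lambda>t. deriv \<phi> t * (K t \<bullet> \<iota> v))"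
    using integral_linear[OF K_int bounded_linear_inner_left[of "\<iota> v"]] by (simp add: o_def)
  have "integral {0..T} (\<lambda>t. \<phi> t *\<^sub>R z t)
      = - integral {0..T} (\<lambda>t. deriv \<phi> t *\<^sub>R conv (g_ker (1 - \<alpha>)) (\<lambda>s. dual_emb \<iota> (\<iota> (u s)) - dual_emb \<iota> u0) t)"
    using caputo \<phi>(1) unfolding has_caputo_derivative_def by blast
  then have "A (integral {0..T} (\<lambda>t. \<phi> t *\<^sub>R u t)) = dual_emb \<iota> (integral {0..T} (\<lambda>t. deriv \<phi> t *\<^sub>R K t))"
    unfolding left right by simp
  then have "A (integral {0..T} (\<lambda>t. \<phi> t *\<^sub>R u t)) v = dual_emb \<iota> (integral {0..T} (\<lambda>t. deriv \<phi> t *\<^sub>R K t)) v"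
    by simp
  then show ?thesis unfolding K_def[symmetric] left'[symmetric] right'[symmetric] .
qed


text \<open>Tested with an eigenvector, the equation is real and closed: its memory term plus \<nu>
  times the antiderivative of \<open>y\<close> has distributional derivative zero. Du Bois-Reymond
  makes this sum constant, and the initial condition makes the constant zero.\<close>

lemma scalar_equation:
  fixes \<iota> :: "'x::{banach, second_countable_topology} \<Rightarrow>\<^sub>L 'h::{real_inner, banach, second_countable_topology}"
    and A :: "'x \<Rightarrow>\<^sub>L ('x \<Rightarrow>\<^sub>L real)"
  assumes T: "T > 0" and \<alpha>: "0 < \<alpha>" "\<alpha> < 1" and p: "p > 1"
    and grad: "\<And>v. grad_H E v = A v"
    and eig: "\<And>v. A v e = \<nu> * (\<iota> v \<bullet> \<iota> e)"
    and sol: "variational_solution \<iota> E \<alpha> p T u0 u"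
  obtains y M N where "y \<in> borel_measurable borel" "\<And>t. \<bar>y t\<bar> \<le> M" "\<And>t. t \<notin> {0<..<T} \<Longrightarrow> y t = 0"
    "negligible N" "\<And>t. t \<in> {0<..<T} \<Longrightarrow> t \<notin> N \<Longrightarrow> y t = \<iota> (u t) \<bullet> \<iota> e"
    "\<And>t. t \<in> {0<..<T} \<Longrightarrow>
      integral {0..t} (\<lambda>s. g_ker (1 - \<alpha>) (t - s) * (y s - u0 \<bullet> \<iota> e)) = - \<nu> * integral {0..t} y"
proof -
  define K where "K = conv (g_ker (1 - \<alpha>)) (\<lambda>s. \<iota> (u s) - u0)"
  obtain z where uLp: "u \<in> Lp_space p T" and bdd: "(\<lambda>t. \<iota> (u t)) \<in> Linf_space T"
    and caputo: "has_caputo_derivative \<alpha> T (dual_emb \<iota> u0) (\<lambda>t. dual_emb \<iota> (\<iota> (u t))) z"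
    and eq: "\<And>v. AE t in time_measure T. (z t + A (u t)) v = 0"
    and cont: "continuous_on {0..T} K" and init: "(K \<longlongrightarrow> 0) (at_right 0)"
    using sol unfolding variational_solution_def grad K_def by blast
  have u_int: "integrable (time_measure T) u"
    using p by (intro Lp_imp_time_integrable[OF uLp]) simp
  have \<iota>u_meas: "(\<lambda>t. \<iota> (u t)) \<in> borel_measurable (time_measure T)"
    using bdd by (simp add: Linf_space_def)
  obtain C where C: "AE t in time_measure T. norm (\<iota> (u t)) \<le> C"
    using bdd by (auto simp: Linf_space_def)
  define f where "f t = \<iota> (u t) \<bullet> \<iota> e" for t
  define M where "M = \<bar>C\<bar> * norm (\<iota> e)"
  have "f \<in> borel_measurable (time_measure T)" unfolding f_def using \<iota>u_meas by measurable
  moreover have "AE t in time_measure T. \<bar>f t\<bar> \<le> M"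
    using C
  proof eventually_elim
    case (elim t)
    have "\<bar>f t\<bar> \<le> norm (\<iota> (u t)) * norm (\<iota> e)" unfolding f_def by (rule Cauchy_Schwarz_ineq2)
    also have "\<dots> \<le> M" unfolding M_def using elim by (intro mult_right_mono) auto
    finally show ?case .
  qed
  moreover have "0 \<le> M" by (simp add: M_def)
  ultimately obtain y N where y: "y \<in> borel_measurable borel" "\<And>t. \<bar>y t\<bar> \<le> M" "\<And>t. t \<notin> {0<..<T} \<Longrightarrow> y t = 0"
    and N: "negligible N" "\<And>t. t \<in> {0<..<T} \<Longrightarrow> t \<notin> N \<Longrightarrow> y t = f t"
    by (rule borel_representative) blast
  have conv_int: "(\<lambda>s. g_ker (1 - \<alpha>) (t - s) *\<^sub>R (\<iota> (u s) - u0)) integrable_on {0..t}" if "t \<in> {0..T}" for t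
    by (rule Linf_conv_integrable_on[OF bdd]) (use that \<alpha> in auto)
  have K_eq: "K t \<bullet> \<iota> e = integral {0..t} (\<lambda>s. g_ker (1 - \<alpha>) (t - s) * (y s - u0 \<bullet> \<iota> e))"
    if "t \<in> {0<..<T}" for t
  proof -
    have "K t \<bullet> \<iota> e = integral {0..t} (\<lambda>s. g_ker (1 - \<alpha>) (t - s) * (f s - u0 \<bullet> \<iota> e))"
      using integral_linear[OF conv_int bounded_linear_inner_left[of "\<iota> e"], of t] that
      by (simp add: K_def conv_def o_def f_def inner_diff_left)
    also have "\<dots> = integral {0..t} (\<lambda>s. g_ker (1 - \<alpha>) (t - s) * (y s - u0 \<bullet> \<iota> e))"
      by (rule integral_spike[of "N \<union> {0}"]) (use N that in auto)
    finally show ?thesis .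
  qed
  define \<Lambda> where "\<Lambda> t = integral {0..t} y" for t
  have \<Lambda>_cont: "continuous_on {0..T} \<Lambda>"
    unfolding \<Lambda>_def by (intro indefinite_integral_continuous_1 bounded_borel_integrable_on[OF y(1,2)])
  define \<psi> where "\<psi> t = K t \<bullet> \<iota> e + \<nu> * \<Lambda> t" for t
  have \<psi>_cont: "continuous_on {0<..<T} \<psi>"
    unfolding \<psi>_def
    by (intro continuous_intros continuous_on_subset[OF cont] continuous_on_subset[OF \<Lambda>_cont]) auto
  have test: "integral {0..T} (\<lambda>t. deriv \<phi> t * \<psi> t) = 0"
    if \<phi>: "test_function T \<phi>" "continuous_on UNIV (deriv \<phi>)" for \<phi>
  proof -
    have "(deriv ^^ 0) \<phi> field_differentiable at t" for t
      using \<phi>(1) unfolding test_function_def by blast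
    then have D: "(\<phi> has_real_derivative deriv \<phi> t) (at t)" for t
      by (simp add: DERIV_deriv_iff_field_differentiable)
    have "\<phi> T = 0" using \<phi>(1) unfolding test_function_def by (metis greaterThanLessThan_iff less_irrefl subsetD)
    have 1: "integral {0..T} (\<lambda>t. \<phi> t * y t) = - integral {0..T} (\<lambda>t. deriv \<phi> t * \<Lambda> t)"
      unfolding \<Lambda>_def using T D \<phi>(2) \<open>\<phi> T = 0\<close> by (intro integral_by_parts_test_function[OF y(1,2)]) auto
    have "integral {0..T} (\<lambda>t. deriv \<phi> t * (K t \<bullet> \<iota> e)) = integral {0..T} (\<lambda>t. \<phi> t * A (u t) e)"
      unfolding K_def
      by (rule has_caputo_derivative_dual_emb[symmetric, OF \<alpha>(2) u_int bdd caputo eq _ \<phi>]) (use cont in \<open>simp add: K_def\<close>)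
    also have "\<dots> = integral {0..T} (\<lambda>t. \<nu> * (\<phi> t * y t))"
      by (rule integral_spike[of "N \<union> {0, T}"]) (use N in \<open>auto simp: eig f_def\<close>)
    also have "\<dots> = - (\<nu> * integral {0..T} (\<lambda>t. deriv \<phi> t * \<Lambda> t))" using 1 by simp
    finally have 2: "integral {0..T} (\<lambda>t. deriv \<phi> t * (K t \<bullet> \<iota> e)) = - (\<nu> * integral {0..T} (\<lambda>t. deriv \<phi> t * \<Lambda> t))" .
    have "(\<lambda>t. deriv \<phi> t * (K t \<bullet> \<iota> e)) integrable_on {0..T}"
      by (intro integrable_continuous_real continuous_intros cont continuous_on_subset[OF \<phi>(2)]) auto
    moreover have "(\<lambda>t. \<nu> * (deriv \<phi> t * \<Lambda> t)) integrable_on {0..T}"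
      by (intro integrable_continuous_real continuous_intros \<Lambda>_cont continuous_on_subset[OF \<phi>(2)]) auto
    moreover have "deriv \<phi> t * \<psi> t = deriv \<phi> t * (K t \<bullet> \<iota> e) + \<nu> * (deriv \<phi> t * \<Lambda> t)" for t
      by (simp add: \<psi>_def algebra_simps)
    ultimately have "integral {0..T} (\<lambda>t. deriv \<phi> t * \<psi> t)
        = integral {0..T} (\<lambda>t. deriv \<phi> t * (K t \<bullet> \<iota> e)) + integral {0..T} (\<lambda>t. \<nu> * (deriv \<phi> t * \<Lambda> t))"
      by (simp only: Henstock_Kurzweil_Integration.integral_add)
    then show ?thesis using 2 by simp
  qed
  have const: "\<psi> s = \<psi> t" if "s \<in> {0<..<T}" "t \<in> {0<..<T}" for s t
    using du_Bois_Reymond[OF \<psi>_cont test that] du_Bois_Reymond[OF \<psi>_cont test that(2,1)] by linarith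
  have "\<Lambda> 0 = 0" by (simp add: \<Lambda>_def)
  moreover have "(\<Lambda> \<longlongrightarrow> \<Lambda> 0) (at 0 within {0..T})"
    using \<Lambda>_cont T by (auto simp: continuous_on_def)
  then have "(\<Lambda> \<longlongrightarrow> \<Lambda> 0) (at_right 0)"
    using T by (simp add: at_within_Icc_at_right)
  ultimately have "(\<psi> \<longlongrightarrow> 0 \<bullet> \<iota> e + \<nu> * 0) (at_right 0)"
    unfolding \<psi>_def by (intro tendsto_intros init) simp
  then have lim: "(\<psi> \<longlongrightarrow> 0) (at_right 0)" by simp
  have zero: "\<psi> t = 0" if "t \<in> {0<..<T}" for t
  proof -
    have "\<forall>\<^sub>F s in at_right 0. \<psi> s = \<psi> t"
      using eventually_at_right_real[OF T] by eventually_elim (rule const[OF _ that])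
    then have "(\<psi> \<longlongrightarrow> \<psi> t) (at_right 0)" by (rule tendsto_eventually)
    then show ?thesis using lim by (rule tendsto_unique[rotated]) simp
  qed
  show thesis
  proof (rule that[OF y N(1)])
    show "y t = \<iota> (u t) \<bullet> \<iota> e" if "t \<in> {0<..<T}" "t \<notin> N" for t
      using N(2)[OF that] by (simp add: f_def)
    show "integral {0..t} (\<lambda>s. g_ker (1 - \<alpha>) (t - s) * (y s - u0 \<bullet> \<iota> e)) = - \<nu> * integral {0..t} y"
      if "t \<in> {0<..<T}" for t
      using zero[OF that] K_eq[OF that] by (simp add: \<psi>_def \<Lambda>_def)
  qed
qed

text \<open>By linearity the value of \<open>G_aug\<close> is again of the form \<open>A v\<close>,
  with \<open>v\<close> a multiple of an integral in \<open>X\<close>; so the series for the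
  extended norm applies to it, also when it is infinite.\<close>

lemma ext_norm_H_G_aug:
  fixes \<iota> :: "'x::{banach, second_countable_topology} \<Rightarrow>\<^sub>L 'h::{real_inner, banach, second_countable_topology}"
    and A :: "'x \<Rightarrow>\<^sub>L ('x \<Rightarrow>\<^sub>L real)"
  assumes u: "integrable (time_measure T) u" and t: "0 \<le> t" "t \<le> T"
    and grad: "\<And>v. grad_H E v = A v"
    and ext: "\<And>v. (ext_norm_H \<iota> (A v))\<^sup>2 = (\<Sum>k. ennreal ((\<nu> k * (\<iota> v \<bullet> \<iota> (x k)))\<^sup>2))"
    and y: "\<And>k. negligible (N k)" "\<And>k t. t \<in> {0<..<T} \<Longrightarrow> t \<notin> N k \<Longrightarrow> y k t = \<iota> (u t) \<bullet> \<iota> (x k)"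
  shows "(ext_norm_H \<iota> (G_aug E u t \<theta>))\<^sup>2 = (\<Sum>k. ennreal ((\<nu> k * (c0 \<theta> * mode (y k) t \<theta>))\<^sup>2))"
proof -
  define k where "k s = exp (- c1 \<theta> * (t - s))" for s
  have int: "(\<lambda>s. k s *\<^sub>R u s) integrable_on {0..t}"
    unfolding k_def using t by (intro integrable_on_continuous_scaleR[OF u] continuous_intros) auto
  define U where "U = integral {0..t} (\<lambda>s. k s *\<^sub>R u s)"
  have "integral {0..t} (\<lambda>s. k s *\<^sub>R grad_H E (u s)) = A U"
    using integral_linear[OF int blinfun.bounded_linear_right[of A]]
    by (simp add: U_def o_def grad blinfun.scaleR_right)
  then have G: "G_aug E u t \<theta> = A (- c0 \<theta> *\<^sub>R U)"
    by (simp add: G_aug_def k_def blinfun.scaleR_right blinfun.minus_right)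
  have modes: "\<iota> U \<bullet> \<iota> (x j) = mode (y j) t \<theta>" for j
  proof -
    have "\<iota> U \<bullet> \<iota> (x j) = integral {0..t} (\<lambda>s. k s * (\<iota> (u s) \<bullet> \<iota> (x j)))"
      using integral_linear[OF int bounded_linear_compose[OF bounded_linear_inner_left[of "\<iota> (x j)"]
          blinfun.bounded_linear_right[of \<iota>]]]
      by (simp add: U_def o_def blinfun.scaleR_right)
    also have "\<dots> = integral {0..t} (\<lambda>s. k s * y j s)"
      by (rule integral_spike[of "N j \<union> {0, T}"]) (use y t in auto)
    finally show ?thesis by (simp add: mode_def k_def)
  qed
  show ?thesis
    unfolding G ext by (simp add: blinfun.scaleR_right blinfun.minus_right modes)
qed

text \<open>The null set \<open>N\<close> appears because \<open>u\<close> stands for a class in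
  \<open>L^p\<close> and may be changed on null sets. Over the countably many modes it collects the
  times where the coefficient of \<open>u t\<close> differs from its Borel representative, or that
  one from its continuous version.\<close>

theorem corollary3:
  fixes \<iota> :: "'x::{banach, second_countable_topology} \<Rightarrow>\<^sub>L
              'h::{real_inner, banach, second_countable_topology}"
    and E :: "'x \<Rightarrow> real"
    and T \<alpha> p C0 C1 C2 :: real
    and u0 :: 'h
    and u :: "real \<Rightarrow> 'x"
  assumes "T > 0" and "0 < \<alpha>" and "\<alpha> < 1"
    and "reflexive TYPE('x)"
    and "compact_dense_embedding \<iota>"
    and "C1_functional E"
    and "p > 1" and "C0 > 0" and "C1 > 0" and "C2 > 0"
    and "\<And>v. norm (grad_H E v) \<le> C0 * norm v powr (p - 1) + C0"
    and "\<And>v. gateaux E v v \<ge> C1 * norm v powr p - C2 * (norm (blinfun_apply \<iota> v))\<^sup>2"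
    and "weak_to_weak_continuous p (p / (p - 1)) T (grad_H E)"
    and "variational_solution \<iota> E \<alpha> p T u0 u"
  shows "\<exists>N \<in> null_sets lebesgue. antimono_on ({0<..<T} - N) (augmented_energy \<iota> E \<alpha> u)"
proof -
  note \<alpha> = assms(2,3)
  obtain A where form: "garding_form \<iota> A C1 C2" and grad: "\<And>v. grad_H E v = A v"
    and energy: "\<And>v. E v = E 0 + A v v / 2"
    using gradient_is_garding_form[OF assms(1,5,6,7,9,11,12,13)] by blast
  interpret garding_form \<iota> A C1 C2 by (rule form)
  obtain x \<nu> where eig: "\<And>k v. A v (x k) = \<nu> k * (\<iota> v \<bullet> \<iota> (x k))"
    and quad: "\<And>v. (\<lambda>k. \<nu> k * (\<iota> v \<bullet> \<iota> (x k))\<^sup>2) sums A v v"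
    and ext: "\<And>v. (ext_norm_H \<iota> (A v))\<^sup>2 = (\<Sum>k. ennreal ((\<nu> k * (\<iota> v \<bullet> \<iota> (x k)))\<^sup>2))"
    by (rule eigenbasis) blast
  have u_int: "integrable (time_measure T) u"
    using assms(7,14) by (intro Lp_imp_time_integrable[where p = p]) (auto simp: variational_solution_def)
  \<comment> \<open>One predicate for all properties, so that choice over \<open>k\<close> yields
    the three sequences at once.\<close>
  define is_mode where "is_mode k y M N \<longleftrightarrow>
    y \<in> borel_measurable borel \<and> (\<forall>t. \<bar>y t\<bar> \<le> M) \<and> (\<forall>t. t \<notin> {0<..<T} \<longrightarrow> y t = 0) \<and>
    negligible N \<and> (\<forall>t\<in>{0<..<T}. t \<notin> N \<longrightarrow> y t = \<iota> (u t) \<bullet> \<iota> (x k)) \<and>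
    (\<forall>t\<in>{0<..<T}. integral {0..t} (\<lambda>s. g_ker (1 - \<alpha>) (t - s) * (y s - u0 \<bullet> \<iota> (x k))) = - \<nu> k * integral {0..t} y)"
    for k y M N
  have "\<exists>y M N. is_mode k y M N" for k
    by (rule scalar_equation[OF assms(1) \<alpha> assms(7) grad eig[of _ k] assms(14)])
      (intro exI, unfold is_mode_def, intro conjI allI impI ballI)
  then obtain y M N1 where "\<And>k. is_mode k (y k) (M k) (N1 k)"
    by metis
  then have y: "\<And>k. y k \<in> borel_measurable borel" "\<And>k t. \<bar>y k t\<bar> \<le> M k"
      "\<And>k t. t \<notin> {0<..<T} \<Longrightarrow> y k t = 0"
    and N1: "\<And>k. negligible (N1 k)" "\<And>k t. t \<in> {0<..<T} \<Longrightarrow> t \<notin> N1 k \<Longrightarrow> y k t = \<iota> (u t) \<bullet> \<iota> (x k)"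
    and y_eq: "\<And>k t. t \<in> {0<..<T} \<Longrightarrow>
      integral {0..t} (\<lambda>s. g_ker (1 - \<alpha>) (t - s) * (y k s - u0 \<bullet> \<iota> (x k))) = - \<nu> k * integral {0..t} (y k)"
    unfolding is_mode_def by blast+
  define decreasing_off where "decreasing_off k N \<longleftrightarrow> N \<in> null_sets lborel \<and>
      (\<forall>t\<in>{0<..<T}. mode_energy \<alpha> (\<nu> k) (y k) t < \<infinity>) \<and>
      (\<forall>t1\<in>{0<..<T} - N. \<forall>t2\<in>{0<..<T} - N. t1 \<le> t2 \<longrightarrow>
        \<nu> k * (y k t2)\<^sup>2 + enn2real (mode_energy \<alpha> (\<nu> k) (y k) t2)
        \<le> \<nu> k * (y k t1)\<^sup>2 + enn2real (mode_energy \<alpha> (\<nu> k) (y k) t1))" for k N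
  have "\<exists>N. decreasing_off k N" for k
    by (rule scalar_mode_energy_decreasing[OF \<alpha> assms(1) y(1)[of k] y(2)[of k] y(3)[of _ k] y_eq[of _ k]])
      (unfold decreasing_off_def, blast+)
  then obtain N2 where "\<And>k. decreasing_off k (N2 k)"
    by metis
  then have N2: "\<And>k. N2 k \<in> null_sets lborel"
    and finite: "\<And>k t. t \<in> {0<..<T} \<Longrightarrow> mode_energy \<alpha> (\<nu> k) (y k) t < \<infinity>"
    and decreasing: "\<And>k t1 t2. t1 \<in> {0<..<T} - N2 k \<Longrightarrow> t2 \<in> {0<..<T} - N2 k \<Longrightarrow> t1 \<le> t2 \<Longrightarrow>
        \<nu> k * (y k t2)\<^sup>2 + enn2real (mode_energy \<alpha> (\<nu> k) (y k) t2)
        \<le> \<nu> k * (y k t1)\<^sup>2 + enn2real (mode_energy \<alpha> (\<nu> k) (y k) t1)"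
    unfolding decreasing_off_def by blast+
  define N where "N = (\<Union>k. N1 k \<union> N2 k)"
  have "N1 k \<in> null_sets lebesgue" "N2 k \<in> null_sets lebesgue" for k
    using N1(1)[of k] N2[of k] by (auto simp: negligible_iff_null_sets null_sets_completionI)
  then have N: "N \<in> null_sets lebesgue"
    unfolding N_def by (intro null_sets_UN' null_sets.Un) auto
  define e where "e t k = \<nu> k * (y k t)\<^sup>2 / 2" for t k
  define h where "h t k = enn2real (mode_energy \<alpha> (\<nu> k) (y k) t) / 2" for t k
  have h: "0 \<le> h t k" for t k by (simp add: h_def)
  have potential: "e t sums (E (u t) - E 0)" if "t \<in> {0<..<T} - N" for t
  proof -
    have "y k t = \<iota> (u t) \<bullet> \<iota> (x k)" for k using N1(2)[of t k] that by (auto simp: N_def)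
    then have "e t = (\<lambda>k. \<nu> k * (\<iota> (u t) \<bullet> \<iota> (x k))\<^sup>2 / 2)" by (simp add: e_def fun_eq_iff)
    moreover have "(\<lambda>k. \<nu> k * (\<iota> (u t) \<bullet> \<iota> (x k))\<^sup>2 / 2) sums (A (u t) (u t) / 2)"
      by (rule sums_divide[OF quad])
    moreover have "A (u t) (u t) / 2 = E (u t) - E 0" using energy[of "u t"] by linarith
    ultimately show ?thesis by simp
  qed
  \<comment> \<open>All terms are nonnegative, so the sum over the modes leaves the integral by
    monotone convergence. Finiteness of each single mode energy makes the passage to the real
    numbers \<open>h t k\<close> lossless; their sum may still be infinite.\<close>
  have history: "H_aug \<iota> \<alpha> (G_aug E u t) = (\<Sum>k. ennreal (h t k))" if t: "t \<in> {0<..<T}" for t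
  proof -
    define I where "I k \<theta> = ennreal (\<theta> * w_weight \<alpha> \<theta>) * ennreal ((\<nu> k * (c0 \<theta> * mode (y k) t \<theta>))\<^sup>2)
       * indicator {0<..<1} \<theta>" for k \<theta>
    have "ennreal (\<theta> * w_weight \<alpha> \<theta>) * (ext_norm_H \<iota> (G_aug E u t \<theta>))\<^sup>2 * indicator {0<..<1} \<theta> = (\<Sum>k. I k \<theta>)" for \<theta>
    proof -
      have "(ext_norm_H \<iota> (G_aug E u t \<theta>))\<^sup>2 = (\<Sum>k. ennreal ((\<nu> k * (c0 \<theta> * mode (y k) t \<theta>))\<^sup>2))"
        using t N1 by (intro ext_norm_H_G_aug[OF u_int _ _ grad ext, where N = N1]) auto
      then show ?thesis by (simp add: I_def)
    qed
    then have "H_aug \<iota> \<alpha> (G_aug E u t) = ennreal (1 / 2) * (\<integral>\<^sup>+\<theta>. (\<Sum>k. I k \<theta>) \<partial>lebesgue)"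
      by (simp add: H_aug_def)
    also have "(\<integral>\<^sup>+\<theta>. (\<Sum>k. I k \<theta>) \<partial>lebesgue) = (\<Sum>k. \<integral>\<^sup>+\<theta>. I k \<theta> \<partial>lebesgue)"
      unfolding I_def using mode_measurable[OF \<alpha> y(1) y(2)] by (intro nn_integral_suminf) auto
    also have "\<dots> = (\<Sum>k. mode_energy \<alpha> (\<nu> k) (y k) t)"
      by (simp add: I_def mode_energy_def)
    also have "ennreal (1 / 2) * \<dots> = (\<Sum>k. ennreal (1 / 2) * mode_energy \<alpha> (\<nu> k) (y k) t)"
      by simp
    also have "\<dots> = (\<Sum>k. ennreal (h t k))"
    proof (rule suminf_cong)
      fix k
      have "ennreal (1 / 2) * ennreal (enn2real (mode_energy \<alpha> (\<nu> k) (y k) t))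
          = ennreal (1 / 2 * enn2real (mode_energy \<alpha> (\<nu> k) (y k) t))"
        by (rule ennreal_mult[symmetric]) auto
      also have "ennreal (enn2real (mode_energy \<alpha> (\<nu> k) (y k) t)) = mode_energy \<alpha> (\<nu> k) (y k) t"
        using finite[OF t, of k] by simp
      finally show "ennreal (1 / 2) * mode_energy \<alpha> (\<nu> k) (y k) t = ennreal (h t k)"
        by (simp add: h_def)
    qed
    finally show ?thesis .
  qed
  have "augmented_energy \<iota> E \<alpha> u t2 \<le> augmented_energy \<iota> E \<alpha> u t1"
    if t: "t1 \<in> {0<..<T} - N" "t2 \<in> {0<..<T} - N" "t1 \<le> t2" for t1 t2
  proof -
    \<comment> \<open>The constant \<open>E 0\<close> is separated because the quadratic terms sum
      to \<open>E (u t) - E 0\<close>.\<close>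
    have split: "augmented_energy \<iota> E \<alpha> u t = ereal (E 0) + (ereal (E (u t) - E 0) + enn2ereal (\<Sum>k. ennreal (h t k)))"
      if "t \<in> {0<..<T}" for t
      unfolding augmented_energy_def history[OF that] add.assoc[symmetric] by simp
    have "e t2 k + h t2 k \<le> e t1 k + h t1 k" for k
      using decreasing[of t1 k t2] t by (auto simp: e_def h_def N_def)
    then have "ereal (E (u t2) - E 0) + enn2ereal (\<Sum>k. ennreal (h t2 k))
        \<le> ereal (E (u t1) - E 0) + enn2ereal (\<Sum>k. ennreal (h t1 k))"
      by (intro sum_energy_mono[OF potential potential]) (use t h in auto)
    then show ?thesis using t by (simp add: split add_left_mono)
  qed
  then show ?thesis using N by (intro bexI[of _ N] monotone_onI) auto
qed

end
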